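(* For any one-parameter unipotent subgroup $\{u(t)\}_{t\in\mathbb R}$ of $\operatorname{PSL}(2,\mathbb R)$, there is an uncountable dense subset $E$ of $\operatorname{PSL}(2,\mathbb R)/\operatorname{PSL}(2,\mathbb Z)$ such that for every $x\in E$, the set $\{u(n^2)x:n\in\mathbb N\}$ is dense in $\operatorname{PSL}(2,\mathbb R)/\operatorname{PSL}(2,\mathbb Z)$. Moreover, the Hausdorff dimension of $E$ is strictly greater than $2$.
   Context: A one-parameter unipotent subgroup is a one-parameter subgroup $\{u(t)\}$ of $\operatorname{PSL}(2,\mathbb R)$ with every $u(t)$ unipotent. Hausdorff dimension is taken with respect to the metric on $\operatorname{PSL}(2,\mathbb R)/\operatorname{PSL}(2,\mathbb Z)$ induced by a fixed norm on the Lie algebra of $\operatorname{PSL}(2,\mathbb R)$ (a 3-dimensional Riemannian manifold). *)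

theory Defs
  imports "HOL-Analysis.Analysis"
begin

type_synonym mat2 = "real^2^2"

definition SL2R :: "mat2 set" where
  "SL2R = {A. det A = 1}"

definition SL2Z :: "mat2 set" where
  "SL2Z = {A. det A = 1 \<and> (\<forall>i j. A $ i $ j \<in> \<int>)}"

definition sl2 :: "mat2 set" where
  "sl2 = {M. trace M = 0}"

definition is_norm_on_sl2 :: "(mat2 \<Rightarrow> real) \<Rightarrow> bool" where
  "is_norm_on_sl2 N \<longleftrightarrow>
     (\<forall>M\<in>sl2. \<forall>M'\<in>sl2. N (M + M') \<le> N M + N M') \<and>
     (\<forall>M\<in>sl2. \<forall>c. N (c *\<^sub>R M) = \<bar>c\<bar> * N M) \<and>
     (\<forall>M\<in>sl2. M \<noteq> 0 \<longrightarrow> N M > 0)"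

definition sl2_curve :: "(real \<Rightarrow> mat2) \<Rightarrow> mat2 \<Rightarrow> mat2 \<Rightarrow> bool" where
  "sl2_curve \<gamma> A B \<longleftrightarrow> \<gamma> 0 = A \<and> \<gamma> 1 = B \<and> (\<forall>t\<in>{0..1}. \<gamma> t \<in> SL2R) \<and>
     (\<exists>\<gamma>'. (\<forall>t\<in>{0..1}. (\<gamma> has_vector_derivative \<gamma>' t) (at t within {0..1}))
          \<and> continuous_on {0..1} \<gamma>')"

text \<open>Length w.r.t. the right-invariant metric determined by the norm N on the Lie algebra.\<close>
definition curve_length :: "(mat2 \<Rightarrow> real) \<Rightarrow> (real \<Rightarrow> mat2) \<Rightarrow> real" where
  "curve_length N \<gamma> =
     integral {0..1} (\<lambda>t. N (vector_derivative \<gamma> (at t within {0..1}) ** matrix_inv (\<gamma> t)))"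

definition distG :: "(mat2 \<Rightarrow> real) \<Rightarrow> mat2 \<Rightarrow> mat2 \<Rightarrow> real" where
  "distG N A B = Inf {curve_length N \<gamma> | \<gamma>. sl2_curve \<gamma> A B}"

text \<open>The homogeneous space X = SL(2,R)/SL(2,Z) = PSL(2,R)/PSL(2,Z), points are cosets A SL(2,Z).\<close>
definition Xsp :: "mat2 set set" where
  "Xsp = {(\<lambda>g. A ** g) ` SL2Z | A. A \<in> SL2R}"

definition distX :: "(mat2 \<Rightarrow> real) \<Rightarrow> mat2 set \<Rightarrow> mat2 set \<Rightarrow> real" where
  "distX N C D = Inf {distG N A B | A B. A \<in> C \<and> B \<in> D}"

definition act :: "mat2 \<Rightarrow> mat2 set \<Rightarrow> mat2 set" where
  "act g C = (\<lambda>A. g ** A) ` C"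

definition hdiam :: "('a \<Rightarrow> 'a \<Rightarrow> real) \<Rightarrow> 'a set \<Rightarrow> ennreal" where
  "hdiam d U = (SUP p\<in>U \<times> U. ennreal (d (fst p) (snd p)))"

definition hausdorff_content ::
    "('a \<Rightarrow> 'a \<Rightarrow> real) \<Rightarrow> 'a set \<Rightarrow> real \<Rightarrow> real \<Rightarrow> 'a set \<Rightarrow> ennreal" where
  "hausdorff_content d S s \<delta> E =
     (INF U\<in>{U :: nat \<Rightarrow> 'a set. (\<forall>i. U i \<subseteq> S \<and> hdiam d (U i) \<le> ennreal \<delta>) \<and> E \<subseteq> (\<Union>i. U i)}.
        (\<Sum>i. ennreal (enn2real (hdiam d (U i)) powr s)))"

definition hausdorff_measure ::
    "('a \<Rightarrow> 'a \<Rightarrow> real) \<Rightarrow> 'a set \<Rightarrow> real \<Rightarrow> 'a set \<Rightarrow> ennreal" where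
  "hausdorff_measure d S s E = (SUP \<delta>\<in>{0<..}. hausdorff_content d S s \<delta> E)"

definition hausdorff_dim :: "('a \<Rightarrow> 'a \<Rightarrow> real) \<Rightarrow> 'a set \<Rightarrow> 'a set \<Rightarrow> ereal" where
  "hausdorff_dim d S E = Inf {ereal s | s. s > 0 \<and> hausdorff_measure d S s E = 0}"

definition denseX :: "(mat2 \<Rightarrow> real) \<Rightarrow> mat2 set set \<Rightarrow> bool" where
  "denseX N E \<longleftrightarrow> E \<subseteq> Xsp \<and> (\<forall>y\<in>Xsp. \<forall>\<epsilon>>0. \<exists>x\<in>E. distX N x y < \<epsilon>)"

text \<open>Nontrivial continuous one-parameter unipotent subgroup (lifted to SL(2,R)).\<close>
definition unipotent_one_param :: "(real \<Rightarrow> mat2) \<Rightarrow> bool" where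
  "unipotent_one_param u \<longleftrightarrow>
     continuous_on UNIV u \<and> (\<forall>t. u t \<in> SL2R) \<and> (\<forall>s t. u (s + t) = u s ** u t) \<and>
     (\<forall>t. (u t - mat 1) ** (u t - mat 1) = 0) \<and> (\<exists>t. u t \<noteq> mat 1)"

end

theory Submission
  imports Defs
begin

text \<open>
  Conjugating, let \<open>u(t)\<close> be the horocycle flow \<open>h(ct)\<close>. Write a point as \<open>h(s) a v(r)\<close> with \<open>a\<close>
  diagonal and \<open>v(r)\<close> lower unipotent; since \<open>a\<close> normalises \<open>h\<close>, its orbit along the times \<open>c n^2\<close> is
  dense as soon as the orbit of \<open>v(r)\<close> along the times \<open>\<xi> n^2\<close> is, where \<open>\<xi>\<close> is determined by \<open>a\<close>.
  So it suffices that, for almost every \<open>r\<close>, almost every \<open>\<xi>\<close> has this property: the good points then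
  fill almost all of a coordinate box, and a cover of them by small sets has sum of cubed diameters
  bounded below, which gives dimension at least 3.

  Fix \<open>r\<close> and an open set \<open>W\<close>. If \<open>q r - p\<close> is much smaller than \<open>1/q\<close>, the horocycle through \<open>v(r)\<close> is,
  at times comparable to \<open>q^2\<close>, almost a closed horocycle of length about \<open>q^2\<close>. Closed horocycles of
  length \<open>Q^2\<close> spend a definite proportion of time in \<open>W\<close>: each pair of coprime integers close to \<open>Q\<close>
  times the second row of a matrix in \<open>W\<close> yields one visit, and coprime pairs have positive density.
  Taking \<open>n\<close> to be a multiple of \<open>q\<close>, the times \<open>\<xi> n^2\<close> with \<open>\<xi>\<close> in a short interval sweep out such an
  almost closed horocycle, so the \<open>\<xi>\<close> that never visit \<open>W\<close> form a porous, hence null, set. The same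
  porosity argument shows that almost every \<open>r\<close> admits such approximations.
\<close>

section \<open>Porous sets and well approximable numbers\<close>

text \<open>The difficulty is that the times \<open>\<xi> * n^2\<close> are not merely finely spread
  but huge: for \<open>n = m * q\<close> the sweep starting at \<open>\<xi>\<close> begins at time
  \<open>\<xi> * m^2 * q^2\<close>. The horocycle through \<open>vv r\<close> must therefore stay
  nearly closed up to time \<open>M * q^2\<close> with \<open>M\<close> as large as one likes, while
  the proportion of visits must not depend on \<open>M\<close>. This is why
  \<open>q * |q * r - p|\<close> has to be smaller than \<open>1 / K\<close> for every
  \<open>K\<close>: once \<open>K\<close> is large compared with \<open>M\<close>, the closed
  horocycles that approximate the orbit keep a length comparable with \<open>q^2\<close>. The factor
  \<open>m\<close>, of size \<open>1 / sqrt \<delta>\<close>, turns an interval of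
  \<open>\<xi>\<close> of length \<delta> into a stretch of time comparable with \<open>q^2\<close>,
  so the porosity constant is the same at every scale. A positive proportion of visits is the whole
  dynamical input.\<close>

lemma density_right:
  fixes A :: "real set"
  assumes A: "A \<in> sets borel" and e: "\<eta> > 0"
  obtains N where "negligible N"
    "\<And>x. x \<in> A - N \<Longrightarrow> \<exists>d>0. \<forall>h. 0 < h \<and> h < d \<longrightarrow> measure lborel ({x..x+h} - A) < \<eta> * h"
proof -
  have Ic: "{x..y} \<inter> A \<in> lmeasurable" for x y
    using A by (metis Int_commute fmeasurable_Int_fmeasurable lmeasurable_interval(1) cbox_interval sets_completionI_sets sets_lborel)
  have int: "(indicat_real A) integrable_on cbox a b" for a b :: real
    using Ic[of a b] by (simp add: integrable_on_indicator Int_commute)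
  \<comment> \<open>Lebesgue differentiation over cubes with lower corner \<open>x\<close>, which on
    the line are the intervals to the right of \<open>x\<close>.\<close>
  obtain N where N: "negligible N" and
    *: "\<And>x e. \<lbrakk>x \<notin> N; 0 < e\<rbrakk> \<Longrightarrow> \<exists>d>0. \<forall>h. 0 < h \<and> h < d \<longrightarrow>
            norm (integral (cbox x (x + h *\<^sub>R One)) (indicat_real A) /\<^sub>R h ^ DIM(real) - indicat_real A x) < e"
    using integrable_ccontinuous_explicit[OF int] by blast
  show ?thesis
  proof (rule that[OF N])
    fix x assume x: "x \<in> A - N"
    obtain d where d: "d > 0" "\<And>h. 0 < h \<and> h < d \<Longrightarrow>
            norm (integral (cbox x (x + h *\<^sub>R One)) (indicat_real A) /\<^sub>R h ^ DIM(real) - indicat_real A x) < \<eta>"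
      using *[of x \<eta>] x e by blast
    show "\<exists>d>0. \<forall>h. 0 < h \<and> h < d \<longrightarrow> measure lborel ({x..x+h} - A) < \<eta> * h"
    proof (intro exI conjI allI impI)
      show "d > 0" by fact
      fix h assume h: "0 < h \<and> h < d"
      have L: "{x..x+h} \<inter> A \<in> lmeasurable" by (rule Ic)
      have "integral {x..x+h} (indicat_real A) = measure lebesgue ({x..x+h} \<inter> A)"
        using L by (metis (no_types, lifting) integral_indicator Int_commute)
      also have "\<dots> = measure lborel ({x..x+h} \<inter> A)"
        using A by (intro measure_completion) auto
      finally have I: "integral {x..x+h} (indicat_real A) = measure lborel ({x..x+h} \<inter> A)" .
      hence "\<bar>measure lborel ({x..x+h} \<inter> A) / h - 1\<bar> < \<eta>"
        using d(2)[OF h] x h I by (simp add: divide_inverse_commute)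
      hence "measure lborel ({x..x+h} \<inter> A) / h > 1 - \<eta>" by linarith
      hence a: "measure lborel ({x..x+h} \<inter> A) > (1 - \<eta>) * h"
        using h by (simp add: field_simps)
      have "measure lborel ({x..x+h} - {x..x+h} \<inter> A) = measure lborel {x..x+h} - measure lborel ({x..x+h} \<inter> A)"
        using A h by (intro measure_Diff) auto
      hence "measure lborel ({x..x+h} - A) = h - measure lborel ({x..x+h} \<inter> A)"
        using h by (simp add: Diff_Int)
      thus "measure lborel ({x..x+h} - A) < \<eta> * h" using a h by (simp add: algebra_simps)
    qed
  qed
qed

text \<open>At a density point of \<open>A\<close> the complement fills less than the proportion
  \<eta> of every short interval on either side. Cutting \<open>{a..b}\<close> at \<open>x\<close>
  and adding the two sides contradicts the hole. The set \<open>N0\<close> collects points at which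
  porosity is not known.\<close>

lemma negligible_if_porous:
  fixes A :: "real set"
  assumes A: "A \<in> sets borel" and e: "\<eta> > 0" and N0: "negligible N0"
    and por: "\<And>x d. x \<in> A - N0 \<Longrightarrow> d > 0 \<Longrightarrow> \<exists>a b. a \<le> x \<and> x \<le> b \<and> a < b \<and> b - a < d
                \<and> measure lborel ({a..b} - A) \<ge> \<eta> * (b - a)"
  shows "negligible A"
proof -
  obtain N where N: "negligible N"
    "\<And>x. x \<in> A - N \<Longrightarrow> \<exists>d>0. \<forall>h. 0 < h \<and> h < d \<longrightarrow> measure lborel ({x..x+h} - A) < \<eta> * h"
    using density_right[OF A e] by blast
  \<comment> \<open>Density from the left is density from the right for the reflected set.\<close>
  have A'': "uminus ` A = uminus -` A" by (force simp: image_iff)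
  have A': "uminus ` A \<in> sets borel"
    unfolding A'' using A measurable_sets[of uminus borel borel A] by simp
  obtain M where M: "negligible M"
    "\<And>x. x \<in> uminus ` A - M \<Longrightarrow> \<exists>d>0. \<forall>h. 0 < h \<and> h < d \<longrightarrow> measure lborel ({x..x+h} - uminus ` A) < \<eta> * h"
    using density_right[OF A' e] by blast
  have M': "negligible (uminus ` M)" using M(1) 
    by (intro negligible_differentiable_image_negligible) (auto simp: differentiable_on_def)
  have "A \<subseteq> N0 \<union> N \<union> uminus ` M"
  proof
    fix x assume x: "x \<in> A"
    show "x \<in> N0 \<union> N \<union> uminus ` M"
    proof (rule ccontr)
      assume no: "x \<notin> N0 \<union> N \<union> uminus ` M"
      obtain d1 where d1: "d1>0" "\<And>h. 0 < h \<Longrightarrow> h < d1 \<Longrightarrow> measure lborel ({x..x+h} - A) < \<eta> * h"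
        using N(2)[of x] x no by auto
      have "-x \<in> uminus ` A - M" using x no by (auto simp: image_iff)
      then obtain d2 where d2: "d2>0" "\<And>h. 0 < h \<Longrightarrow> h < d2 \<Longrightarrow> measure lborel ({-x..-x+h} - uminus ` A) < \<eta> * h"
        using M(2)[of "-x"] by auto
      have m2: "measure lborel ({x-h..x} - A) < \<eta> * h" if "0 < h" "h < d2" for h
      proof -
        have eq: "{-x..-x+h} - uminus ` A = uminus ` ({x-h..x} - A)"
        proof -
          have "uminus ` {x-h..x} = {-x..-x+h}" by simp
          thus ?thesis by (metis image_set_diff inj_uminus)
        qed
        have "measure lborel (uminus ` ({x-h..x} - A)) = measure lborel ({x-h..x} - A)"
        proof -
          have "uminus ` ({x-h..x} - A) = uminus -` ({x-h..x} - A)" by (force simp: image_iff)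
          moreover have "measure (distr lborel borel uminus) ({x-h..x} - A) = measure lborel (uminus -` ({x-h..x} - A) \<inter> space lborel)"
            using A by (intro measure_distr) auto
          ultimately show ?thesis using lborel_distr_uminus by simp
        qed
        thus ?thesis using d2(2)[OF that] eq by simp
      qed
      obtain a b where ab: "a \<le> x" "x \<le> b" "a < b" "b - a < min d1 d2" "measure lborel ({a..b} - A) \<ge> \<eta> * (b - a)"
        using por[of x "min d1 d2"] x no d1(1) d2(1) by auto
      have s1': "x < b \<Longrightarrow> measure lborel ({x..b} - A) < \<eta> * (b - x)" 
        using d1(2)[of "b-x"] ab by auto
      have s2: "a < x \<Longrightarrow> measure lborel ({a..x} - A) < \<eta> * (x - a)" 
        using m2[of "x-a"] ab by auto
      \<comment> \<open>Covers the case in which \<open>x\<close> is an endpoint of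
        \<open>{a..b}\<close> and only one side remains.\<close>
      have e0: "{x..x} - A = {}" using x by auto
      have "measure lborel ({a..b} - A) \<le> measure lborel ({a..x} - A) + measure lborel ({x..b} - A)"
      proof -
        have "{a..b} - A = ({a..x} - A) \<union> ({x..b} - A)" using ab by auto
        moreover have "measure lborel (({a..x} - A) \<union> ({x..b} - A)) \<le> measure lborel ({a..x} - A) + measure lborel ({x..b} - A)"
          using A by (intro measure_Un_le) auto
        ultimately show ?thesis by simp
      qed
      moreover have "measure lborel ({a..x} - A) + measure lborel ({x..b} - A) < \<eta> * (x - a) + \<eta> * (b - x)"
      proof (cases "a < x")
        case True
        have "measure lborel ({x..b} - A) \<le> \<eta> * (b - x)"
          using s1' e0 ab by (cases "x = b") auto
        thus ?thesis using s2 True by linarith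
      next
        case False hence "a = x" using ab by simp
        thus ?thesis using s1' ab e0 by simp
      qed
      ultimately show False using ab(5) by (simp add: algebra_simps)
    qed
  qed
  thus ?thesis using N0 N(1) M' by (meson negligible_Un negligible_subset)
qed

section \<open>Dirichlet approximation and its improvements\<close>

text \<open>An irrational number has infinitely many Dirichlet approximations, while bounded
  denominators force bounded numerators and so leave only finitely many.\<close>

lemma approx_set_large_denominator:
  assumes "\<theta> \<notin> \<rat>"
  shows "\<exists>h k. (h, k) \<in> approx_set \<theta> \<and> k \<ge> B"
proof (rule ccontr)
  assume no: "\<not> ?thesis"
  define M where "M = \<lceil>(\<bar>\<theta>\<bar> + 1) * \<bar>of_int B\<bar>\<rceil>"
  have "approx_set \<theta> \<subseteq> {-M..M} \<times> {0..B}"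
  proof safe
    fix h k assume hk: "(h, k) \<in> approx_set \<theta>"
    hence k: "k > 0" "\<bar>\<theta> - of_int h / of_int k\<bar> < 1 / (of_int k)\<^sup>2" by (auto simp: approx_set_def)
    have kB: "k < B" using no hk by force
    have "1 / (real_of_int k)\<^sup>2 \<le> 1" using k(1) by (simp add: field_simps)
    hence "\<bar>of_int h / of_int k\<bar> \<le> \<bar>\<theta>\<bar> + 1" using k(2) by linarith
    hence "\<bar>of_int h\<bar> \<le> (\<bar>\<theta>\<bar> + 1) * of_int k" using k(1) by (simp add: field_simps abs_divide)
    also have "\<dots> \<le> (\<bar>\<theta>\<bar> + 1) * \<bar>of_int B\<bar>" using kB k(1) by (intro mult_left_mono) auto
    finally have "\<bar>h\<bar> \<le> M" unfolding M_def by linarith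
    thus "h \<in> {-M..M}" "k \<in> {0..B}" using kB k(1) by auto
  qed
  hence "finite (approx_set \<theta>)" by (rule finite_subset) auto
  thus False using assms rational_iff_finite_approx_set by blast
qed

text \<open>The numbers with unbounded partial quotients. Coprimality together with arbitrarily
  large \<open>q\<close> excludes the rationals.\<close>

definition well_approximable :: "real \<Rightarrow> bool" where
  "well_approximable r \<longleftrightarrow> (\<forall>K>0. \<forall>q0. \<exists>p q::int. q > 0 \<and> q \<ge> q0 \<and> coprime p q \<and> \<bar>of_int q * r - of_int p\<bar> < 1 / (of_nat K * of_int q))"

text \<open>A Dirichlet fraction \<open>h / k\<close> lies within \<open>e = 1 / k^2\<close> of
  \<open>x\<close>, and every point within \<open>e / K\<close> of it is outside the set. This hole
  of length \<open>2 * e / K\<close> lies in the interval of length \<open>4 * e\<close> about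
  \<open>x\<close>, which gives the proportion \<open>1 / (2 * K)\<close>.\<close>

lemma negligible_badly_approximable:
  assumes K: "K > (0::nat)"
  shows "negligible {r::real. \<not> (\<exists>p q::int. q > 0 \<and> q \<ge> q0 \<and> coprime p q \<and> \<bar>of_int q * r - of_int p\<bar> < 1 / (of_nat K * of_int q))}"
    (is "negligible ?A")
proof -
  have "open (- ?A)"
  proof -
    have "- ?A = (\<Union>(p,q)\<in>{(p,q). q > 0 \<and> q \<ge> q0 \<and> coprime p q}. {r::real. \<bar>of_int q * r - of_int p\<bar> < 1 / (of_nat K * of_int q)})"
      by auto
    also have "open \<dots>"
      by (intro open_UN ballI) (auto split: prod.splits intro!: open_Collect_less continuous_intros)
    finally show ?thesis .
  qed
  hence cl: "closed ?A" by (simp add: closed_def)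
  have N0: "negligible (\<rat>::real set)" by (simp add: negligible_iff_null_sets countable_imp_null_set_lborel countable_rat null_sets_completionI)
  show ?thesis
  proof (rule negligible_if_porous[where \<eta> = "1/(2*K)", OF _ _ N0])
    show "?A \<in> sets borel" using cl by auto
    show "0 < 1 / real (2 * K)" using K by simp
    fix x d :: real assume x: "x \<in> ?A - \<rat>" and d: "d > 0"
    \<comment> \<open>Denominators above \<open>4 / d\<close> make the interval of length
      \<open>4 / k^2\<close> shorter than \<open>d\<close>; the bound \<open>q0\<close> makes the
      fraction admissible.\<close>
    define B where "B = max q0 (max 1 (\<lceil>4/d\<rceil> + 1))"
    obtain h k where hk: "(h, k) \<in> approx_set x" "k \<ge> B"
      using approx_set_large_denominator[of x B] x by auto
    have k: "k > 0" "coprime h k" "\<bar>x - of_int h / of_int k\<bar> < 1 / (of_int k)\<^sup>2" using hk by (auto simp: approx_set_def)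
    have k0: "k \<ge> q0" "k \<ge> 1" "k \<ge> \<lceil>4/d\<rceil> + 1" using hk(2) unfolding B_def by auto
    have "real_of_int k > 4/d" using k0(3) by linarith
    moreover have "(real_of_int k)\<^sup>2 \<ge> of_int k" using k0(2) by (simp add: power2_eq_square)
    ultimately have "(real_of_int k)\<^sup>2 > 4/d" by linarith
    hence k4: "4 / (of_int k)\<^sup>2 < d" using d k(1) by (simp add: field_simps)
    define y where "y = of_int h / real_of_int k"
    define e where "e = 1 / (real_of_int k)\<^sup>2"
    have e: "e > 0" using k(1) by (simp add: e_def)
    have eK: "e / K \<le> e" using e K by (simp add: field_simps)
    have hole: "{y - e/K <..< y + e/K} \<subseteq> {x - 2*e..x + 2*e} - ?A"
    proof
      fix z assume z: "z \<in> {y - e/K <..< y + e/K}"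
      have "\<bar>x - y\<bar> < e" using k(3) by (simp add: y_def e_def)
      hence 1: "z \<in> {x - 2*e..x + 2*e}" using z eK by auto
      have "\<bar>z - y\<bar> < e / K" using z by auto
      hence "of_int k * \<bar>z - y\<bar> < of_int k * (e / K)" using k(1) by (intro mult_strict_left_mono) auto
      moreover have "of_int k * \<bar>z - y\<bar> = \<bar>of_int k * z - of_int h\<bar>"
      proof -
        have "of_int k * \<bar>z - y\<bar> = \<bar>of_int k * (z - y)\<bar>" using k(1) by (simp add: abs_mult)
        also have "of_int k * (z - y) = of_int k * z - of_int h" using k(1) by (simp add: y_def field_simps)
        finally show ?thesis .
      qed
      moreover have "of_int k * (e / K) = 1 / (of_nat K * of_int k)" using k(1) by (simp add: e_def field_simps power2_eq_square)
      ultimately have "\<bar>of_int k * z - of_int h\<bar> < 1 / (of_nat K * of_int k)" by simp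
      hence "z \<notin> ?A" using k k0 by blast
      thus "z \<in> {x - 2*e..x + 2*e} - ?A" using 1 by simp
    qed
    have "measure lborel {y - e/K <..< y + e/K} \<le> measure lborel ({x - 2*e..x + 2*e} - ?A)"
    proof (rule measure_mono_fmeasurable[OF hole])
      have "{x - 2*e..x + 2*e} \<in> fmeasurable lborel"
        using fmeasurable_cbox[of "x - 2*e" "x + 2*e"] by simp
      moreover have "?A \<in> sets lborel" using cl by simp
      ultimately show "{x - 2*e..x + 2*e} - ?A \<in> fmeasurable lborel"
        by (rule fmeasurable_Diff)
    qed auto
    hence "measure lborel ({x - 2*e..x + 2*e} - ?A) \<ge> 2*e/K" using e K by simp
    moreover have "1 / real (2 * K) * ((x + 2*e) - (x - 2*e)) = 2 * e / K" using K by (simp add: field_simps)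
    moreover have "(x + 2*e) - (x - 2*e) < d" using k4 by (simp add: e_def)
    ultimately show "\<exists>a b. a \<le> x \<and> x \<le> b \<and> a < b \<and> b - a < d \<and> 1 / real (2 * K) * (b - a) \<le> measure lborel ({a..b} - ?A)"
      using e by (intro exI[of _ "x - 2*e"] exI[of _ "x + 2*e"]) auto
  qed
qed

lemma negligible_not_well_approximable: "negligible {r. \<not> well_approximable r}"
proof -
  have "{r. \<not> well_approximable r} = (\<Union>K\<in>{0<..}. \<Union>q0. {r. \<not> (\<exists>p q::int. q > 0 \<and> q \<ge> q0 \<and> coprime p q \<and> \<bar>of_int q * r - of_int p\<bar> < 1 / (of_nat K * of_int q))})"
    by (auto simp: well_approximable_def)
  also have "negligible \<dots>"
    by (rule negligible_countable_Union;
        (intro countable_image countable_Collect countableI_type | clarify | rule negligible_countable_Union negligible_badly_approximable | simp)+)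
  finally show ?thesis .
qed

section \<open>Counting coprime pairs\<close>

text \<open>Bounds the proportion of pairs with a common factor; what matters is that it stays below
  1. Subtracting \<open>1 / real n\<close> makes the induction telescope, starting from
  \<open>1/4 = 3/4 - 1/2\<close>.\<close>

lemma sum_inverse_squares_le: "(\<Sum>d=2..n. 1 / (real d)\<^sup>2) \<le> 3/4"
proof -
  have "(\<Sum>d=2..n. 1 / (real d)\<^sup>2) \<le> 3/4 - 1 / real n" if "n \<ge> 2" for n
    using that
  proof (induction n rule: dec_induct)
    case base show ?case by (simp add: power2_eq_square)
  next
    case (step n)
    have "1 / (real (Suc n))\<^sup>2 \<le> 1 / real n - 1 / real (Suc n)"
    proof -
      have "1 / real n - 1 / real (Suc n) = 1 / (real n * real (Suc n))" using step(1) by (simp add: field_simps)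
      moreover have "1 / (real (Suc n))\<^sup>2 \<le> 1 / (real n * real (Suc n))"
        unfolding power2_eq_square using step(1) by (intro divide_left_mono mult_right_mono) auto
      ultimately show ?thesis by simp
    qed
    moreover have "(\<Sum>d=2..Suc n. 1 / (real d)\<^sup>2) = (\<Sum>d=2..n. 1 / (real d)\<^sup>2) + 1 / (real (Suc n))\<^sup>2"
      using step(1) by simp
    ultimately show ?case using step by linarith
  qed
  note * = this
  show ?thesis
  proof (cases "n \<ge> 2")
    case True
    have "1 / real n \<ge> 0" by simp
    thus ?thesis using *[OF True] by linarith
  qed simp
qed

lemma finite_nat_interval: "finite {n::nat. a \<le> real n \<and> real n \<le> b}"
proof (rule finite_subset)
  show "{n::nat. a \<le> real n \<and> real n \<le> b} \<subseteq> {..nat \<lfloor>b\<rfloor>}"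
    by (auto simp: le_nat_floor)
qed simp

lemma card_nat_interval_ge:
  fixes a L :: real
  assumes "a \<ge> 0" "L \<ge> 0"
  shows "real (card {n::nat. a \<le> real n \<and> real n \<le> a + L}) \<ge> L - 1"
proof -
  have "{nat \<lceil>a\<rceil>..nat \<lfloor>a + L\<rfloor>} \<subseteq> {n::nat. a \<le> real n \<and> real n \<le> a + L}"
    using assms by (auto simp: nat_le_iff ceiling_le_iff le_nat_iff le_floor_iff)
  hence "card {nat \<lceil>a\<rceil>..nat \<lfloor>a + L\<rfloor>} \<le> card {n::nat. a \<le> real n \<and> real n \<le> a + L}"
    by (intro card_mono finite_nat_interval)
  moreover have "real (card {nat \<lceil>a\<rceil>..nat \<lfloor>a + L\<rfloor>}) \<ge> L - 1"
  proof -
    have "int (nat \<lceil>a\<rceil>) = \<lceil>a\<rceil>" "int (nat \<lfloor>a + L\<rfloor>) = \<lfloor>a + L\<rfloor>" using assms by auto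
    hence "real (nat \<lceil>a\<rceil>) < a + 1" "real (nat \<lfloor>a + L\<rfloor>) > a + L - 1"
      by linarith+
    moreover have "real (card {nat \<lceil>a\<rceil>..nat \<lfloor>a + L\<rfloor>}) \<ge> real (nat \<lfloor>a + L\<rfloor>) + 1 - real (nat \<lceil>a\<rceil>)"
      by simp
    ultimately show ?thesis by linarith
  qed
  ultimately show ?thesis by linarith
qed

lemma card_multiples_le:
  fixes a L :: real
  assumes "L \<ge> 0" "d > 0"
  shows "real (card {n::nat. a \<le> real n \<and> real n \<le> a + L \<and> d dvd n}) \<le> L / d + 1"
proof -
  let ?S = "{n::nat. a \<le> real n \<and> real n \<le> a + L \<and> d dvd n}"
  have fin: "finite ?S" by (rule finite_subset[OF _ finite_nat_interval[of a "a+L"]]) auto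
  show ?thesis
  proof (cases "?S = {}")
    case True thus ?thesis using assms unfolding True by simp
  next
    case False
    define m where "m = Min ?S"
    have m: "m \<in> ?S" "\<And>n. n \<in> ?S \<Longrightarrow> m \<le> n" using fin False by (auto simp: m_def simp del: mem_Collect_eq)
    have "?S \<subseteq> (\<lambda>j. m + d * j) ` {..nat \<lfloor>L / d\<rfloor>}"
    proof
      fix n assume n: "n \<in> ?S"
      have "d dvd n - m" using n m by (simp add: dvd_diff_nat)
      then obtain j where j: "n - m = d * j" by auto
      hence j': "n = m + d * j" using m(2)[OF n] by linarith
      have "real n \<le> real m + L" using n m(1) by auto
      hence "real d * real j \<le> L" using j' by simp
      hence "real j \<le> L / d" using assms by (simp add: field_simps)
      hence "j \<le> nat \<lfloor>L / d\<rfloor>" by (simp add: le_nat_floor)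
      thus "n \<in> (\<lambda>j. m + d * j) ` {..nat \<lfloor>L / d\<rfloor>}" using j' by auto
    qed
    hence "card ?S \<le> card {..nat \<lfloor>L / d\<rfloor>}" by (meson surj_card_le finite_atMost)
    hence "real (card ?S) \<le> real (nat \<lfloor>L / d\<rfloor>) + 1" by simp
    also have "real (nat \<lfloor>L / d\<rfloor>) \<le> L / d" using assms by (simp add: of_nat_floor)
    finally show ?thesis by simp
  qed
qed

text \<open>Pairs that are not coprime are discarded by a union bound over the common factor
  \<open>d\<close>. With \<open>L = \<epsilon> * Q\<close> this removes at most
  \<open>7/8 * L^2 + 7 * D\<close> of at least \<open>(L - 1)^2\<close> pairs. The hypothesis on
  \<open>Q\<close> says that a further \<open>L^2 / 16\<close> absorbs the linear terms
  \<open>2 * L + 7 * D\<close>: multiplied by 16 these are the constants 32 and 112.\<close>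

lemma card_coprime_pairs_ge:
  fixes y1 y2 \<epsilon> Q :: real
  assumes y: "y1 > 0" "y2 > 0" and e: "\<epsilon> > 0"
    and Q: "\<epsilon>\<^sup>2 * Q \<ge> 32 * \<epsilon> + 112 * (y1 + \<epsilon>)" "Q > 0"
  defines "I \<equiv> {n::nat. y1 * Q \<le> real n \<and> real n \<le> y1 * Q + \<epsilon> * Q}"
    and "J \<equiv> {n::nat. y2 * Q \<le> real n \<and> real n \<le> y2 * Q + \<epsilon> * Q}"
  shows "real (card {(i,j). i \<in> I \<and> j \<in> J \<and> coprime i j}) \<ge> \<epsilon>\<^sup>2 / 16 * Q\<^sup>2"
proof -
  define L where "L = \<epsilon> * Q"
  \<comment> \<open>A common divisor of \<open>i\<close> and \<open>j\<close> is at most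
    \<open>i\<close>, so the union bound stops at the upper end of \<open>I\<close>.\<close>
  define D where "D = nat \<lfloor>y1 * Q + \<epsilon> * Q\<rfloor>"
  have L0: "L \<ge> 0" using e Q by (simp add: L_def)
  have finI: "finite I" and finJ: "finite J" unfolding I_def J_def by (rule finite_nat_interval)+
  let ?C = "{(i,j). i \<in> I \<and> j \<in> J \<and> coprime i j}"
  let ?N = "\<lambda>d. {i\<in>I. d dvd i} \<times> {j\<in>J. d dvd j}"
  have sub: "I \<times> J \<subseteq> ?C \<union> (\<Union>d\<in>{2..D}. ?N d)"
  proof safe
    fix i j assume ij: "i \<in> I" "j \<in> J" and no: "(i,j) \<notin> (\<Union>d\<in>{2..D}. ?N d)"
    show "coprime i j"
    proof (rule ccontr)
      assume nc: "\<not> coprime i j"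
      have i0: "i > 0" 
      proof -
        have "y1 * Q > 0" using y(1) Q(2) by simp
        hence "real i > 0" using ij(1) unfolding I_def by auto
        thus ?thesis by simp
      qed
      have "gcd i j \<noteq> 1" using nc coprime_iff_gcd_eq_1 by blast
      moreover have "gcd i j > 0" using i0 by simp
      ultimately have "gcd i j \<ge> 2" by linarith
      moreover have "i \<le> D" using ij(1) unfolding I_def D_def by (simp add: le_nat_floor)
      hence "gcd i j \<le> D" using i0 gcd_le1_nat[of i j] by linarith
      ultimately have "gcd i j \<in> {2..D}" by simp
      moreover have "(i,j) \<in> ?N (gcd i j)" using ij by simp
      ultimately have "(i,j) \<in> (\<Union>d\<in>{2..D}. ?N d)" by (rule UN_I)
      thus False using no by blast
    qed
  qed
  have finC: "finite ?C" by (rule finite_subset[of _ "I \<times> J"]) (use finI finJ in auto)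
  have "card I * card J \<le> card (?C \<union> (\<Union>d\<in>{2..D}. ?N d))"
    using sub finC finI finJ by (subst card_cartesian_product[symmetric], intro card_mono) auto
  also have "\<dots> \<le> card ?C + card (\<Union>d\<in>{2..D}. ?N d)" by (rule card_Un_le)
  also have "card (\<Union>d\<in>{2..D}. ?N d) \<le> (\<Sum>d=2..D. card (?N d))" by (rule card_UN_le) simp
  finally have "card I * card J \<le> card ?C + (\<Sum>d=2..D. card (?N d))" by simp
  hence "real (card I * card J) \<le> real (card ?C + (\<Sum>d=2..D. card (?N d)))" by (rule of_nat_mono)
  hence "real (card I) * real (card J) \<le> real (card ?C) + (\<Sum>d=2..D. real (card (?N d)))"
    unfolding of_nat_mult of_nat_add of_nat_sum .
  moreover have "(\<Sum>d=2..D. real (card (?N d))) \<le> 7/8 * L\<^sup>2 + 7 * D"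
  proof -
    have "(\<Sum>d=2..D. real (card (?N d))) \<le> (\<Sum>d=2..D. 7/6 * L\<^sup>2 * (1 / (real d)\<^sup>2) + 7)"
    proof (rule sum_mono)
      fix d assume d: "d \<in> {2..D}"
      have 1: "real (card {i\<in>I. d dvd i}) \<le> L / d + 1"
        using card_multiples_le[of L d "y1 * Q"] d L0 by (simp add: I_def L_def conj_assoc)
      have 2: "real (card {j\<in>J. d dvd j}) \<le> L / d + 1"
        using card_multiples_le[of L d "y2 * Q"] d L0 by (simp add: J_def L_def conj_assoc)
      have "real (card (?N d)) = real (card {i\<in>I. d dvd i}) * real (card {j\<in>J. d dvd j})"
        by (simp add: card_cartesian_product)
      also have "\<dots> \<le> (L / d + 1) * (L / d + 1)" using 1 2 L0 by (intro mult_mono) auto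
      \<comment> \<open>the factor 7/6 keeps its product with the bound 3/4 for the sum below 1\<close>
      also have "\<dots> \<le> 7/6 * (L / d)\<^sup>2 + 7"
      proof -
        define z where "z = L / real d"
        \<comment> \<open>The two sides below differ by \<open>(z - 6)^2 / 6\<close>.\<close>
        have "0 \<le> (z - 6)\<^sup>2" by simp
        hence "(z + 1) * (z + 1) \<le> 7/6 * z\<^sup>2 + 7" by (simp add: power2_eq_square algebra_simps)
        thus ?thesis by (simp add: z_def)
      qed
      also have "\<dots> = 7/6 * L\<^sup>2 * (1 / (real d)\<^sup>2) + 7" by (simp add: power_divide)
      finally show "real (card (?N d)) \<le> 7/6 * L\<^sup>2 * (1 / (real d)\<^sup>2) + 7" .
    qed
    also have "\<dots> = 7/6 * L\<^sup>2 * (\<Sum>d=2..D. 1 / (real d)\<^sup>2) + 7 * real (card {2..D})"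
      by (simp add: sum.distrib sum_distrib_left)
    also have "\<dots> \<le> 7/6 * L\<^sup>2 * (3/4) + 7 * real D"
      by (intro add_mono mult_left_mono sum_inverse_squares_le) auto
    finally show ?thesis by simp
  qed
  moreover have "real D \<le> (y1 + \<epsilon>) * Q"
    using y e Q unfolding D_def by (simp add: algebra_simps of_nat_floor)
  moreover have "real (card I) * real (card J) \<ge> (L - 1)\<^sup>2"
  proof -
    have "L \<ge> 32"
    proof -
      have "112 * (y1 + \<epsilon>) \<ge> 0" using y e by simp
      hence "\<epsilon>\<^sup>2 * Q \<ge> 32 * \<epsilon>" using Q(1) by (metis add_increasing2 order_trans order_refl)
      hence "\<epsilon> * 32 \<le> \<epsilon> * L" by (simp add: L_def power2_eq_square mult_ac)
      thus ?thesis using e by (simp only: mult_le_cancel_left_pos)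
    qed
    moreover have "real (card I) \<ge> L - 1" unfolding I_def L_def using y Q L0 by (intro card_nat_interval_ge) (auto simp: L_def)
    moreover have "real (card J) \<ge> L - 1" unfolding J_def L_def using y Q L0 by (intro card_nat_interval_ge) (auto simp: L_def)
    ultimately show ?thesis unfolding power2_eq_square by (intro mult_mono) auto
  qed
  moreover have "L\<^sup>2 / 16 \<ge> 2 * L + 7 * ((y1 + \<epsilon>) * Q)"
  proof -
    have "(\<epsilon>\<^sup>2 * Q) * Q \<ge> (32 * \<epsilon> + 112 * (y1 + \<epsilon>)) * Q" using Q by (intro mult_right_mono) auto
    thus ?thesis by (simp add: L_def power2_eq_square algebra_simps)
  qed
  moreover have "(L - 1)\<^sup>2 \<ge> L\<^sup>2 - 2 * L" by (simp add: power2_eq_square algebra_simps)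
  ultimately have "real (card ?C) \<ge> L\<^sup>2 / 16" by linarith
  thus ?thesis by (simp add: L_def power_mult_distrib)
qed

section \<open>Matrices of size two\<close>

definition mk :: "real \<Rightarrow> real \<Rightarrow> real \<Rightarrow> real \<Rightarrow> mat2" where
  "mk a b c d = vector [vector [a, b], vector [c, d]]"

lemma mk_nth [simp]:
  "mk a b c d $ 1 $ 1 = a" "mk a b c d $ 1 $ 2 = b" "mk a b c d $ 2 $ 1 = c" "mk a b c d $ 2 $ 2 = d"
  by (simp_all add: mk_def)

lemma mk_eta: "A = mk (A$1$1) (A$1$2) (A$2$1) (A$2$2)"
  by (simp add: vec_eq_iff forall_2)

lemma mat2_eq_iff: "(A::mat2) = B \<longleftrightarrow> A$1$1 = B$1$1 \<and> A$1$2 = B$1$2 \<and> A$2$1 = B$2$1 \<and> A$2$2 = B$2$2"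
  by (simp add: vec_eq_iff forall_2)

lemma mk_eq_iff [simp]: "mk a b c d = mk a' b' c' d' \<longleftrightarrow> a = a' \<and> b = b' \<and> c = c' \<and> d = d'"
  by (simp add: mat2_eq_iff)

lemma mk_mult [simp]: "mk a b c d ** mk a' b' c' d' = mk (a*a' + b*c') (a*b' + b*d') (c*a' + d*c') (c*b' + d*d')"
  by (simp add: mat2_eq_iff matrix_matrix_mult_def sum_2)

lemma mult_nth_2: "((A::mat2) ** (B::mat2)) $ i $ j = A$i$1 * B$1$j + A$i$2 * B$2$j"
  by (simp add: matrix_matrix_mult_def sum_2)

lemma mat_1_mk: "mat 1 = mk 1 0 0 1"
  by (simp add: mat2_eq_iff mat_def)

lemma det_mk [simp]: "det (mk a b c d) = a*d - b*c"
  by (simp add: det_2)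

lemma mk_in_SL2R [simp]: "mk a b c d \<in> SL2R \<longleftrightarrow> a*d - b*c = 1"
  by (simp add: SL2R_def)

lemma mk_in_SL2Z [simp]: "mk a b c d \<in> SL2Z \<longleftrightarrow> a*d - b*c = 1 \<and> a \<in> \<int> \<and> b \<in> \<int> \<and> c \<in> \<int> \<and> d \<in> \<int>"
  by (auto simp: SL2Z_def forall_2)

lemma SL2Z_subset_SL2R: "SL2Z \<subseteq> SL2R" by (auto simp: SL2Z_def SL2R_def)

lemma SL2R_mult: "A \<in> SL2R \<Longrightarrow> B \<in> SL2R \<Longrightarrow> A ** B \<in> SL2R"
  by (simp add: SL2R_def det_mul)

lemma SL2Z_mult: "A \<in> SL2Z \<Longrightarrow> B \<in> SL2Z \<Longrightarrow> A ** B \<in> SL2Z"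
  by (auto simp: SL2Z_def det_mul mult_nth_2)

lemma mat_1_SL2Z: "mat 1 \<in> SL2Z" by (simp add: mat_1_mk)

text \<open>The adjugate. It is linear in the entries, hence continuous, and reverses products of
  arbitrary matrices; on \<open>SL2R\<close> it is the inverse.\<close>

definition inv2 :: "mat2 \<Rightarrow> mat2" where
  "inv2 A = mk (A$2$2) (- A$1$2) (- A$2$1) (A$1$1)"

lemma inv2_mk [simp]: "inv2 (mk a b c d) = mk d (-b) (-c) a"
  by (simp add: inv2_def)

lemma inv2_mult: "inv2 (A ** B) = inv2 B ** inv2 A"
  by (simp add: mat2_eq_iff inv2_def mult_nth_2 mult.commute)

lemma inv2_left: "A \<in> SL2R \<Longrightarrow> inv2 A ** A = mat 1"
  by (simp add: SL2R_def mat2_eq_iff inv2_def mult_nth_2 det_2 mat_1_mk algebra_simps)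

lemma inv2_right: "A \<in> SL2R \<Longrightarrow> A ** inv2 A = mat 1"
  by (simp add: SL2R_def mat2_eq_iff inv2_def mult_nth_2 det_2 mat_1_mk algebra_simps)

lemma inv2_SL2R: "A \<in> SL2R \<Longrightarrow> inv2 A \<in> SL2R"
  by (simp add: SL2R_def inv2_def det_2 mult.commute)

lemma inv2_SL2Z: "A \<in> SL2Z \<Longrightarrow> inv2 A \<in> SL2Z"
  by (simp add: SL2Z_def inv2_def det_2 mult.commute forall_2)

lemma inv2_left': "A \<in> SL2R \<Longrightarrow> inv2 A ** (A ** B) = B"
  by (simp add: matrix_mul_assoc inv2_left)

lemma inv2_right': "A \<in> SL2R \<Longrightarrow> A ** (inv2 A ** B) = B"
  by (simp add: matrix_mul_assoc inv2_right)

lemma matrix_inv_eq_inv2: "A \<in> SL2R \<Longrightarrow> matrix_inv A = inv2 A"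
  unfolding matrix_inv_def
proof (rule some_equality)
  fix B assume "A \<in> SL2R" "A ** B = mat 1 \<and> B ** A = mat 1"
  thus "B = inv2 A" by (metis inv2_left' matrix_mul_rid)
qed (simp add: inv2_left inv2_right)

lemma nth_le_norm: "\<bar>(A::mat2) $ i $ j\<bar> \<le> norm A"
  using Finite_Cartesian_Product.norm_nth_le[of "A $ i" j] Finite_Cartesian_Product.norm_nth_le[of A i] by (metis order_trans real_norm_def)

lemma norm_mat2_le: "norm (A::mat2) \<le> \<bar>A$1$1\<bar> + \<bar>A$1$2\<bar> + \<bar>A$2$1\<bar> + \<bar>A$2$2\<bar>"
proof -
  have "norm A \<le> norm (A$1) + norm (A$2)"
    using L2_set_le_sum[of UNIV "\<lambda>i. norm (A$i)"] by (simp add: norm_vec_def sum_2)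
  moreover have *: "norm (A$i) \<le> \<bar>A$i$1\<bar> + \<bar>A$i$2\<bar>" for i
    using norm_le_l1_cart[of "A$i"] by (simp add: sum_2)
  ultimately show ?thesis using *[of 1] *[of 2] by linarith
qed

text \<open>The factor 8 counts four entries, each a sum of two products. It accounts for most
  constants in the metric estimates.\<close>

lemma norm_mult_le: "norm ((A::mat2) ** (B::mat2)) \<le> 8 * norm A * norm B"
proof -
  have "\<bar>(A ** B) $ i $ j\<bar> \<le> 2 * norm A * norm B" for i j
  proof -
    have "\<bar>(A ** B) $ i $ j\<bar> \<le> \<bar>A$i$1\<bar> * \<bar>B$1$j\<bar> + \<bar>A$i$2\<bar> * \<bar>B$2$j\<bar>"
      using abs_triangle_ineq[of "A$i$1 * B$1$j" "A$i$2 * B$2$j"] by (simp add: mult_nth_2 abs_mult)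
    also have "\<dots> \<le> norm A * norm B + norm A * norm B"
      by (intro add_mono mult_mono nth_le_norm) auto
    finally show ?thesis by simp
  qed
  note * = this
  have "4 * (2 * norm A * norm B) = 8 * norm A * norm B" by simp
  thus ?thesis using *[of 1 1] *[of 1 2] *[of 2 1] *[of 2 2] norm_mat2_le[of "A ** B"] by linarith
qed

lemma tendsto_mk [tendsto_intros]:
  assumes "(a \<longlongrightarrow> a') F" "(b \<longlongrightarrow> b') F" "(c \<longlongrightarrow> c') F" "(d \<longlongrightarrow> d') F"
  shows "((\<lambda>x. mk (a x) (b x) (c x) (d x)) \<longlongrightarrow> mk a' b' c' d') F"
proof -
  have *: "((\<lambda>x. mk (a x) (b x) (c x) (d x) $ i $ j) \<longlongrightarrow> mk a' b' c' d' $ i $ j) F" for i j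
    using assms exhaust_2[of i] exhaust_2[of j] by auto
  show ?thesis by (intro vec_tendstoI *)
qed

lemma continuous_on_mk [continuous_intros]:
  assumes "continuous_on S a" "continuous_on S b" "continuous_on S c" "continuous_on S d"
  shows "continuous_on S (\<lambda>x. mk (a x) (b x) (c x) (d x))"
  using assms unfolding continuous_on_def by (auto intro: tendsto_mk)

lemma tendsto_matmul [tendsto_intros]:
  assumes "(f \<longlongrightarrow> A) F" "(g \<longlongrightarrow> B) F"
  shows "((\<lambda>x. f x ** g x :: mat2) \<longlongrightarrow> A ** (B::mat2)) F"
proof -
  have *: "((\<lambda>x. (f x ** g x) $ i $ j) \<longlongrightarrow> (A ** B) $ i $ j) F" for i j
    unfolding mult_nth_2 by (intro tendsto_intros assms)
  show ?thesis by (intro vec_tendstoI *)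
qed

lemma continuous_on_matmul [continuous_intros]:
  assumes "continuous_on S f" "continuous_on S g"
  shows "continuous_on S (\<lambda>x. f x ** (g x :: mat2) :: mat2)"
  using assms unfolding continuous_on_def by (auto intro: tendsto_matmul)

lemma tendsto_inv2 [tendsto_intros]:
  assumes "(f \<longlongrightarrow> A) F"
  shows "((\<lambda>x. inv2 (f x)) \<longlongrightarrow> inv2 A) F"
  unfolding inv2_def by (intro tendsto_intros assms)

lemma eventually_nhds_tripleE:
  fixes a :: "'a::metric_space" and b :: "'b::metric_space" and c :: "'c::metric_space"
  assumes "eventually P (nhds (a, b, c))"
  obtains e where "e > 0" "\<And>x y z. dist x a < e \<Longrightarrow> dist y b < e \<Longrightarrow> dist z c < e \<Longrightarrow> P (x, y, z)"
proof -
  obtain d where d: "d > 0" "\<And>w. dist w (a,b,c) < d \<Longrightarrow> P w"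
    using assms by (auto simp: eventually_nhds_metric)
  show ?thesis
  proof (rule that[of "d/3"])
    fix x y z assume "dist x a < d/3" "dist y b < d/3" "dist z c < d/3"
    moreover have "dist (x,y,z) (a,b,c) \<le> dist x a + dist (y,z) (b,c)"
      unfolding dist_Pair_Pair[of x] by (rule sqrt_sum_squares_le_sum) auto
    moreover have "dist (y,z) (b,c) \<le> dist y b + dist z c"
      unfolding dist_Pair_Pair[of y] by (rule sqrt_sum_squares_le_sum) auto
    ultimately show "P (x,y,z)" by (intro d(2)) linarith
  qed (use d in simp)
qed

text \<open>Discreteness of the lattice with an explicit radius. It identifies lattice elements
  twice: when visits to an open set are separated, and when representatives of nearby cosets are
  matched.\<close>

lemma SL2Z_near_1:
  assumes "\<gamma> \<in> SL2Z" "norm (\<gamma> - mat 1) < 1"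
  shows "\<gamma> = mat 1"
proof -
  have *: "\<gamma> $ i $ j = (mat 1 :: mat2) $ i $ j" for i j
  proof -
    have "\<bar>\<gamma> $ i $ j - (mat 1 :: mat2) $ i $ j\<bar> < 1"
      using nth_le_norm[of "\<gamma> - mat 1" i j] assms(2) by simp
    moreover have "\<gamma> $ i $ j \<in> \<int>" using assms by (simp add: SL2Z_def)
    moreover have "(mat 1 :: mat2) $ i $ j \<in> \<int>" by (simp add: mat_def)
    ultimately show ?thesis by (metis Ints_diff Ints_eq_abs_less1)
  qed
  thus ?thesis by (simp add: vec_eq_iff)
qed

text \<open>The horocycle flow acts by \<open>hh\<close> on the left. Since
  \<open>dg Q ** hh 1 = hh (Q^2) ** dg Q\<close>, the coset of \<open>dg Q\<close> lies on a closed
  horocycle of length \<open>Q^2\<close>.\<close>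

definition hh :: "real \<Rightarrow> mat2" where "hh x = mk 1 x 0 1"
definition vv :: "real \<Rightarrow> mat2" where "vv x = mk 1 0 x 1"
definition dg :: "real \<Rightarrow> mat2" where "dg l = mk l 0 0 (1/l)"

lemma hh_SL2R: "hh x \<in> SL2R" and vv_SL2R: "vv x \<in> SL2R" and dg_SL2R: "l \<noteq> 0 \<Longrightarrow> dg l \<in> SL2R"
  by (simp_all add: hh_def vv_def dg_def)

lemma hh_add: "hh (x + y) = hh x ** hh y" by (simp add: hh_def)
lemma inv2_hh: "inv2 (hh x) = hh (-x)" by (simp add: hh_def)

section \<open>Closed horocycles\<close>

text \<open>Coordinates adapted to the left action of \<open>hh\<close>, which fixes the second row:
  the upper left entry is the remaining parameter, and a suitable time gives it any prescribed
  value.\<close>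

lemma SL2R_of_second_row:
  assumes "A \<in> SL2R" "A$2$1 \<noteq> 0"
  shows "A = mk (A$1$1) ((A$1$1 * A$2$2 - 1) / A$2$1) (A$2$1) (A$2$2)"
  using assms by (simp add: mat2_eq_iff SL2R_def det_2 field_simps)

text \<open>Adding \<open>k\<close> times the second row of \<open>\<gamma>\<close> to its first row lowers \<open>x\<close> by \<open>k Q\<^sup>2\<close>, so \<open>x\<close> can be
  placed in any window of length \<open>Q\<^sup>2\<close>.\<close>
lemma horocycle_point_of_coprime_pair:
  fixes i j :: nat and p \<alpha> Q :: real
  assumes ij: "coprime i j" "i > 0" and Q: "Q > 0"
  shows "\<exists>x \<gamma>. \<alpha> \<le> x \<and> x \<le> \<alpha> + Q\<^sup>2 \<and> \<gamma> \<in> SL2Z \<and> \<gamma>$2$1 = real i \<and> \<gamma>$2$2 = real j \<and>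
            hh x ** dg Q ** \<gamma> = mk p ((p * (j/Q) - 1) / (i/Q)) (i/Q) (j/Q)"
proof -
  have "coprime (int i) (int j)" using ij(1) by simp
  then obtain u v where uv: "u * int i + v * int j = 1"
    using bezout_int[of "int i" "int j"] by (auto simp: coprime_iff_gcd_eq_1)
  \<comment> \<open>The solution of \<open>Q * v + x0 * i / Q = p\<close>, that is, the time at
    which the Bezout matrix with rows \<open>v, -u\<close> and \<open>i, j\<close> produces the
    upper left entry \<open>p\<close>.\<close>
  define x0 where "x0 = (p - Q * v) * Q / i"
  define k where "k = \<lfloor>(x0 - \<alpha>) / Q\<^sup>2\<rfloor>"
  define m1 where "m1 = v + k * int i"
  define m2 where "m2 = - u + k * int j"
  have det: "m1 * int j - m2 * int i = 1" using uv by (simp add: m1_def m2_def algebra_simps)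
  have det': "real_of_int m1 * real j - real_of_int m2 * real i = 1"
    using arg_cong[OF det, of real_of_int] by simp
  define x where "x = (p - Q * m1) * Q / i"
  have x: "x = x0 - k * Q\<^sup>2" using ij(2) by (simp add: x_def x0_def m1_def field_simps power2_eq_square)
  have "of_int k \<le> (x0 - \<alpha>) / Q\<^sup>2" "(x0 - \<alpha>) / Q\<^sup>2 < of_int k + 1" unfolding k_def by linarith+
  hence xa: "\<alpha> \<le> x" "x \<le> \<alpha> + Q\<^sup>2" using Q unfolding x by (simp_all add: field_simps)
  define \<gamma> where "\<gamma> = mk m1 m2 i j"
  have "\<gamma> \<in> SL2Z" using det' by (simp add: \<gamma>_def mult.commute)
  moreover have "hh x ** dg Q ** \<gamma> = mk p ((p * (j/Q) - 1) / (i/Q)) (i/Q) (j/Q)"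
  proof -
    have xi: "x * i / Q = p - Q * m1" using ij(2) Q by (simp add: x_def)
    have e1: "Q * m1 + x * i / Q = p" using xi by simp
    have "i * (Q * m2 + x * j / Q) = Q * (m2 * i) + (x * i / Q) * j" by (simp add: algebra_simps)
    also have "\<dots> = p * j - Q * (m1 * j - m2 * i)" unfolding xi by (simp add: algebra_simps)
    also have "\<dots> = p * j - Q" using det' by simp
    finally have "Q * m2 + x * j / Q = (p * j - Q) / i" using ij(2) by (simp add: field_simps)
    also have "\<dots> = (p * (j/Q) - 1) / (i/Q)" using ij(2) Q by (simp add: field_simps)
    finally have e2: "Q * m2 + x * j / Q = (p * (j/Q) - 1) / (i/Q)" .
    show ?thesis using e1 e2 by (simp add: hh_def dg_def \<gamma>_def)
  qed
  ultimately show ?thesis using xa by (intro exI[of _ x] exI[of _ \<gamma>]) (simp add: \<gamma>_def)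
qed

text \<open>Visits of distinct pairs are separated because \<open>SL2Z\<close> is discrete.\<close>
lemma closed_horocycle_visits:
  assumes W: "open W" "g0 \<in> W" and g0: "g0 \<in> SL2R" "g0$2$1 > 0" "g0$2$2 > 0"
  shows "\<exists>\<eta>>0. \<exists>l>0. \<exists>Q0>0. \<forall>Q\<ge>Q0. \<forall>\<alpha>. \<exists>P. finite P \<and> P \<subseteq> {\<alpha>..\<alpha> + Q\<^sup>2} \<and> \<eta> * Q\<^sup>2 \<le> real (card P)
           \<and> (\<forall>x\<in>P. \<forall>x'\<in>P. x \<noteq> x' \<longrightarrow> l \<le> \<bar>x - x'\<bar>) \<and> (\<forall>x\<in>P. \<exists>\<gamma>\<in>SL2Z. hh x ** dg Q ** \<gamma> \<in> W)"
proof -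
  define p where "p = g0$1$1"
  define y1 where "y1 = g0$2$1"
  define y2 where "y2 = g0$2$2"
  have y: "y1 > 0" "y2 > 0" using g0 by (simp_all add: y1_def y2_def)
  \<comment> \<open>The matrices with the upper left entry of \<open>g0\<close>, parametrised by
    their second row. Points of this form near \<open>g0\<close> are the visits that get
    counted.\<close>
  define F where "F = (\<lambda>Y1 Y2. mk p ((p * Y2 - 1) / Y1) Y1 Y2)"
  have F0: "F y1 y2 = g0" using SL2R_of_second_row[OF g0(1)] g0(2) by (simp add: F_def p_def y1_def y2_def)
  \<comment> \<open>If \<open>A\<close> and \<open>B\<close> are two counted points of the closed
    horocycle and \<open>s\<close> is the difference of their times, this product is the quotient of
    their lattice elements. Close to \<open>mat 1\<close> it must equal \<open>mat 1\<close>, and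
    then the second rows, hence the coprime pairs, coincide.\<close>
  define f where "f = (\<lambda>(A::mat2, s, B::mat2). inv2 A ** hh s ** B)"
  have "(f \<longlongrightarrow> inv2 g0 ** hh 0 ** g0) (nhds (g0, 0, g0))"
  proof -
    have "((\<lambda>z. z) \<longlongrightarrow> (g0, 0, g0)) (nhds (g0, 0::real, g0))" by (rule filterlim_ident)
    from tendsto_fst[OF this] tendsto_fst[OF tendsto_snd[OF this]] tendsto_snd[OF tendsto_snd[OF this]]
    show ?thesis unfolding f_def case_prod_beta hh_def by (intro tendsto_intros) simp_all
  qed
  hence "(f \<longlongrightarrow> mat 1) (nhds (g0, 0, g0))"
    using g0(1) by (simp add: inv2_left hh_def flip: mat_1_mk)
  hence "eventually (\<lambda>z. dist (f z) (mat 1) < 1) (nhds (g0, 0, g0))" by (rule tendstoD) simp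
  then obtain e where e: "e > 0" "\<And>A s B. dist A g0 < e \<Longrightarrow> dist s 0 < e \<Longrightarrow> dist B g0 < e \<Longrightarrow> dist (f (A,s,B)) (mat 1) < 1"
    by (rule eventually_nhds_tripleE) blast
  have "((\<lambda>z. F (fst z) (snd z)) \<longlongrightarrow> F y1 y2) (nhds (y1, y2))"
  proof -
    have "((\<lambda>z. z) \<longlongrightarrow> (y1, y2)) (nhds (y1, y2))" by (rule filterlim_ident)
    from tendsto_fst[OF this] tendsto_snd[OF this]
    show ?thesis unfolding F_def using y by (intro tendsto_intros) simp_all
  qed
  moreover have "open (W \<inter> ball g0 e)" "F y1 y2 \<in> W \<inter> ball g0 e" using W e F0 by auto
  ultimately have "eventually (\<lambda>z. F (fst z) (snd z) \<in> W \<inter> ball g0 e) (nhds (y1, y2))"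
    by (rule topological_tendstoD)
  then obtain d where d: "d > 0" "\<And>z. dist z (y1,y2) < d \<Longrightarrow> F (fst z) (snd z) \<in> W \<inter> ball g0 e"
    by (auto simp: eventually_nhds_metric)
  define \<epsilon> where "\<epsilon> = d / 3"
  have \<epsilon>: "\<epsilon> > 0" using d by (simp add: \<epsilon>_def)
  have FW: "F Y1 Y2 \<in> W" "dist (F Y1 Y2) g0 < e" if "y1 \<le> Y1" "Y1 \<le> y1 + \<epsilon>" "y2 \<le> Y2" "Y2 \<le> y2 + \<epsilon>" for Y1 Y2
  proof -
    have "dist (Y1,Y2) (y1,y2) \<le> dist Y1 y1 + dist Y2 y2"
      unfolding dist_Pair_Pair by (rule sqrt_sum_squares_le_sum) auto
    also have "\<dots> < d" using that d(1) by (simp add: dist_real_def \<epsilon>_def)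
    finally show "F Y1 Y2 \<in> W" "dist (F Y1 Y2) g0 < e" using d(2)[of "(Y1,Y2)"] by (auto simp: dist_commute)
  qed
  \<comment> \<open>The threshold in \<open>card_coprime_pairs_ge\<close>, solved for
    \<open>Q\<close>.\<close>
  define Q0 where "Q0 = (32 * \<epsilon> + 112 * (y1 + \<epsilon>)) / \<epsilon>\<^sup>2"
  have Q0: "Q0 > 0" using \<epsilon> y by (auto simp: Q0_def intro!: divide_pos_pos add_pos_pos)
  have "\<exists>P. finite P \<and> P \<subseteq> {\<alpha>..\<alpha> + Q\<^sup>2} \<and> \<epsilon>\<^sup>2 / 16 * Q\<^sup>2 \<le> real (card P)
           \<and> (\<forall>x\<in>P. \<forall>x'\<in>P. x \<noteq> x' \<longrightarrow> e \<le> \<bar>x - x'\<bar>) \<and> (\<forall>x\<in>P. \<exists>\<gamma>\<in>SL2Z. hh x ** dg Q ** \<gamma> \<in> W)"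
    if QQ: "Q \<ge> Q0" for Q \<alpha>
  proof -
    have Q: "Q > 0" using QQ Q0 by simp
    have Q1: "\<epsilon>\<^sup>2 * Q \<ge> 32 * \<epsilon> + 112 * (y1 + \<epsilon>)" using QQ \<epsilon> unfolding Q0_def by (simp add: field_simps)
    define I where "I = {n::nat. y1 * Q \<le> real n \<and> real n \<le> y1 * Q + \<epsilon> * Q}"
    define J where "J = {n::nat. y2 * Q \<le> real n \<and> real n \<le> y2 * Q + \<epsilon> * Q}"
    define C where "C = {(i,j). i \<in> I \<and> j \<in> J \<and> coprime i j}"
    have cardC: "real (card C) \<ge> \<epsilon>\<^sup>2 / 16 * Q\<^sup>2"
      unfolding C_def I_def J_def by (rule card_coprime_pairs_ge[OF y \<epsilon> Q1 Q])
    have finC: "finite C"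
      by (rule finite_subset[of _ "I \<times> J"]) (auto simp: C_def I_def J_def finite_nat_interval)
    have IJ: "y1 \<le> real i / Q" "real i / Q \<le> y1 + \<epsilon>" "y2 \<le> real j / Q" "real j / Q \<le> y2 + \<epsilon>" "coprime i j" "i > 0"
      if "(i,j) \<in> C" for i j
    proof -
      have ij: "y1 * Q \<le> real i" "real i \<le> y1 * Q + \<epsilon> * Q" "y2 * Q \<le> real j" "real j \<le> y2 * Q + \<epsilon> * Q"
        using that by (auto simp: C_def I_def J_def)
      show "y1 \<le> real i / Q" "real i / Q \<le> y1 + \<epsilon>" "y2 \<le> real j / Q" "real j / Q \<le> y2 + \<epsilon>"
        using ij Q by (simp_all add: field_simps)
      show "coprime i j" using that by (simp add: C_def)
      have "y1 * Q > 0" using y Q by simp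
      hence "real i > 0" using ij by linarith
      thus "i > 0" by simp
    qed
    define R where "R = (\<lambda>c x \<gamma>. \<alpha> \<le> x \<and> x \<le> \<alpha> + Q\<^sup>2 \<and> \<gamma> \<in> SL2Z \<and> \<gamma>$2$1 = real (fst c) \<and> \<gamma>$2$2 = real (snd c) \<and>
            hh x ** dg Q ** \<gamma> = F (real (fst c) / Q) (real (snd c) / Q))"
    have "\<forall>c\<in>C. \<exists>x \<gamma>. R c x \<gamma>"
    proof
      fix c assume "c \<in> C"
      moreover obtain i j where "c = (i,j)" by (cases c)
      ultimately show "\<exists>x \<gamma>. R c x \<gamma>"
        using horocycle_point_of_coprime_pair[of i j Q \<alpha> p] IJ[of i j] Q unfolding R_def F_def by auto
    qed
    then obtain X where "\<forall>c\<in>C. \<exists>\<gamma>. R c (X c) \<gamma>" by metis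
    then obtain G where R: "\<And>c. c \<in> C \<Longrightarrow> R c (X c) (G c)" by metis
    have FC: "F (real (fst c) / Q) (real (snd c) / Q) \<in> W" "dist (F (real (fst c) / Q) (real (snd c) / Q)) g0 < e" if "c \<in> C" for c
      using FW[of "real (fst c) / Q" "real (snd c) / Q"] IJ[of "fst c" "snd c"] that by auto
    have sep: "c = c'" if c: "c \<in> C" "c' \<in> C" and near: "\<bar>X c - X c'\<bar> < e" for c c'
    proof -
      have r: "R c (X c) (G c)" "R c' (X c') (G c')" using R c by auto
      have S: "G c \<in> SL2R" "G c' \<in> SL2Z" "G c \<in> SL2Z" "G c' \<in> SL2R" using r SL2Z_subset_SL2R by (auto simp: R_def)
      have D: "dg Q \<in> SL2R" using Q by (simp add: dg_SL2R)
      have "f (F (real (fst c) / Q) (real (snd c) / Q), X c - X c', F (real (fst c') / Q) (real (snd c') / Q)) = inv2 (G c) ** G c'"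
      proof -
        have "f (F (real (fst c) / Q) (real (snd c) / Q), X c - X c', F (real (fst c') / Q) (real (snd c') / Q))
            = inv2 (hh (X c) ** dg Q ** G c) ** hh (X c - X c') ** (hh (X c') ** dg Q ** G c')"
          using r by (simp add: f_def R_def)
        also have "\<dots> = inv2 (G c) ** (inv2 (dg Q) ** ((hh (- X c) ** hh (X c - X c') ** hh (X c')) ** (dg Q ** G c')))"
          by (simp add: inv2_mult inv2_hh matrix_mul_assoc)
        also have "hh (- X c) ** hh (X c - X c') ** hh (X c') = mat 1"
          by (simp add: mat_1_mk hh_def)
        finally show ?thesis using D by (simp add: inv2_left')
      qed
      hence "dist (inv2 (G c) ** G c') (mat 1) < 1"
        using e(2)[of "F (real (fst c) / Q) (real (snd c) / Q)" "X c - X c'" "F (real (fst c') / Q) (real (snd c') / Q)"] FC c near by simp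
      hence "inv2 (G c) ** G c' = mat 1"
        using SL2Z_near_1 S by (simp add: SL2Z_mult inv2_SL2Z dist_norm)
      hence "G c = G c'" using S inv2_right'[of "G c" "G c'"] by simp
      thus "c = c'" using r by (auto simp: R_def prod_eq_iff)
    qed
    have inj: "inj_on X C" by (rule inj_onI) (use sep e(1) in auto)
    show ?thesis
    proof (intro exI[of _ "X ` C"] conjI ballI impI)
      show "finite (X ` C)" using finC by simp
      show "X ` C \<subseteq> {\<alpha>..\<alpha> + Q\<^sup>2}" using R by (auto simp: R_def)
      show "\<epsilon>\<^sup>2 / 16 * Q\<^sup>2 \<le> real (card (X ` C))" using cardC inj by (simp add: card_image)
      fix x assume x: "x \<in> X ` C"
      then obtain c where c: "c \<in> C" "x = X c" by auto
      show "\<exists>\<gamma>\<in>SL2Z. hh x ** dg Q ** \<gamma> \<in> W" using R[OF c(1)] FC[OF c(1)] c(2) by (auto simp: R_def intro!: bexI[of _ "G c"])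
      fix x' assume x': "x' \<in> X ` C" "x \<noteq> x'"
      then obtain c' where c': "c' \<in> C" "x' = X c'" by auto
      show "e \<le> \<bar>x - x'\<bar>" using sep[OF c(1) c'(1)] c c' x'(2) by force
    qed
  qed
  moreover have "\<epsilon>\<^sup>2 / 16 > 0" using \<epsilon> by simp
  ultimately show ?thesis using e(1) Q0 by blast
qed

section \<open>Transfer to nearly closed horocycles\<close>

lemma SL2R_eqI:
  assumes "A \<in> SL2R" "B \<in> SL2R" "A$1$1 \<noteq> 0" "A$1$1 = B$1$1" "A$1$2 = B$1$2" "A$2$1 = B$2$1"
  shows "A = B"
proof -
  have "A$1$1 * A$2$2 = 1 + A$1$2 * A$2$1" "B$1$1 * B$2$2 = 1 + B$1$2 * B$2$1"
    using assms(1,2) by (simp_all add: SL2R_def det_2)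
  hence "A$1$1 * A$2$2 = A$1$1 * B$2$2" by (simp only: assms(4-6))
  hence "A$2$2 = B$2$2" using mult_left_cancel[OF assms(3)] by blast
  thus ?thesis using assms by (simp add: mat2_eq_iff)
qed

text \<open>The factorisation of the left side into lower unipotent, diagonal and upper unipotent
  parts. For small \<theta> the factors \<open>vv (\<theta> / (a * Q))\<close> and
  \<open>dg a\<close> are near the identity, so the orbit at time \<sigma> shadows the closed
  horocycle at the time \<open>x\<close>, a fractional linear function of \<sigma>.\<close>

lemma horocycle_time_change:
  assumes det: "Q * \<theta>' - \<theta> * Q' = 1" and Q: "Q \<noteq> 0" and a: "a \<noteq> 0" "a * Q = Q + \<sigma> * \<theta>" and x: "a * (x - Q * Q') = \<sigma>"
  shows "hh \<sigma> ** mk Q Q' \<theta> \<theta>' = vv (\<theta> / (a * Q)) ** dg a ** (hh x ** dg Q)"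
proof (rule SL2R_eqI)
  show "hh \<sigma> ** mk Q Q' \<theta> \<theta>' \<in> SL2R" using det by (intro SL2R_mult hh_SL2R) (simp add: mult.commute)
  show "vv (\<theta> / (a * Q)) ** dg a ** (hh x ** dg Q) \<in> SL2R"
    using a Q by (intro SL2R_mult hh_SL2R vv_SL2R dg_SL2R) auto
  show "(hh \<sigma> ** mk Q Q' \<theta> \<theta>') $ 1 $ 1 \<noteq> 0" using a Q by (simp add: hh_def flip: a(2))
  show "(hh \<sigma> ** mk Q Q' \<theta> \<theta>') $ 1 $ 1 = (vv (\<theta> / (a * Q)) ** dg a ** (hh x ** dg Q)) $ 1 $ 1"
    using a by (simp add: hh_def vv_def dg_def)
  show "(hh \<sigma> ** mk Q Q' \<theta> \<theta>') $ 2 $ 1 = (vv (\<theta> / (a * Q)) ** dg a ** (hh x ** dg Q)) $ 2 $ 1"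
    using a(1) Q by (simp add: hh_def vv_def dg_def)
  have ax: "a * x = \<sigma> + (Q + \<sigma> * \<theta>) * Q'" using x unfolding a(2)[symmetric] by (simp add: algebra_simps)
  have "(Q' + \<sigma> * \<theta>') * Q - a * x = \<sigma> * (Q * \<theta>' - \<theta> * Q' - 1)"
    unfolding ax by (simp add: algebra_simps)
  hence "(Q' + \<sigma> * \<theta>') * Q = a * x" using det by simp
  hence "Q' + \<sigma> * \<theta>' = a * x / Q" using Q by (simp add: field_simps)
  thus "(hh \<sigma> ** mk Q Q' \<theta> \<theta>') $ 1 $ 2 = (vv (\<theta> / (a * Q)) ** dg a ** (hh x ** dg Q)) $ 1 $ 2"
    by (simp add: hh_def vv_def dg_def)
qed

lemma measure_separated_intervals:
  fixes f :: "'a \<Rightarrow> real" and w :: real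
  assumes "finite P" "w \<ge> 0" "\<And>x y. x \<in> P \<Longrightarrow> y \<in> P \<Longrightarrow> x \<noteq> y \<Longrightarrow> w < \<bar>f x - f y\<bar>"
  shows "measure lborel (\<Union>x\<in>P. {f x..f x + w}) = real (card P) * w"
proof -
  have "disjoint_family_on (\<lambda>x. {f x..f x + w}) P"
    unfolding disjoint_family_on_def using assms(3) by fastforce
  hence "measure lborel (\<Union>x\<in>P. {f x..f x + w}) = (\<Sum>x\<in>P. measure lborel {f x..f x + w})"
    using assms(1,2) by (intro measure_finite_Union) auto
  thus ?thesis using assms(2) by simp
qed

text \<open>The quotient is given no topology: an open set of cosets is represented by an open set
  \<open>W\<close> of matrices, and some lift of the moving point has to lie in
  \<open>W\<close>.\<close>

definition visits :: "real \<Rightarrow> real \<Rightarrow> mat2 set \<Rightarrow> bool" where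
  "visits r t W \<longleftrightarrow> (\<exists>\<gamma>\<in>SL2Z. hh t ** vv r ** \<gamma> \<in> W)"

lemma open_visits:
  assumes "open W"
  shows "open {\<xi>. visits r (\<xi> * c) W}"
proof -
  have "{\<xi>. visits r (\<xi> * c) W} = (\<Union>\<gamma>\<in>SL2Z. (\<lambda>\<xi>. hh (\<xi> * c) ** vv r ** \<gamma>) -` W)"
    by (auto simp: visits_def)
  also have "open \<dots>"
    unfolding hh_def using assms by (intro open_UN ballI open_vimage continuous_intros) auto
  finally show ?thesis .
qed

text \<open>The order of quantifiers is the point: \<eta> and \<open>l\<close> depend on
  \<open>W\<close> alone, whereas \<open>q\<close> may depend on how late, up to
  \<open>M * q^2\<close>, the sweep starts. The visits are those of a closed horocycle of length
  \<open>Q^2\<close>, carried over by \<open>horocycle_time_change\<close>; each persists for time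
  \<open>l\<close>.\<close>

lemma nearly_closed_horocycle_visits:
  assumes r: "well_approximable r" and W: "open W" "g0 \<in> W" and g0: "g0 \<in> SL2R" "g0$2$1 > 0" "g0$2$2 > 0"
  shows "\<exists>\<eta>>0. \<exists>l>0. \<forall>M::real. \<exists>q::nat. q > 0 \<and> (\<forall>\<tau>. \<bar>\<tau>\<bar> \<le> M * (real q)\<^sup>2 \<longrightarrow>
           (\<exists>P \<sigma>. finite P \<and> \<eta> * (real q)\<^sup>2 \<le> real (card P) \<and>
             (\<forall>x\<in>P. 0 \<le> \<sigma> x \<and> \<sigma> x + l \<le> 6 * (real q)\<^sup>2 \<and> (\<forall>s\<in>{0..l}. visits r (\<tau> + \<sigma> x + s) W)) \<and>
             (\<forall>x\<in>P. \<forall>x'\<in>P. x \<noteq> (x'::real) \<longrightarrow> l < \<bar>\<sigma> x - \<sigma> x'\<bar>)))"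
proof -
  \<comment> \<open>The margin of \<open>W\<close> around \<open>g0\<close>: it must absorb the
    additional time \<open>s\<close> and the two correction factors of the time change.\<close>
  define f where "f = (\<lambda>(z::real\<times>real, a, A::mat2). hh (fst z) ** vv (snd z) ** dg a ** A)"
  have "(f \<longlongrightarrow> hh 0 ** vv 0 ** dg 1 ** g0) (nhds ((0,0),1,g0))"
  proof -
    have "((\<lambda>z. z) \<longlongrightarrow> ((0,0),1,g0)) (nhds ((0::real,0::real), 1::real, g0))" by (rule filterlim_ident)
    from tendsto_fst[OF tendsto_fst[OF this]] tendsto_snd[OF tendsto_fst[OF this]]
      tendsto_fst[OF tendsto_snd[OF this]] tendsto_snd[OF tendsto_snd[OF this]]
    show ?thesis unfolding f_def case_prod_beta hh_def vv_def dg_def by (intro tendsto_intros) simp_all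
  qed
  moreover have "hh 0 ** vv 0 ** dg 1 ** g0 = g0" by (simp add: hh_def vv_def dg_def flip: mat_1_mk)
  ultimately have "eventually (\<lambda>z. f z \<in> W) (nhds ((0,0),1,g0))"
    using topological_tendstoD[OF _ W] by simp
  then obtain e where e: "e > 0" "\<And>z a A. dist z (0,0) < e \<Longrightarrow> dist a 1 < e \<Longrightarrow> dist A g0 < e \<Longrightarrow> f (z,a,A) \<in> W"
    by (rule eventually_nhds_tripleE) blast
  have "open (ball g0 e)" "g0 \<in> ball g0 e" using e by auto
  from closed_horocycle_visits[OF this g0] obtain \<eta>0 l0 Q0 where h: "\<eta>0 > 0" "l0 > 0" "Q0 > 0"
    "\<forall>Q\<ge>Q0. \<forall>\<alpha>. \<exists>P. finite P \<and> P \<subseteq> {\<alpha>..\<alpha> + Q\<^sup>2} \<and> \<eta>0 * Q\<^sup>2 \<le> real (card P)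
           \<and> (\<forall>x\<in>P. \<forall>x'\<in>P. x \<noteq> x' \<longrightarrow> l0 \<le> \<bar>x - x'\<bar>) \<and> (\<forall>x\<in>P. \<exists>\<gamma>\<in>SL2Z. hh x ** dg Q ** \<gamma> \<in> ball g0 e)"
    by (elim exE conjE) (rule that; assumption)
  \<comment> \<open>The bound 1 keeps \<open>\<sigma> x + l\<close> below \<open>6 * q^2\<close>,
    \<open>l0 / 4\<close> keeps the transferred visits separated, and \<open>e / 4\<close> leaves
    room for the shift \<open>s\<close>.\<close>
  define l where "l = min 1 (min (l0/4) (e/4))"
  have l: "l > 0" "l \<le> 1" "l \<le> l0/4" "l \<le> e/4" using h e by (auto simp: l_def)
  have "\<exists>q::nat. q > 0 \<and> (\<forall>\<tau>. \<bar>\<tau>\<bar> \<le> M * (real q)\<^sup>2 \<longrightarrow>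
           (\<exists>P \<sigma>. finite P \<and> \<eta>0/4 * (real q)\<^sup>2 \<le> real (card P) \<and>
             (\<forall>x\<in>P. 0 \<le> \<sigma> x \<and> \<sigma> x + l \<le> 6 * (real q)\<^sup>2 \<and> (\<forall>s\<in>{0..l}. visits r (\<tau> + \<sigma> x + s) W)) \<and>
             (\<forall>x\<in>P. \<forall>x'\<in>P. x \<noteq> (x'::real) \<longrightarrow> l < \<bar>\<sigma> x - \<sigma> x'\<bar>)))" for M :: real
  proof -
    \<comment> \<open>The summand \<open>2 * |M|\<close> keeps \<open>Q\<close> between
      \<open>q / 2\<close> and \<open>3 * q / 2\<close>, \<open>8 / e\<close> keeps the corrections,
      of size about \<open>3 / K\<close>, below \<open>e\<close>, and 8 keeps \<open>b x\<close>
      between 1/2 and 3/2.\<close>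
    define K where "K = nat \<lceil>2 * \<bar>M\<bar> + 8 / e + 8\<rceil>"
    have "real K \<ge> 2 * \<bar>M\<bar> + 8 / e + 8" unfolding K_def by (rule real_nat_ceiling_ge)
    moreover have "8/e > 0" using e by simp
    ultimately have K: "real K \<ge> 2 * \<bar>M\<bar>" "real K > 8/e - 1" "real K \<ge> 8" "real K \<ge> 8 / e" by linarith+
    have K0: "K > 0" using K(3) by linarith
    have Ke: "4 / K < e"
    proof -
      have "e * real K \<ge> 8" using K(4) e(1) by (simp add: field_simps)
      thus ?thesis using K0 by (simp add: field_simps)
    qed
    obtain p q' where pq: "q' > 0" "q' \<ge> \<lceil>2 * Q0\<rceil>" "coprime p q'" "\<bar>of_int q' * r - of_int p\<bar> < 1 / (of_nat K * of_int q')"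
      using r K0 unfolding well_approximable_def by blast
    define q where "q = nat q'"
    have qq: "q > 0" "real_of_int q' = real q" using pq(1) by (auto simp: q_def)
    have qQ0: "real q \<ge> 2 * Q0" using pq(2) qq(2) by linarith
    have q1: "real q \<ge> 1" using qq by simp
    define \<theta> where "\<theta> = real q * r - of_int p"
    have \<theta>: "\<bar>\<theta>\<bar> < 1 / (real K * real q)" using pq(4) by (simp add: \<theta>_def qq)
    have \<theta>q: "\<bar>\<theta>\<bar> * real q < 1 / K" using \<theta> qq K0 by (simp add: field_simps)
    obtain u v where uv: "u * q' + v * p = 1"
      using bezout_int[of q' p] pq(3) by (auto simp: coprime_iff_gcd_eq_1 gcd.commute)
    have uv': "of_int u * real q + of_int v * of_int p = (1::real)"
      using arg_cong[OF uv, of real_of_int] by (simp add: qq)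
    \<comment> \<open>A lattice element with first column \<open>q, -p\<close>; it gives
      \<open>vv r ** \<gamma>0\<close> the small lower left entry
      \<open>\<theta> = q * r - p\<close>.\<close>
    define \<gamma>0 where "\<gamma>0 = mk q v (- p) u"
    define \<theta>' where "\<theta>' = r * v + u"
    have \<gamma>0: "\<gamma>0 \<in> SL2Z" using uv' by (simp add: \<gamma>0_def algebra_simps)
    have det: "real q * \<theta>' - \<theta> * v = 1" using uv' by (simp add: \<theta>'_def \<theta>_def algebra_simps)
    have vvg: "vv r ** \<gamma>0 = mk q v \<theta> \<theta>'" by (simp add: vv_def \<gamma>0_def \<theta>_def \<theta>'_def algebra_simps)
    show ?thesis
    proof (intro exI[of _ q] conjI allI impI)
      show "q > 0" by fact
      fix \<tau> :: real assume \<tau>: "\<bar>\<tau>\<bar> \<le> M * (real q)\<^sup>2"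
      define Q where "Q = real q + \<tau> * \<theta>"
      define Q' where "Q' = real_of_int v + \<tau> * \<theta>'"
      have detQ: "Q * \<theta>' - \<theta> * Q' = 1" using det by (simp add: Q_def Q'_def algebra_simps)
      have "\<bar>\<tau> * \<theta>\<bar> \<le> real q / 2"
      proof -
        have "\<bar>\<tau> * \<theta>\<bar> \<le> (M * (real q)\<^sup>2) * \<bar>\<theta>\<bar>" unfolding abs_mult using \<tau> by (intro mult_right_mono) auto
        also have "\<dots> = (M * real q) * (\<bar>\<theta>\<bar> * real q)" by (simp add: power2_eq_square)
        also have "\<dots> \<le> (\<bar>M\<bar> * real q) * (1 / K)" using \<theta>q by (intro mult_mono) auto
        also have "\<dots> = (\<bar>M\<bar> / K) * real q" by simp
        also have "\<dots> \<le> 1/2 * real q" using K(1) K0 by (intro mult_right_mono) (auto simp: field_simps)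
        finally show ?thesis by simp
      qed
      hence Qq: "Q \<ge> real q / 2" "Q \<le> 3/2 * real q" by (auto simp: Q_def)
      have Q: "Q > 0" using Qq qq by auto
      have QQ0: "Q \<ge> Q0" using Qq qQ0 by auto
      have Q\<theta>: "Q * \<bar>\<theta>\<bar> \<le> 3/2 * (1 / K)"
      proof -
        have "Q * \<bar>\<theta>\<bar> \<le> (3/2 * real q) * \<bar>\<theta>\<bar>" using Qq by (intro mult_right_mono) auto
        also have "\<dots> = 3/2 * (\<bar>\<theta>\<bar> * real q)" by simp
        also have "\<dots> \<le> 3/2 * (1/K)" using \<theta>q by (intro mult_left_mono) auto
        finally show ?thesis .
      qed
      have K8: "1 / K \<le> 1/8" using K(3) by (simp add: field_simps)
      \<comment> \<open>With \<theta> replaced by 0, the matrix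
        \<open>mk Q Q' \<theta> \<theta>'\<close> would be the point of the closed horocycle at time
        \<open>Q * Q'\<close>. The window is one full period from there.\<close>
      obtain P where P: "finite P" "P \<subseteq> {Q * Q'..Q * Q' + Q\<^sup>2}" "\<eta>0 * Q\<^sup>2 \<le> real (card P)"
        "\<And>x x'. x \<in> P \<Longrightarrow> x' \<in> P \<Longrightarrow> x \<noteq> x' \<Longrightarrow> l0 \<le> \<bar>x - x'\<bar>" "\<And>x. x \<in> P \<Longrightarrow> \<exists>\<gamma>\<in>SL2Z. hh x ** dg Q ** \<gamma> \<in> ball g0 e"
        using h(4)[rule_format, OF QQ0, of "Q * Q'"] by (elim exE conjE) (rule that, assumption+, blast+)
      \<comment> \<open>The reciprocal of the stretching factor \<open>a\<close>: eliminating
        \<sigma> from \<open>a * Q = Q + \<sigma> * \<theta>\<close> and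
        \<open>a * (x - Q * Q') = \<sigma>\<close> gives \<open>a * b x = 1\<close>.\<close>
      define b where "b = (\<lambda>x. 1 - (x - Q * Q') * (\<theta> / Q))"
      have b: "\<bar>1 - b x\<bar> \<le> 3/2 * (1 / K)" "b x \<ge> 1/2" "b x \<le> 3/2" if "x \<in> P" for x
      proof -
        have "0 \<le> x - Q * Q'" "x - Q * Q' \<le> Q\<^sup>2" using P(2) that by auto
        hence "\<bar>x - Q * Q'\<bar> * (\<bar>\<theta>\<bar> / Q) \<le> Q\<^sup>2 * (\<bar>\<theta>\<bar> / Q)" using Q by (intro mult_right_mono) auto
        moreover have "\<bar>1 - b x\<bar> = \<bar>x - Q * Q'\<bar> * (\<bar>\<theta>\<bar> / Q)" using Q by (simp add: b_def abs_mult)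
        ultimately have "\<bar>1 - b x\<bar> \<le> Q\<^sup>2 * (\<bar>\<theta>\<bar> / Q)" by simp
        also have "\<dots> = Q * \<bar>\<theta>\<bar>" using Q by (simp add: power2_eq_square)
        finally show *: "\<bar>1 - b x\<bar> \<le> 3/2 * (1 / K)" using Q\<theta> by linarith
        show "b x \<ge> 1/2" "b x \<le> 3/2" using * K8 by linarith+
      qed
      define \<sigma> where "\<sigma> = (\<lambda>x. (x - Q * Q') / b x)"
      show "\<exists>P \<sigma>. finite P \<and> \<eta>0/4 * (real q)\<^sup>2 \<le> real (card P) \<and>
             (\<forall>x\<in>P. 0 \<le> \<sigma> x \<and> \<sigma> x + l \<le> 6 * (real q)\<^sup>2 \<and> (\<forall>s\<in>{0..l}. visits r (\<tau> + \<sigma> x + s) W)) \<and>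
             (\<forall>x\<in>P. \<forall>x'\<in>P. x \<noteq> (x'::real) \<longrightarrow> l < \<bar>\<sigma> x - \<sigma> x'\<bar>)"
      proof (intro exI[of _ P] exI[of _ \<sigma>] conjI ballI impI)
        show "finite P" by fact
        have "(real q / 2)\<^sup>2 \<le> Q\<^sup>2" using Qq by (intro power_mono) auto
        hence "\<eta>0 * (real q / 2)\<^sup>2 \<le> \<eta>0 * Q\<^sup>2" using h(1) by simp
        thus "\<eta>0/4 * (real q)\<^sup>2 \<le> real (card P)" using P(3) by (simp add: power_divide)
      next
        fix x assume x: "x \<in> P"
        have x0: "0 \<le> x - Q * Q'" "x - Q * Q' \<le> Q\<^sup>2" using P(2) x by auto
        show "0 \<le> \<sigma> x" using x0 b[OF x] by (simp add: \<sigma>_def)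
        have "\<sigma> x \<le> Q\<^sup>2 / (1/2)" unfolding \<sigma>_def using x0 b[OF x] by (intro frac_le) auto
        also have "\<dots> \<le> 2 * (3/2 * real q)\<^sup>2" using Qq Q by (simp add: power_mono)
        also have "\<dots> = 9/2 * (real q)\<^sup>2" by (simp add: power2_eq_square)
        finally have "\<sigma> x \<le> 9/2 * (real q)\<^sup>2" .
        moreover have "(real q)\<^sup>2 \<ge> 1" using q1 by simp
        ultimately show "\<sigma> x + l \<le> 6 * (real q)\<^sup>2" using l(2) by linarith
        fix s assume s: "s \<in> {0..l}"
        obtain \<gamma> where \<gamma>: "\<gamma> \<in> SL2Z" "hh x ** dg Q ** \<gamma> \<in> ball g0 e" using P(5)[OF x] by blast
        define a where "a = 1 / b x"
        have b0: "b x \<noteq> 0" using b[OF x] by auto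
        have ab: "a * b x = 1" using b0 by (simp add: a_def)
        have a0: "a \<noteq> 0" using b0 by (simp add: a_def)
        have ax: "a * (x - Q * Q') = \<sigma> x" by (simp add: a_def \<sigma>_def)
        have bQ: "b x * Q = Q - (x - Q * Q') * \<theta>" using Q by (simp add: b_def field_simps)
        have "Q = (a * b x) * Q" using ab by simp
        also have "\<dots> = a * (b x * Q)" by (simp only: mult.assoc)
        also have "\<dots> = a * Q - (a * (x - Q * Q')) * \<theta>" unfolding bQ by (simp add: algebra_simps)
        also have "\<dots> = a * Q - \<sigma> x * \<theta>" by (simp only: ax)
        finally have aQ: "a * Q = Q + \<sigma> x * \<theta>" by simp
        have hq: "hh \<tau> ** mk q v \<theta> \<theta>' = mk Q Q' \<theta> \<theta>'"
          by (simp add: hh_def Q_def Q'_def)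
        have eq: "hh (\<tau> + \<sigma> x + s) ** vv r ** (\<gamma>0 ** \<gamma>) = f ((s, \<theta> / (a * Q)), a, hh x ** dg Q ** \<gamma>)"
        proof -
          have "hh (\<tau> + \<sigma> x + s) ** vv r ** (\<gamma>0 ** \<gamma>) = hh s ** (hh (\<sigma> x) ** (hh \<tau> ** (vv r ** \<gamma>0))) ** \<gamma>"
            by (simp add: matrix_mul_assoc flip: hh_add) (simp add: add_ac)
          also have "hh (\<sigma> x) ** (hh \<tau> ** (vv r ** \<gamma>0)) = vv (\<theta> / (a * Q)) ** dg a ** (hh x ** dg Q)"
            unfolding vvg hq using Q by (intro horocycle_time_change[OF detQ _ a0 aQ ax]) simp
          finally show ?thesis by (simp add: f_def matrix_mul_assoc)
        qed
        have "f ((s, \<theta> / (a * Q)), a, hh x ** dg Q ** \<gamma>) \<in> W"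
        proof (rule e(2))
          have "\<theta> / (a * Q) = \<theta> * b x / Q" by (simp add: a_def)
          hence "\<bar>\<theta> / (a * Q)\<bar> = \<bar>\<theta>\<bar> * b x / Q" using b[OF x] Q by (simp add: abs_mult)
          also have "\<dots> \<le> \<bar>\<theta>\<bar> * (3/2) / (real q / 2)" using b[OF x] Q Qq qq by (intro frac_le mult_left_mono) auto
          also have "\<dots> = 3 * (\<bar>\<theta>\<bar> / real q)" by simp
          also have "\<bar>\<theta>\<bar> / real q \<le> \<bar>\<theta>\<bar> * real q"
          proof -
            have "\<bar>\<theta>\<bar> / real q \<le> \<bar>\<theta>\<bar> / 1" using q1 by (intro divide_left_mono) auto
            also have "\<dots> \<le> \<bar>\<theta>\<bar> * real q" using q1 mult_left_mono[OF q1, of "\<bar>\<theta>\<bar>"] by simp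
            finally show ?thesis .
          qed
          finally have "\<bar>\<theta> / (a * Q)\<bar> \<le> 3 * (1 / K)" using \<theta>q by linarith
          moreover have "\<bar>s\<bar> \<le> e/4" using s l(4) by auto
          ultimately have "\<bar>s\<bar> + \<bar>\<theta> / (a * Q)\<bar> \<le> e/4 + 3 * (1 / K)" by (intro add_mono)
          moreover have "dist (s, \<theta> / (a * Q)) (0,0) \<le> \<bar>s\<bar> + \<bar>\<theta> / (a * Q)\<bar>"
          proof -
            have "dist (s, \<theta> / (a * Q)) (0,0) \<le> dist s 0 + dist (\<theta> / (a * Q)) 0"
              unfolding dist_Pair_Pair by (rule sqrt_sum_squares_le_sum) auto
            thus ?thesis by (simp add: dist_real_def)
          qed
          moreover have "e/4 + 3 * (1 / K) < e" using Ke by simp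
          ultimately show "dist (s, \<theta> / (a * Q)) (0,0) < e" by (meson order_trans le_less_trans)
          have "a - 1 = (1 - b x) / b x" using b0 by (simp add: a_def field_simps)
          hence "\<bar>a - 1\<bar> = \<bar>1 - b x\<bar> / b x" using b[OF x] by simp
          also have "\<dots> \<le> (3/2 * (1/K)) / (1/2)" using b[OF x] by (intro frac_le) auto
          also have "\<dots> < e" using Ke e by (simp add: field_simps)
          finally show "dist a 1 < e" by (simp add: dist_real_def)
          show "dist (hh x ** dg Q ** \<gamma>) g0 < e" using \<gamma>(2) by (simp add: dist_commute)
        qed
        hence "hh (\<tau> + \<sigma> x + s) ** vv r ** (\<gamma>0 ** \<gamma>) \<in> W" using eq by simp
        thus "visits r (\<tau> + \<sigma> x + s) W" unfolding visits_def using SL2Z_mult[OF \<gamma>0 \<gamma>(1)] by blast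
      next
        fix x x' assume x: "x \<in> P" "x' \<in> P" "x \<noteq> x'"
        have bb: "b x \<noteq> 0" "b x' \<noteq> 0" using b[OF x(1)] b[OF x(2)] by auto
        \<comment> \<open>The quadratic terms cancel because \<sigma> is fractional linear, so the
          time change divides distances by \<open>b x * b x'\<close>, at most 9/4;
          \<open>l0 / 4\<close> lies below \<open>l0 / (9/4)\<close>.\<close>
        have "(x - Q * Q') * b x' - (x' - Q * Q') * b x = x - x'"
        proof -
          have "(x - c) * (1 - (x' - c) * t) - (x' - c) * (1 - (x - c) * t) = x - x'" for c t
            by (simp add: algebra_simps)
          thus ?thesis by (simp only: b_def)
        qed
        hence "\<sigma> x - \<sigma> x' = (x - x') / (b x * b x')"
          using bb unfolding \<sigma>_def by (simp add: diff_frac_eq)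
        hence "\<bar>\<sigma> x - \<sigma> x'\<bar> = \<bar>x - x'\<bar> / (b x * b x')" using b[OF x(1)] b[OF x(2)] by (simp add: abs_mult)
        moreover have "l0 / (3/2 * (3/2)) \<le> \<bar>x - x'\<bar> / (b x * b x')"
          using P(4)[OF x] b[OF x(1)] b[OF x(2)] h(2) by (intro frac_le mult_mono) auto
        ultimately show "l < \<bar>\<sigma> x - \<sigma> x'\<bar>" using l(3) h(2) by simp
      qed
    qed
  qed
  moreover have "\<eta>0 / 4 > 0" using h by simp
  ultimately show ?thesis using l(1) by blast
qed

text \<open>Coprime pairs were counted in the positive quadrant. A change of sign and a large
  multiple of one column added to the other bring the second row there.\<close>

lemma positive_row_representative:
  assumes "g \<in> SL2R"
  shows "\<exists>\<gamma>\<in>SL2Z. (g ** \<gamma>)$2$1 > 0 \<and> (g ** \<gamma>)$2$2 > 0"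
proof -
  define y1 y2 where "y1 = g$2$1" and "y2 = g$2$2"
  show ?thesis
  proof (cases "y1 = 0")
    case True
    hence "y2 \<noteq> 0" using assms by (auto simp: SL2R_def det_2 y1_def y2_def)
    define s where "s = sgn y2"
    have s: "s = 1 \<or> s = -1" "s * y2 > 0" using \<open>y2 \<noteq> 0\<close> by (auto simp: s_def sgn_if)
    hence "mk s 0 s s \<in> SL2Z" by auto
    thus ?thesis using True s by (intro bexI[of _ "mk s 0 s s"]) (auto simp: mult_nth_2 y1_def y2_def mult.commute)
  next
    case False
    define s where "s = sgn y1"
    have s: "s = 1 \<or> s = -1" "s * y1 > 0" using False by (auto simp: s_def sgn_if)
    define k where "k = nat \<lceil>\<bar>y2\<bar> / (s * y1)\<rceil> + 1"
    have "real k > \<bar>y2\<bar> / (s * y1)" unfolding k_def using real_nat_ceiling_ge[of "\<bar>y2\<bar> / (s * y1)"] by simp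
    hence "real k * (s * y1) > \<bar>y2\<bar>" using s(2) by (simp add: field_simps)
    moreover have "s * y2 \<ge> - \<bar>y2\<bar>" using s(1) by auto
    ultimately have "s * y2 + real k * (s * y1) > 0" by linarith
    moreover have "mk s (s * k) 0 s \<in> SL2Z" using s(1) by auto
    ultimately show ?thesis using s
      by (intro bexI[of _ "mk s (s * k) 0 s"]) (auto simp: mult_nth_2 y1_def y2_def mult.commute mult.left_commute add.commute)
  qed
qed

text \<open>For \<open>n = m * q\<close> the times \<open>z * n^2\<close>, with \<open>z\<close> in
  \<open>{x..x + \<delta>}\<close>, fill a stretch of length between \<open>16 * q^2\<close> and
  \<open>25 * q^2\<close>, which contains the \<open>6 * q^2\<close> needed for the visits. Scaled
  back by \<open>T = n^2\<close>, visits of total length at least \<open>\<eta> * l * q^2\<close>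
  occupy \<open>\<eta> * l / m^2\<close>, a fixed proportion of \<delta>.\<close>

lemma negligible_never_visits:
  assumes r: "well_approximable r" and W: "open W" "W \<inter> SL2R \<noteq> {}"
  shows "negligible {\<xi>. \<forall>n::nat. \<not> visits r (\<xi> * (real n)\<^sup>2) W}" (is "negligible ?A")
proof -
  obtain g where g: "g \<in> W" "g \<in> SL2R" using W(2) by blast
  obtain \<gamma> where \<gamma>: "\<gamma> \<in> SL2Z" "(g ** \<gamma>)$2$1 > 0" "(g ** \<gamma>)$2$2 > 0"
    using positive_row_representative[OF g(2)] by blast
  have \<gamma>R: "\<gamma> \<in> SL2R" using \<gamma> SL2Z_subset_SL2R by blast
  \<comment> \<open>Right translation by a lattice element moves the target to a point with positive
    second row; visits are unaffected because lifts differ by lattice elements.\<close>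
  define W' where "W' = (\<lambda>A. A ** inv2 \<gamma>) -` W"
  have W'o: "open W'" unfolding W'_def using W(1) by (intro open_vimage continuous_intros)
  have W'g: "g ** \<gamma> \<in> W'" unfolding W'_def using g \<gamma>R by (simp add: inv2_right flip: matrix_mul_assoc)
  have visW: "visits r t W" if vis: "visits r t W'" for t
  proof -
    obtain \<gamma>' where g': "\<gamma>' \<in> SL2Z" "hh t ** vv r ** \<gamma>' ** inv2 \<gamma> \<in> W"
      using vis by (auto simp: visits_def W'_def)
    thus ?thesis unfolding visits_def
      by (intro bexI[of _ "\<gamma>' ** inv2 \<gamma>"]) (simp_all add: matrix_mul_assoc SL2Z_mult inv2_SL2Z \<gamma>(1))
  qed
  obtain \<eta> l where \<eta>: "\<eta> > 0" and l: "l > 0" and nc: "\<forall>M::real. \<exists>q::nat. q > 0 \<and> (\<forall>\<tau>. \<bar>\<tau>\<bar> \<le> M * (real q)\<^sup>2 \<longrightarrow>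
           (\<exists>P \<sigma>. finite P \<and> \<eta> * (real q)\<^sup>2 \<le> real (card P) \<and>
             (\<forall>x\<in>P. 0 \<le> \<sigma> x \<and> \<sigma> x + l \<le> 6 * (real q)\<^sup>2 \<and> (\<forall>s\<in>{0..l}. visits r (\<tau> + \<sigma> x + s) W')) \<and>
             (\<forall>x\<in>P. \<forall>x'\<in>P. x \<noteq> (x'::real) \<longrightarrow> l < \<bar>\<sigma> x - \<sigma> x'\<bar>)))"
    using nearly_closed_horocycle_visits[OF r W'o W'g SL2R_mult[OF g(2) \<gamma>R] \<gamma>(2,3)]
    by (elim exE conjE) (rule that; assumption)
  have "open (\<Union>n::nat. {\<xi>. visits r (\<xi> * (real n)\<^sup>2) W})" by (intro open_UN ballI open_visits W)
  moreover have "- ?A = (\<Union>n::nat. {\<xi>. visits r (\<xi> * (real n)\<^sup>2) W})" by auto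
  ultimately have cl: "closed ?A" by (simp add: closed_def)
  have porous: "\<exists>a b. a \<le> x \<and> x \<le> b \<and> a < b \<and> b - a < d \<and> \<eta> * l / 25 * (b - a) \<le> measure lborel ({a..b} - ?A)"
    if "d > 0" for x d :: real
  proof -
    define \<delta> where "\<delta> = min 1 (d/2)"
    have \<delta>: "\<delta> > 0" "\<delta> \<le> 1" "\<delta> < d" using \<open>d > 0\<close> by (auto simp: \<delta>_def)
    \<comment> \<open>Makes \<open>\<delta> * m^2\<close> lie between 16 and 25. Rounding up costs
      at most 1, which is at most \<open>1 / sqrt \<delta>\<close> because of
      \<open>\<delta> \<le> 1\<close>.\<close>
    define m where "m = nat \<lceil>4 / sqrt \<delta>\<rceil>"
    have s0: "sqrt \<delta> > 0" "sqrt \<delta> \<le> 1" using \<delta> by auto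
    have m0: "real m \<ge> 4 / sqrt \<delta>" unfolding m_def by (rule real_nat_ceiling_ge)
    have m4: "4 / sqrt \<delta> > 0" using s0 by simp
    have "real m < 4 / sqrt \<delta> + 1" unfolding m_def using m4 by (simp add: of_nat_nat) linarith
    also have "1 \<le> 1 / sqrt \<delta>" using s0 by simp
    also have "4 / sqrt \<delta> + 1 / sqrt \<delta> = 5 / sqrt \<delta>" by (simp flip: add_divide_distrib)
    finally have m1: "real m \<le> 5 / sqrt \<delta>" by simp
    have mm: "4 \<le> sqrt \<delta> * real m" "sqrt \<delta> * real m \<le> 5" using m0 m1 s0 by (simp_all add: field_simps)
    have "4\<^sup>2 \<le> (sqrt \<delta> * real m)\<^sup>2" "(sqrt \<delta> * real m)\<^sup>2 \<le> 5\<^sup>2" using mm by (intro power_mono; simp)+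
    hence dm: "16 \<le> \<delta> * (real m)\<^sup>2" "\<delta> * (real m)\<^sup>2 \<le> 25" using \<delta> by (simp_all add: power_mult_distrib)
    have mpos: "m > 0" using m0 m4 by linarith
    \<comment> \<open>Only now is \<open>q\<close> chosen: the starting time
      \<open>x * (m * q)^2\<close> is bounded by \<open>M * q^2\<close> with an \<open>M\<close>
      that depends on \<open>m\<close>.\<close>
    obtain q where q: "q > 0" and qq: "\<forall>\<tau>. \<bar>\<tau>\<bar> \<le> (\<bar>x\<bar> * (real m)\<^sup>2) * (real q)\<^sup>2 \<longrightarrow>
           (\<exists>P \<sigma>. finite P \<and> \<eta> * (real q)\<^sup>2 \<le> real (card P) \<and>
             (\<forall>x\<in>P. 0 \<le> \<sigma> x \<and> \<sigma> x + l \<le> 6 * (real q)\<^sup>2 \<and> (\<forall>s\<in>{0..l}. visits r (\<tau> + \<sigma> x + s) W')) \<and>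
             (\<forall>x\<in>P. \<forall>x'\<in>P. x \<noteq> (x'::real) \<longrightarrow> l < \<bar>\<sigma> x - \<sigma> x'\<bar>))"
      using nc[THEN spec, of "\<bar>x\<bar> * (real m)\<^sup>2"] by (elim exE conjE) (rule that; assumption)
    define T where "T = (real (m * q))\<^sup>2"
    have Tm: "T = (real m)\<^sup>2 * (real q)\<^sup>2" by (simp add: T_def power_mult_distrib)
    have T: "T > 0" using mpos q by (simp add: T_def)
    have xT: "\<bar>x * T\<bar> \<le> (\<bar>x\<bar> * (real m)\<^sup>2) * (real q)\<^sup>2" using T by (simp add: abs_mult Tm)
    obtain P \<sigma> where P: "finite P" "\<eta> * (real q)\<^sup>2 \<le> real (card P)"
       "\<forall>y\<in>P. 0 \<le> \<sigma> y \<and> \<sigma> y + l \<le> 6 * (real q)\<^sup>2 \<and> (\<forall>s\<in>{0..l}. visits r (x * T + \<sigma> y + s) W')"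
       "\<forall>y\<in>P. \<forall>y'\<in>P. y \<noteq> (y'::real) \<longrightarrow> l < \<bar>\<sigma> y - \<sigma> y'\<bar>"
      using qq[THEN spec, THEN mp, OF xT] by (elim exE conjE) (rule that; assumption)
    define f where "f = (\<lambda>y. x + \<sigma> y / T)"
    have sub: "(\<Union>y\<in>P. {f y..f y + l/T}) \<subseteq> {x..x + \<delta>} - ?A"
    proof
      fix z assume "z \<in> (\<Union>y\<in>P. {f y..f y + l/T})"
      then obtain y where y: "y \<in> P" "f y \<le> z" "z \<le> f y + l/T" by auto
      have Py: "0 \<le> \<sigma> y" "\<sigma> y + l \<le> 6 * (real q)\<^sup>2" "\<And>s. s \<in> {0..l} \<Longrightarrow> visits r (x * T + \<sigma> y + s) W'"
        using P(3) y(1) by blast+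
      define s where "s = (z - f y) * T"
      have "(z - f y) * T \<le> (l / T) * T" using y T by (intro mult_right_mono) auto
      hence s: "s \<in> {0..l}" using y T by (simp add: s_def)
      have "z * T = x * T + \<sigma> y + s" using T by (simp add: s_def f_def algebra_simps)
      hence "visits r (z * T) W'" using Py(3)[OF s] by simp
      hence "visits r (z * (real (m * q))\<^sup>2) W" unfolding T_def by (rule visW)
      hence nA: "z \<notin> ?A" by blast
      have "z - x \<le> (\<sigma> y + l) / T" using y(3) by (simp add: f_def add_divide_distrib)
      also have "\<dots> \<le> 6 * (real q)\<^sup>2 / T" using Py T by (intro divide_right_mono) auto
      also have "\<dots> = 6 / (real m)\<^sup>2" using q by (simp add: Tm)
      also have "\<dots> \<le> \<delta>" using dm(1) mpos by (simp add: field_simps)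
      finally have "z \<le> x + \<delta>" by simp
      moreover have "x \<le> f y" using Py(1) T by (simp add: f_def)
      ultimately show "z \<in> {x..x + \<delta>} - ?A" using nA y by auto
    qed
    have "measure lborel (\<Union>y\<in>P. {f y..f y + l/T}) = card P * (l/T)"
    proof (rule measure_separated_intervals[where f = f and w = "l/T", OF P(1)])
      show "0 \<le> l / T" using l T by simp
      fix y y' assume "y \<in> P" "y' \<in> P" "y \<noteq> y'"
      hence "l < \<bar>\<sigma> y - \<sigma> y'\<bar>" using P(4) by blast
      hence "l / T < \<bar>\<sigma> y - \<sigma> y'\<bar> / T" using T by (simp add: divide_strict_right_mono)
      also have "\<dots> = \<bar>f y - f y'\<bar>" using T by (simp add: f_def abs_divide flip: diff_divide_distrib)
      finally show "l / T < \<bar>f y - f y'\<bar>" .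
    qed
    also have "real (card P) * (l/T) \<ge> (\<eta> * (real q)\<^sup>2) * (l/T)" using P(2) l T by (intro mult_right_mono) auto
    finally have 1: "measure lborel (\<Union>y\<in>P. {f y..f y + l/T}) \<ge> (\<eta> * (real q)\<^sup>2) * (l/T)" .
    have "(\<eta> * (real q)\<^sup>2) * (l/T) = \<eta> * l / (real m)\<^sup>2" using q by (simp add: Tm)
    also have "\<dots> \<ge> \<eta> * l * (\<delta> / 25)"
    proof -
      have "\<delta> / 25 \<le> 1 / (real m)\<^sup>2" using dm(2) mpos by (simp add: field_simps)
      hence "\<eta> * l * (\<delta> / 25) \<le> \<eta> * l * (1 / (real m)\<^sup>2)" using \<eta> l by (intro mult_left_mono) auto
      thus ?thesis by simp
    qed
    finally have 2: "(\<eta> * (real q)\<^sup>2) * (l/T) \<ge> \<eta> * l * (\<delta> / 25)" .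
    have "measure lborel (\<Union>y\<in>P. {f y..f y + l/T}) \<le> measure lborel ({x..x + \<delta>} - ?A)"
    proof (rule measure_mono_fmeasurable[OF sub])
      have "?A \<in> sets lborel" using cl by simp
      moreover have "{x..x + \<delta>} \<in> fmeasurable lborel" using fmeasurable_cbox[of x "x + \<delta>"] by simp
      ultimately show "{x..x + \<delta>} - ?A \<in> fmeasurable lborel" by (intro fmeasurable_Diff)
      show "(\<Union>y\<in>P. {f y..f y + l/T}) \<in> sets lborel" using P(1) by auto
    qed
    from order_trans[OF order_trans[OF 2 1] this]
    have "\<eta> * l / 25 * (x + \<delta> - x) \<le> measure lborel ({x..x + \<delta>} - ?A)" by simp
    thus ?thesis
      using \<delta> by (intro exI[of _ x] exI[of _ "x + \<delta>"]) auto
  qed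
  have "?A \<in> sets borel" using cl by simp
  moreover have "0 < \<eta> * l / 25" using \<eta> l by simp
  ultimately show ?thesis using negligible_empty porous by (rule negligible_if_porous)
qed

definition generic :: "real \<Rightarrow> real \<Rightarrow> bool" where
  "generic r \<xi> \<longleftrightarrow> (\<forall>W. open W \<and> W \<inter> SL2R \<noteq> {} \<longrightarrow> (\<exists>n::nat. visits r (\<xi> * (real n)\<^sup>2) W))"

lemma negligible_not_generic:
  assumes "well_approximable r"
  shows "negligible {\<xi>. \<not> generic r \<xi>}"
proof -
  obtain B :: "mat2 set set" where B: "countable B" "topological_basis B"
    using ex_countable_basis by blast
  have "{\<xi>. \<not> generic r \<xi>} \<subseteq> (\<Union>W\<in>{W\<in>B. W \<inter> SL2R \<noteq> {}}. {\<xi>. \<forall>n::nat. \<not> visits r (\<xi> * (real n)\<^sup>2) W})"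
  proof
    fix \<xi> assume "\<xi> \<in> {\<xi>. \<not> generic r \<xi>}"
    then obtain W where W: "open W" "W \<inter> SL2R \<noteq> {}" "\<And>n::nat. \<not> visits r (\<xi> * (real n)\<^sup>2) W"
      by (auto simp: generic_def)
    then obtain g where g: "g \<in> W" "g \<in> SL2R" by blast
    obtain V where V: "V \<in> B" "g \<in> V" "V \<subseteq> W" using topological_basisE[OF B(2) W(1) g(1)] .
    hence "\<not> visits r (\<xi> * (real n)\<^sup>2) V" for n :: nat using W(3)[of n] by (auto simp: visits_def)
    thus "\<xi> \<in> (\<Union>W\<in>{W\<in>B. W \<inter> SL2R \<noteq> {}}. {\<xi>. \<forall>n::nat. \<not> visits r (\<xi> * (real n)\<^sup>2) W})"
      using V g by blast
  qed
  moreover have "negligible (\<Union>W\<in>{W\<in>B. W \<inter> SL2R \<noteq> {}}. {\<xi>. \<forall>n::nat. \<not> visits r (\<xi> * (real n)\<^sup>2) W})"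
  proof (rule negligible_countable_Union)
    show "countable ((\<lambda>W. {\<xi>. \<forall>n::nat. \<not> visits r (\<xi> * (real n)\<^sup>2) W}) ` {W\<in>B. W \<inter> SL2R \<noteq> {}})"
      using B(1) by (intro countable_image) (simp add: countable_Collect)
    fix S assume "S \<in> (\<lambda>W. {\<xi>. \<forall>n::nat. \<not> visits r (\<xi> * (real n)\<^sup>2) W}) ` {W\<in>B. W \<inter> SL2R \<noteq> {}}"
    thus "negligible S" using negligible_never_visits[OF assms] topological_basis_open[OF B(2)] by blast
  qed
  ultimately show ?thesis by (rule negligible_subset[rotated])
qed

section \<open>The right-invariant metric\<close>

lemma bounded_bilinear_matmul: "bounded_bilinear (\<lambda>A B. (A::mat2) ** (B::mat2))"
proof
  show "\<exists>K. \<forall>a b. norm ((a::mat2) ** (b::mat2)) \<le> norm a * norm b * K"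
    using norm_mult_le by (intro exI[of _ 8]) (simp add: mult_ac)
qed (simp_all add: mat2_eq_iff mult_nth_2 algebra_simps)

lemma bounded_linear_entry: "bounded_linear (\<lambda>M::mat2. M $ i $ j)"
  by (rule bounded_linear_compose[OF bounded_linear_vec_nth[of j] bounded_linear_vec_nth[of i]])

lemma has_vector_derivative_mk:
  assumes "(a has_real_derivative a') (at t within S)" "(b has_real_derivative b') (at t within S)"
    "(c has_real_derivative c') (at t within S)" "(d has_real_derivative d') (at t within S)"
  shows "((\<lambda>x. mk (a x) (b x) (c x) (d x)) has_vector_derivative mk a' b' c' d') (at t within S)"
proof -
  have s: "mk w x y z = w *\<^sub>R mk 1 0 0 0 + x *\<^sub>R mk 0 1 0 0 + y *\<^sub>R mk 0 0 1 0 + z *\<^sub>R mk 0 0 0 1" for w x y z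
    by (simp add: mat2_eq_iff)
  have k: "((\<lambda>x. f x *\<^sub>R v) has_vector_derivative f' *\<^sub>R v) (at t within S)" if "(f has_real_derivative f') (at t within S)" for f f' and v :: mat2
    using has_vector_derivative_scaleR[OF that has_vector_derivative_const[of v]] by simp
  have "((\<lambda>x. a x *\<^sub>R mk 1 0 0 0 + b x *\<^sub>R mk 0 1 0 0 + c x *\<^sub>R mk 0 0 1 0 + d x *\<^sub>R mk 0 0 0 1) has_vector_derivative
      (a' *\<^sub>R mk 1 0 0 0 + b' *\<^sub>R mk 0 1 0 0 + c' *\<^sub>R mk 0 0 1 0 + d' *\<^sub>R mk 0 0 0 1)) (at t within S)"
    by (intro has_vector_derivative_add k assms)
  thus ?thesis by (simp only: s[symmetric])
qed

text \<open>Since \<open>N\<close> is constrained on \<open>sl2\<close> alone, every use of the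
  triangle inequality has to stay in that subspace. The upper bound comes from a basis, the lower
  one from the minimum on the compact unit sphere of \<open>sl2\<close>.\<close>

lemma norm_equiv_sl2:
  assumes N: "is_norm_on_sl2 N"
  obtains c C where "c > 0" "C > 0" "\<And>M. M \<in> sl2 \<Longrightarrow> c * norm M \<le> N M" "\<And>M. M \<in> sl2 \<Longrightarrow> N M \<le> C * norm M"
    "continuous_on sl2 N"
proof -
  have tri: "\<And>A B. A \<in> sl2 \<Longrightarrow> B \<in> sl2 \<Longrightarrow> N (A + B) \<le> N A + N B"
    and sc: "\<And>A r. A \<in> sl2 \<Longrightarrow> N (r *\<^sub>R A) = \<bar>r\<bar> * N A" and pos: "\<And>A. A \<in> sl2 \<Longrightarrow> A \<noteq> 0 \<Longrightarrow> N A > 0"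
    using N by (auto simp: is_norm_on_sl2_def)
  have sl2_iff: "A \<in> sl2 \<longleftrightarrow> A$1$1 + A$2$2 = 0" for A by (simp add: sl2_def trace_def sum_2)
  have sl2_sc: "r *\<^sub>R A \<in> sl2" if "A \<in> sl2" for A r
    using that by (simp add: sl2_iff flip: distrib_left)
  have sl2_add: "A + B \<in> sl2" "A - B \<in> sl2" if "A \<in> sl2" "B \<in> sl2" for A B
    using that by (simp_all add: sl2_iff)
  define H E F where "H = mk 1 0 0 (-1)" and "E = mk 0 1 0 0" and "F = mk 0 0 1 0"
  have HEF: "H \<in> sl2" "E \<in> sl2" "F \<in> sl2" by (simp_all add: sl2_iff H_def E_def F_def)
  have n0: "N 0 = 0" using sc[OF HEF(1), of 0] by simp
  have nn: "N A \<ge> 0" if "A \<in> sl2" for A using pos[OF that] n0 by (cases "A = 0") auto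
  define C where "C = N H + N E + N F + 1"
  have C: "C > 0" using nn HEF by (auto simp: C_def intro!: add_nonneg_pos add_nonneg_nonneg)
  have up: "N M \<le> C * norm M" if M: "M \<in> sl2" for M
  proof -
    have eq: "M = (M$1$1 *\<^sub>R H + M$1$2 *\<^sub>R E) + M$2$1 *\<^sub>R F"
      using M by (simp add: mat2_eq_iff H_def E_def F_def sl2_iff)
    have "N M = N ((M$1$1 *\<^sub>R H + M$1$2 *\<^sub>R E) + M$2$1 *\<^sub>R F)" by (rule arg_cong[OF eq])
    also have "\<dots> \<le> N (M$1$1 *\<^sub>R H + M$1$2 *\<^sub>R E) + N (M$2$1 *\<^sub>R F)" by (intro tri sl2_add sl2_sc HEF)
    also have "\<dots> \<le> N (M$1$1 *\<^sub>R H) + N (M$1$2 *\<^sub>R E) + N (M$2$1 *\<^sub>R F)" by (intro add_right_mono tri sl2_add sl2_sc HEF)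
    also have "\<dots> = \<bar>M$1$1\<bar> * N H + \<bar>M$1$2\<bar> * N E + \<bar>M$2$1\<bar> * N F" by (simp add: sc HEF)
    also have "\<dots> \<le> norm M * N H + norm M * N E + norm M * N F"
      by (intro add_mono mult_right_mono nth_le_norm nn HEF)
    also have "\<dots> \<le> C * norm M" by (simp add: C_def algebra_simps)
    finally show ?thesis .
  qed
  have lip: "N A - N B \<le> C * norm (A - B)" if "A \<in> sl2" "B \<in> sl2" for A B
    using tri[of "A - B" B] up[of "A - B"] that sl2_add[OF that] by simp
  have cont: "continuous_on sl2 N"
  proof (rule continuous_onI)
    fix A and e :: real assume A: "A \<in> sl2" "e > 0"
    show "\<exists>d>0. \<forall>B\<in>sl2. dist B A < d \<longrightarrow> dist (N B) (N A) \<le> e"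
    proof (intro exI[of _ "e / C"] conjI ballI impI)
      show "e / C > 0" using A C by simp
      fix B assume B: "B \<in> sl2" "dist B A < e / C"
      have "C * norm (B - A) \<le> e" using B(2) C by (simp add: dist_norm field_simps)
      thus "dist (N B) (N A) \<le> e" using lip[OF B(1) A(1)] lip[OF A(1) B(1)] by (simp add: dist_real_def abs_le_iff norm_minus_commute)
    qed
  qed
  define S where "S = sl2 \<inter> sphere 0 1"
  have "closed sl2"
  proof -
    have "continuous_on UNIV (\<lambda>A::mat2. A$1$1 + A$2$2)"
      by (intro continuous_on_add linear_continuous_on bounded_linear_entry)
    from closed_Collect_eq[OF this continuous_on_const[of UNIV 0]]
    have "closed {A::mat2. A$1$1 + A$2$2 = 0}" .
    moreover have "sl2 = {A. A$1$1 + A$2$2 = 0}" by (simp add: set_eq_iff sl2_iff)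
    ultimately show ?thesis by simp
  qed
  hence "compact S" unfolding S_def by (intro closed_Int_compact compact_sphere)
  moreover have "S \<noteq> {}"
  proof -
    have "E \<noteq> 0" by (simp add: E_def mat2_eq_iff)
    hence "(1 / norm E) *\<^sub>R E \<in> S" using HEF by (simp add: S_def sl2_sc)
    thus ?thesis by blast
  qed
  moreover have "continuous_on S N" using cont by (rule continuous_on_subset) (auto simp: S_def)
  ultimately obtain A0 where A0: "A0 \<in> S" "\<forall>A\<in>S. N A0 \<le> N A"
    using continuous_attains_inf[of S N] by blast
  have "A0 \<noteq> 0" using A0(1) by (auto simp: S_def)
  hence c: "N A0 > 0" using A0(1) pos by (auto simp: S_def)
  have low: "N A0 * norm M \<le> N M" if M: "M \<in> sl2" for M
  proof (cases "M = 0")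
    case True thus ?thesis using n0 by simp
  next
    case False
    hence "(1 / norm M) *\<^sub>R M \<in> S" using M by (simp add: S_def sl2_sc)
    from A0(2)[rule_format, OF this] have "N A0 \<le> N M / norm M" using sc[OF M] by simp
    thus ?thesis using False by (simp add: field_simps)
  qed
  show ?thesis by (rule that[OF c C low up cont])
qed

text \<open>The trace of \<open>\<gamma>' t ** inv2 (\<gamma> t)\<close> is the derivative of the
  constant determinant. So this logarithmic derivative lies in \<open>sl2\<close>, where
  \<open>N\<close> is a continuous norm, and the length is an integral of a continuous
  function.\<close>

lemma sl2_curve_length:
  assumes "is_norm_on_sl2 N" "sl2_curve \<gamma> A B"
  shows "\<exists>\<gamma>'. (\<forall>t\<in>{0..1}. (\<gamma> has_vector_derivative \<gamma>' t) (at t within {0..1})) \<and> continuous_on {0..1} \<gamma>' \<and>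
    continuous_on {0..1} \<gamma> \<and> (\<forall>t\<in>{0..1}. \<gamma>' t ** inv2 (\<gamma> t) \<in> sl2) \<and>
    continuous_on {0..1} (\<lambda>t. \<gamma>' t ** inv2 (\<gamma> t)) \<and>
    continuous_on {0..1} (\<lambda>t. N (\<gamma>' t ** inv2 (\<gamma> t))) \<and>
    curve_length N \<gamma> = integral {0..1} (\<lambda>t. N (\<gamma>' t ** inv2 (\<gamma> t)))"
proof -
  obtain \<gamma>' where d: "\<And>t. t \<in> {0..1} \<Longrightarrow> (\<gamma> has_vector_derivative \<gamma>' t) (at t within {0..1})" and c': "continuous_on {0..1} \<gamma>'"
    and S: "\<And>t. t \<in> {0..1} \<Longrightarrow> \<gamma> t \<in> SL2R"
    using assms(2) unfolding sl2_curve_def by blast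
  have c: "continuous_on {0..1} \<gamma>"
    using d has_vector_derivative_continuous continuous_on_eq_continuous_within by blast
  have c\<omega>: "continuous_on {0..1} (\<lambda>t. \<gamma>' t ** inv2 (\<gamma> t))"
    unfolding inv2_def by (intro continuous_intros c c')
  have sl: "\<gamma>' t ** inv2 (\<gamma> t) \<in> sl2" if t: "t \<in> {0..1}" for t
  proof -
    have dn: "((\<lambda>t. \<gamma> t $ i $ j) has_real_derivative \<gamma>' t $ i $ j) (at t within {0..1})" for i j
    proof -
      from bounded_linear.has_vector_derivative[OF bounded_linear_entry d[OF t]] show ?thesis
        by (simp add: has_real_derivative_iff_has_vector_derivative)
    qed
    have "((\<lambda>t. \<gamma> t $ 1 $ 1 * \<gamma> t $ 2 $ 2 - \<gamma> t $ 1 $ 2 * \<gamma> t $ 2 $ 1) has_real_derivative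
       ((\<gamma>' t $ 1 $ 1 * \<gamma> t $ 2 $ 2 + \<gamma>' t $ 2 $ 2 * \<gamma> t $ 1 $ 1) - (\<gamma>' t $ 1 $ 2 * \<gamma> t $ 2 $ 1 + \<gamma>' t $ 2 $ 1 * \<gamma> t $ 1 $ 2))) (at t within {0..1})"
      by (intro DERIV_diff DERIV_mult dn)
    moreover have "((\<lambda>t. \<gamma> t $ 1 $ 1 * \<gamma> t $ 2 $ 2 - \<gamma> t $ 1 $ 2 * \<gamma> t $ 2 $ 1) has_real_derivative 0) (at t within {0..1})"
    proof (rule has_field_derivative_transform_within[OF DERIV_const zero_less_one t])
      fix s :: real assume "s \<in> {0..1}"
      thus "1 = \<gamma> s $ 1 $ 1 * \<gamma> s $ 2 $ 2 - \<gamma> s $ 1 $ 2 * \<gamma> s $ 2 $ 1" using S[of s] by (simp add: SL2R_def det_2)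
    qed
    ultimately have "(\<gamma>' t $ 1 $ 1 * \<gamma> t $ 2 $ 2 + \<gamma>' t $ 2 $ 2 * \<gamma> t $ 1 $ 1) - (\<gamma>' t $ 1 $ 2 * \<gamma> t $ 2 $ 1 + \<gamma>' t $ 2 $ 1 * \<gamma> t $ 1 $ 2) = 0"
      using t unfolding has_real_derivative_iff_has_vector_derivative
      by (intro vector_derivative_unique_within_closed_interval[of 0 1 t, simplified]) auto
    thus ?thesis by (simp add: sl2_def trace_def sum_2 mult_nth_2 inv2_def)
  qed
  have "continuous_on sl2 N" by (rule norm_equiv_sl2[OF assms(1)])
  hence cN: "continuous_on {0..1} (\<lambda>t. N (\<gamma>' t ** inv2 (\<gamma> t)))"
    by (rule continuous_on_compose2[OF _ c\<omega>]) (use sl in auto)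
  have "curve_length N \<gamma> = integral {0..1} (\<lambda>t. N (\<gamma>' t ** inv2 (\<gamma> t)))"
    unfolding curve_length_def
  proof (rule integral_cong)
    fix t :: real assume t: "t \<in> {0..1}"
    have "vector_derivative \<gamma> (at t within {0..1}) = \<gamma>' t"
      using t d[OF t] by (intro vector_derivative_within_cbox[of 0 1, simplified]) auto
    thus "N (vector_derivative \<gamma> (at t within {0..1}) ** matrix_inv (\<gamma> t)) = N (\<gamma>' t ** inv2 (\<gamma> t))"
      using matrix_inv_eq_inv2[OF S[OF t]] by simp
  qed
  with d c' c sl c\<omega> cN show ?thesis by (intro exI[of _ \<gamma>'] conjI ballI)
qed

lemma curve_length_nonneg:
  assumes "is_norm_on_sl2 N" "sl2_curve \<gamma> A B"
  shows "curve_length N \<gamma> \<ge> 0"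
proof -
  obtain c C where n: "c > 0" "C > 0" "\<And>M. M \<in> sl2 \<Longrightarrow> c * norm M \<le> N M" "\<And>M. M \<in> sl2 \<Longrightarrow> N M \<le> C * norm M"
    "continuous_on sl2 N" by (rule norm_equiv_sl2[OF assms(1)]) (rule that; blast)
  obtain \<gamma>' where g: "\<forall>t\<in>{0..1}. (\<gamma> has_vector_derivative \<gamma>' t) (at t within {0..1})" "continuous_on {0..1} \<gamma>'"
    "continuous_on {0..1} \<gamma>"
    "\<forall>t\<in>{0..1}. \<gamma>' t ** inv2 (\<gamma> t) \<in> sl2"
    "continuous_on {0..1} (\<lambda>t. \<gamma>' t ** inv2 (\<gamma> t))"
    "continuous_on {0..1} (\<lambda>t. N (\<gamma>' t ** inv2 (\<gamma> t)))"
    "curve_length N \<gamma> = integral {0..1} (\<lambda>t. N (\<gamma>' t ** inv2 (\<gamma> t)))"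
    using sl2_curve_length[OF assms] by (elim exE conjE) (rule that; assumption)
  show ?thesis unfolding g(7)
  proof (rule integral_nonneg)
    show "(\<lambda>t. N (\<gamma>' t ** inv2 (\<gamma> t))) integrable_on {0..1}" using g(6) by (rule integrable_continuous_real)
    fix t :: real assume "t \<in> {0..1}"
    from n(3)[OF g(4)[rule_format, OF this]] n(1) show "0 \<le> N (\<gamma>' t ** inv2 (\<gamma> t))"
      by (meson mult_nonneg_nonneg less_imp_le norm_ge_zero order_trans)
  qed
qed

text \<open>The bound on the length forces the maximum \<open>M\<close> of the norm along the curve to satisfy
  \<open>M \<le> 2 + M / 2\<close>, which replaces Gronwall's inequality.\<close>
lemma sl2_curve_displacement:
  assumes N: "is_norm_on_sl2 N" and n: "c > 0" "\<And>M. M \<in> sl2 \<Longrightarrow> c * norm M \<le> N M"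
    and curve: "sl2_curve \<gamma> A B" and L: "curve_length N \<gamma> \<le> L" "L \<le> c / 16"
  shows "norm (B ** inv2 A - mat 1) \<le> 32 / c * L"
proof -
  obtain \<gamma>' where g: "\<forall>t\<in>{0..1}. (\<gamma> has_vector_derivative \<gamma>' t) (at t within {0..1})" "continuous_on {0..1} \<gamma>'"
    "continuous_on {0..1} \<gamma>"
    "\<forall>t\<in>{0..1}. \<gamma>' t ** inv2 (\<gamma> t) \<in> sl2"
    "continuous_on {0..1} (\<lambda>t. \<gamma>' t ** inv2 (\<gamma> t))"
    "continuous_on {0..1} (\<lambda>t. N (\<gamma>' t ** inv2 (\<gamma> t)))"
    "curve_length N \<gamma> = integral {0..1} (\<lambda>t. N (\<gamma>' t ** inv2 (\<gamma> t)))"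
    using sl2_curve_length[OF N curve] by (elim exE conjE) (rule that; assumption)
  have AB: "\<gamma> 0 = A" "\<gamma> 1 = B" and S: "\<And>t. t \<in> {0..1} \<Longrightarrow> \<gamma> t \<in> SL2R" using curve by (auto simp: sl2_curve_def)
  have A: "A \<in> SL2R" using S[of 0] AB by simp
  define \<omega> where "\<omega> = (\<lambda>t. \<gamma>' t ** inv2 (\<gamma> t))"
  \<comment> \<open>Right translation moves the starting point to \<open>mat 1\<close> and keeps the
    logarithmic derivative.\<close>
  define \<phi> where "\<phi> = (\<lambda>t. \<gamma> t ** inv2 A)"
  define I where "I = integral {0..1} (\<lambda>t. norm (\<omega> t))"
  have c\<omega>: "continuous_on {0..1} \<omega>" using g(5) by (simp add: \<omega>_def)
  have c\<phi>: "continuous_on {0..1} \<phi>" unfolding \<phi>_def by (intro continuous_intros g(3))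
  have "c * I = integral {0..1} (\<lambda>t. c * norm (\<omega> t))" by (simp add: I_def)
  also have "\<dots> \<le> integral {0..1} (\<lambda>t. N (\<gamma>' t ** inv2 (\<gamma> t)))"
  proof (rule integral_le)
    show "(\<lambda>t. c * norm (\<omega> t)) integrable_on {0..1}" by (intro integrable_continuous_real continuous_intros c\<omega>)
    show "(\<lambda>t. N (\<gamma>' t ** inv2 (\<gamma> t))) integrable_on {0..1}" by (intro integrable_continuous_real g(6))
  qed (use n(2) g(4) in \<open>simp add: \<omega>_def\<close>)
  finally have cI: "c * I \<le> L" using g(7) L(1) by simp
  have I0: "I \<ge> 0" unfolding I_def by (intro integral_nonneg integrable_continuous_real continuous_intros c\<omega>) auto
  have "c * I \<le> c * (1/16)" using cI L(2) by simp
  hence I: "I \<le> 1/16" "I \<le> L / c" using cI n(1) by (simp_all add: field_simps)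
  have d\<phi>: "(\<phi> has_vector_derivative \<omega> t ** \<phi> t) (at t within {0..1})" if t: "t \<in> {0..1}" for t
  proof -
    have "bounded_linear (\<lambda>M::mat2. M ** inv2 A)"
      using bounded_bilinear.bounded_linear_left[OF bounded_bilinear_matmul] .
    from bounded_linear.has_vector_derivative[OF this g(1)[rule_format, OF t]]
    have "(\<phi> has_vector_derivative \<gamma>' t ** inv2 A) (at t within {0..1})" by (simp add: \<phi>_def)
    moreover have "\<omega> t ** \<phi> t = \<gamma>' t ** inv2 A"
      by (simp add: \<omega>_def \<phi>_def inv2_left' S[OF t] flip: matrix_mul_assoc)
    ultimately show ?thesis by simp
  qed
  obtain t0 where t0: "t0 \<in> {0..1}" "\<And>t. t \<in> {0..1} \<Longrightarrow> norm (\<phi> t) \<le> norm (\<phi> t0)"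
    using continuous_attains_sup[OF _ _ continuous_on_norm[OF c\<phi>]] by (metis atLeastatMost_empty_iff compact_Icc zero_le_one not_le)
  define M where "M = norm (\<phi> t0)"
  have M0: "M \<ge> 0" by (simp add: M_def)
  have \<phi>0: "\<phi> 0 = mat 1" using A by (simp add: \<phi>_def AB inv2_right)
  have main: "norm (\<phi> t - mat 1) \<le> 8 * M * I" if t: "t \<in> {0..1}" for t
  proof -
    have sub: "{0..t} \<subseteq> {0..1}" using t by auto
    have hi: "((\<lambda>s. \<omega> s ** \<phi> s) has_integral (\<phi> t - \<phi> 0)) {0..t}"
    proof (rule fundamental_theorem_of_calculus)
      show "0 \<le> t" using t by simp
      fix x assume "x \<in> {0..t}"
      thus "(\<phi> has_vector_derivative \<omega> x ** \<phi> x) (at x within {0..t})"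
        using d\<phi>[of x] sub by (meson has_vector_derivative_within_subset subsetD)
    qed
    have "norm (\<phi> t - \<phi> 0) = norm (integral {0..t} (\<lambda>s. \<omega> s ** \<phi> s))" using hi by (simp add: integral_unique)
    also have "\<dots> \<le> integral {0..t} (\<lambda>s. 8 * M * norm (\<omega> s))"
    proof (rule integral_norm_bound_integral)
      show "(\<lambda>s. \<omega> s ** \<phi> s) integrable_on {0..t}" using hi by blast
      show "(\<lambda>s. 8 * M * norm (\<omega> s)) integrable_on {0..t}"
        by (intro integrable_continuous_real continuous_intros continuous_on_subset[OF c\<omega> sub])
      fix s assume "s \<in> {0..t}"
      hence "norm (\<phi> s) \<le> M" using t0(2)[of s] sub by (auto simp: M_def)
      hence "8 * norm (\<omega> s) * norm (\<phi> s) \<le> 8 * norm (\<omega> s) * M" by (intro mult_left_mono) auto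
      thus "norm (\<omega> s ** \<phi> s) \<le> 8 * M * norm (\<omega> s)" using norm_mult_le[of "\<omega> s" "\<phi> s"] by (simp add: mult_ac)
    qed
    also have "\<dots> = 8 * M * integral {0..t} (\<lambda>s. norm (\<omega> s))" by simp
    also have "\<dots> \<le> 8 * M * I"
      unfolding I_def using M0
      by (intro mult_left_mono integral_subset_le sub integrable_continuous_real continuous_intros c\<omega> continuous_on_subset[OF c\<omega> sub]) auto
    finally show ?thesis using \<phi>0 by simp
  qed
  have "norm (mat 1 :: mat2) \<le> 2" using norm_mat2_le[of "mat 1"] by (simp add: mat_1_mk)
  moreover have "M \<le> norm (\<phi> t0 - mat 1) + norm (mat 1 :: mat2)"
    unfolding M_def using norm_triangle_ineq[of "\<phi> t0 - mat 1" "mat 1"] by simp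
  \<comment> \<open>The bound \<open>c / 16\<close> on the length makes the integral of the norm at
    most 1/16, so the factor 8 of \<open>norm_mult_le\<close> becomes 1/2. The resulting
    \<open>M \<le> 4\<close> gives the constant \<open>8 * 4 = 32\<close>.\<close>
  moreover have "8 * M * I \<le> 8 * M * (1/16)" using I(1) M0 by (intro mult_left_mono) auto
  ultimately have "M \<le> 4" using main[OF t0(1)] by linarith
  have "norm (\<phi> 1 - mat 1) \<le> 8 * M * I" by (rule main) simp
  also have "\<dots> \<le> 8 * 4 * (L / c)" using \<open>M \<le> 4\<close> M0 I I0 by (intro mult_mono) auto
  finally show ?thesis by (simp add: \<phi>_def AB)
qed

section \<open>Existence of connecting curves\<close>

text \<open>The smoothness clause of \<open>sl2_curve\<close> on its own, so that curves can be
  assembled as products.\<close>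

definition C1_path :: "(real \<Rightarrow> mat2) \<Rightarrow> bool" where
  "C1_path \<gamma> \<longleftrightarrow> (\<exists>\<gamma>'. (\<forall>t\<in>{0..1}. (\<gamma> has_vector_derivative \<gamma>' t) (at t within {0..1})) \<and> continuous_on {0..1} \<gamma>')"

lemma C1_path_const: "C1_path (\<lambda>t. A)"
  unfolding C1_path_def by (intro exI[of _ "\<lambda>t. 0"] conjI ballI has_vector_derivative_const continuous_on_const)

lemma C1_path_mult:
  assumes "C1_path f" "C1_path g"
  shows "C1_path (\<lambda>t. f t ** g t)"
proof -
  obtain f' where f: "\<forall>t\<in>{0..1}. (f has_vector_derivative f' t) (at t within {0..1})" "continuous_on {0..1} f'"
    using assms(1) unfolding C1_path_def by (elim exE conjE) (rule that; assumption)
  obtain g' where g: "\<forall>t\<in>{0..1}. (g has_vector_derivative g' t) (at t within {0..1})" "continuous_on {0..1} g'"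
    using assms(2) unfolding C1_path_def by (elim exE conjE) (rule that; assumption)
  have cf: "continuous_on {0..1} f"
    using f(1) has_vector_derivative_continuous continuous_on_eq_continuous_within by blast
  have cg: "continuous_on {0..1} g"
    using g(1) has_vector_derivative_continuous continuous_on_eq_continuous_within by blast
  show ?thesis unfolding C1_path_def
  proof (intro exI[of _ "\<lambda>t. f t ** g' t + f' t ** g t"] conjI ballI)
    fix t :: real assume t: "t \<in> {0..1}"
    show "((\<lambda>t. f t ** g t) has_vector_derivative f t ** g' t + f' t ** g t) (at t within {0..1})"
      using bounded_bilinear.has_vector_derivative[OF bounded_bilinear_matmul f(1)[rule_format, OF t] g(1)[rule_format, OF t]] .
  qed (intro continuous_on_add continuous_on_matmul cf cg f(2) g(2))
qed

lemma C1_path_mk: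
  assumes "\<And>t. t \<in> {0..1} \<Longrightarrow> (a has_real_derivative a' t) (at t within {0..1})"
    "\<And>t. t \<in> {0..1} \<Longrightarrow> (b has_real_derivative b' t) (at t within {0..1})"
    "\<And>t. t \<in> {0..1} \<Longrightarrow> (c has_real_derivative c' t) (at t within {0..1})"
    "\<And>t. t \<in> {0..1} \<Longrightarrow> (d has_real_derivative d' t) (at t within {0..1})"
    "continuous_on {0..1} a'" "continuous_on {0..1} b'" "continuous_on {0..1} c'" "continuous_on {0..1} d'"
  shows "C1_path (\<lambda>t. mk (a t) (b t) (c t) (d t))"
  unfolding C1_path_def
  by (intro exI[of _ "\<lambda>t. mk (a' t) (b' t) (c' t) (d' t)"] conjI ballI has_vector_derivative_mk continuous_on_mk assms)

lemma C1_path_hh: "C1_path (\<lambda>t. hh (t * x))"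
  unfolding hh_def
  by (rule C1_path_mk[where a' = "\<lambda>_. 0" and b' = "\<lambda>_. x" and c' = "\<lambda>_. 0" and d' = "\<lambda>_. 0"])
    (auto intro!: derivative_eq_intros)

lemma C1_path_vv: "C1_path (\<lambda>t. vv (t * x))"
  unfolding vv_def
  by (rule C1_path_mk[where a' = "\<lambda>_. 0" and b' = "\<lambda>_. 0" and c' = "\<lambda>_. x" and d' = "\<lambda>_. 0"])
    (auto intro!: derivative_eq_intros)

text \<open>Row and column operations suffice when the lower left entry is nonzero; otherwise
  multiplication by \<open>vv 1\<close> makes it nonzero. Scaling the four parameters by
  \<open>t\<close> then joins \<open>mat 1\<close> to any element.\<close>

lemma SL2R_elementary:
  assumes "M \<in> SL2R"
  shows "\<exists>w x y z. M = vv w ** hh x ** vv y ** hh z"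
proof -
  have gen: "\<exists>x y z. A = hh x ** vv y ** hh z" if "A \<in> SL2R" "A$2$1 \<noteq> 0" for A
  proof -
    obtain a b c d where A: "A = mk a b c d" using mk_eta by blast
    have "a * d - b * c = 1" "c \<noteq> 0" using that by (auto simp: A)
    hence "b = (a * d - 1) / c" by (simp add: field_simps)
    moreover have "a * ((d - 1) / c) + (a - 1) / c = (a * d - 1) / c"
      by (simp add: right_diff_distrib diff_divide_distrib)
    ultimately have "A = hh ((a - 1) / c) ** vv c ** hh ((d - 1) / c)"
      using \<open>c \<noteq> 0\<close> by (simp add: A hh_def vv_def)
    thus ?thesis by blast
  qed
  show ?thesis
  proof (cases "M$2$1 = 0")
    case False
    then obtain x y z where "M = hh x ** vv y ** hh z" using gen assms by blast
    hence "M = vv 0 ** hh x ** vv y ** hh z" by (simp add: vv_def hh_def)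
    thus ?thesis by blast
  next
    case True
    have "M$1$1 \<noteq> 0" using assms True by (auto simp: SL2R_def det_2)
    hence "(vv 1 ** M)$2$1 \<noteq> 0" using True by (simp add: mult_nth_2 vv_def)
    moreover have "vv 1 ** M \<in> SL2R" by (intro SL2R_mult vv_SL2R assms)
    ultimately obtain x y z where e: "vv 1 ** M = hh x ** vv y ** hh z" using gen by blast
    have "M = vv (-1) ** (vv 1 ** M)" by (simp add: vv_def matrix_mul_assoc flip: mat_1_mk)
    hence "M = vv (-1) ** hh x ** vv y ** hh z" unfolding e by (simp only: matrix_mul_assoc)
    thus ?thesis by blast
  qed
qed

text \<open>Guarantees that the infimum in \<open>distG\<close> is taken over a nonempty set;
  \<open>Inf {}\<close> would carry no information.\<close>

lemma sl2_curve_exists: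
  assumes "A \<in> SL2R" "B \<in> SL2R"
  shows "\<exists>\<gamma>. sl2_curve \<gamma> A B"
proof -
  obtain w x y z where e: "B ** inv2 A = vv w ** hh x ** vv y ** hh z"
    using SL2R_elementary[of "B ** inv2 A"] assms SL2R_mult inv2_SL2R by blast
  define \<gamma> where "\<gamma> = (\<lambda>t. vv (t * w) ** hh (t * x) ** vv (t * y) ** hh (t * z) ** A)"
  have C1: "C1_path \<gamma>" unfolding \<gamma>_def
    by (intro C1_path_mult C1_path_const C1_path_hh C1_path_vv)
  have \<gamma>0: "\<gamma> 0 = A" by (simp add: \<gamma>_def vv_def hh_def flip: mat_1_mk)
  have "\<gamma> 1 = (B ** inv2 A) ** A" unfolding e by (simp add: \<gamma>_def)
  hence \<gamma>1: "\<gamma> 1 = B" using assms(1) by (simp add: inv2_left flip: matrix_mul_assoc)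
  have \<gamma>S: "\<gamma> t \<in> SL2R" for t unfolding \<gamma>_def by (intro SL2R_mult vv_SL2R hh_SL2R assms)
  show ?thesis unfolding sl2_curve_def
    by (intro exI[of _ \<gamma>] conjI ballI \<gamma>0 \<gamma>1 \<gamma>S C1[unfolded C1_path_def])
qed

section \<open>Distances as infima and their comparison with the matrix norm\<close>

lemma distG_le:
  assumes "is_norm_on_sl2 N" "sl2_curve \<gamma> A B"
  shows "distG N A B \<le> curve_length N \<gamma>"
  unfolding distG_def
proof (rule cInf_lower)
  show "curve_length N \<gamma> \<in> {curve_length N \<gamma> |\<gamma>. sl2_curve \<gamma> A B}" using assms(2) by blast
  show "bdd_below {curve_length N \<gamma> |\<gamma>. sl2_curve \<gamma> A B}"
    using curve_length_nonneg[OF assms(1)] by (intro bdd_belowI[of _ 0]) blast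
qed

lemma distG_nonneg:
  assumes "is_norm_on_sl2 N" "A \<in> SL2R" "B \<in> SL2R"
  shows "distG N A B \<ge> 0"
  unfolding distG_def
proof (rule cInf_greatest)
  show "{curve_length N \<gamma> |\<gamma>. sl2_curve \<gamma> A B} \<noteq> {}" using sl2_curve_exists[OF assms(2,3)] by blast
qed (use curve_length_nonneg[OF assms(1)] in blast)

lemma distG_lessD:
  assumes "A \<in> SL2R" "B \<in> SL2R" "distG N A B < L"
  shows "\<exists>\<gamma>. sl2_curve \<gamma> A B \<and> curve_length N \<gamma> < L"
proof -
  have "{curve_length N \<gamma> |\<gamma>. sl2_curve \<gamma> A B} \<noteq> {}" using sl2_curve_exists[OF assms(1,2)] by blast
  from cInf_lessD[OF this assms(3)[unfolded distG_def]] show ?thesis by blast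
qed

lemma Xsp_memD:
  assumes "C \<in> Xsp" "A \<in> C"
  shows "A \<in> SL2R"
proof -
  obtain A0 g where "A0 \<in> SL2R" "g \<in> SL2Z" "A = A0 ** g" using assms unfolding Xsp_def by blast
  thus ?thesis using SL2R_mult SL2Z_subset_SL2R by blast
qed

lemma Xsp_nonempty: "C \<in> Xsp \<Longrightarrow> C \<noteq> {}"
  using mat_1_SL2Z unfolding Xsp_def by blast

lemma distX_le:
  assumes "is_norm_on_sl2 N" "C \<in> Xsp" "D \<in> Xsp" "A \<in> C" "B \<in> D"
  shows "distX N C D \<le> distG N A B"
  unfolding distX_def
proof (rule cInf_lower)
  show "distG N A B \<in> {distG N A B |A B. A \<in> C \<and> B \<in> D}" using assms(4,5) by (intro CollectI exI[of _ A] exI[of _ B]) simp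
  show "bdd_below {distG N A B |A B. A \<in> C \<and> B \<in> D}"
  proof (rule bdd_belowI[of _ 0])
    fix x assume "x \<in> {distG N A B |A B. A \<in> C \<and> B \<in> D}"
    then obtain A B where "x = distG N A B" "A \<in> C" "B \<in> D" by blast
    thus "0 \<le> x" using distG_nonneg[OF assms(1) Xsp_memD[OF assms(2)] Xsp_memD[OF assms(3)]] by simp
  qed
qed

lemma distX_lessD:
  assumes "C \<in> Xsp" "D \<in> Xsp" "distX N C D < L"
  shows "\<exists>A\<in>C. \<exists>B\<in>D. distG N A B < L"
proof -
  obtain A B where "A \<in> C" "B \<in> D" using Xsp_nonempty[OF assms(1)] Xsp_nonempty[OF assms(2)] by auto
  hence "distG N A B \<in> {distG N A B |A B. A \<in> C \<and> B \<in> D}" by (intro CollectI exI[of _ A] exI[of _ B]) simp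
  hence ne: "{distG N A B |A B. A \<in> C \<and> B \<in> D} \<noteq> {}" by (metis empty_iff)
  obtain x where "x \<in> {distG N A B |A B. A \<in> C \<and> B \<in> D}" "x < L"
    using cInf_lessD[OF ne assms(3)[unfolded distX_def]] by (elim bexE) (rule that; assumption)
  thus ?thesis by (elim CollectE exE conjE) (intro bexI; simp)
qed

text \<open>Both sides depend on \<open>A\<close> and \<open>B\<close> only through right-invariant
  quantities, so the constants are uniform over the noncompact group.\<close>

lemma distG_displacement:
  assumes N: "is_norm_on_sl2 N"
  shows "\<exists>K>0. \<exists>L0>0. \<forall>A\<in>SL2R. \<forall>B\<in>SL2R. \<forall>L\<le>L0. distG N A B < L \<longrightarrow> norm (B ** inv2 A - mat 1) \<le> K * L"
proof -
  obtain c C where n: "c > 0" "C > 0" "\<And>M. M \<in> sl2 \<Longrightarrow> c * norm M \<le> N M" "\<And>M. M \<in> sl2 \<Longrightarrow> N M \<le> C * norm M"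
    "continuous_on sl2 N" by (rule norm_equiv_sl2[OF N]) (rule that; blast)
  have main: "norm (B ** inv2 A - mat 1) \<le> 32 / c * L" if AB: "A \<in> SL2R" "B \<in> SL2R" "L \<le> c / 16" "distG N A B < L" for A B L
  proof -
    obtain \<gamma> where "sl2_curve \<gamma> A B" "curve_length N \<gamma> < L" using distG_lessD[OF AB(1,2,4)] by blast
    thus ?thesis using AB(3) by (intro sl2_curve_displacement[OF N n(1,3)]) auto
  qed
  have "32 / c > 0" "c / 16 > 0" using n(1) by auto
  with main show ?thesis by (intro exI[of _ "32 / c"] conjI exI[of _ "c / 16"] ballI allI impI)
qed

text \<open>The joining curve moves three entries of the displacement linearly and lets the
  determinant dictate the fourth; near \<open>mat 1\<close> the division involved is
  harmless.\<close>

lemma distG_small: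
  assumes N: "is_norm_on_sl2 N" and e: "\<epsilon> > 0"
  shows "\<exists>\<delta>>0. \<forall>A\<in>SL2R. \<forall>B\<in>SL2R. norm (B ** inv2 A - mat 1) < \<delta> \<longrightarrow> distG N A B < \<epsilon>"
proof -
  obtain c0 C where n: "c0 > 0" "C > 0" "\<And>M. M \<in> sl2 \<Longrightarrow> c0 * norm M \<le> N M" "\<And>M. M \<in> sl2 \<Longrightarrow> N M \<le> C * norm M"
    "continuous_on sl2 N" by (rule norm_equiv_sl2[OF N]) (rule that; blast)
  \<comment> \<open>The bound 1/2 keeps the divisor \<open>D t\<close> at least 1/2; the factor 1000
    beats the speed bound \<open>900 * C * \<delta>\<close> below, which comes from
    \<open>8 * 14 * 5\<close>.\<close>
  define \<delta> where "\<delta> = min (1/2) (\<epsilon> / (1000 * C))"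
  have \<delta>: "\<delta> > 0" "\<delta> \<le> 1/2" "\<delta> \<le> \<epsilon> / (1000 * C)" using e n(2) by (auto simp: \<delta>_def)
  have "distG N A B < \<epsilon>" if AB: "A \<in> SL2R" "B \<in> SL2R" and near: "norm (B ** inv2 A - mat 1) < \<delta>" for A B
  proof -
    obtain p b c d where M: "B ** inv2 A = mk p b c d" using mk_eta by blast
    have det: "p * d - b * c = 1" using SL2R_mult[OF AB(2) inv2_SL2R[OF AB(1)]] unfolding M by simp
    define \<alpha> where "\<alpha> = p - 1"
    have ent: "\<bar>\<alpha>\<bar> \<le> \<delta>" "\<bar>b\<bar> \<le> \<delta>" "\<bar>c\<bar> \<le> \<delta>"
      using near nth_le_norm[of "B ** inv2 A - mat 1" 1 1] nth_le_norm[of "B ** inv2 A - mat 1" 1 2] nth_le_norm[of "B ** inv2 A - mat 1" 2 1]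
      unfolding M by (simp_all add: mat_1_mk \<alpha>_def)
    define D where "D = (\<lambda>t. 1 + t * \<alpha>)"
    define d0 where "d0 = (\<lambda>t. (1 + t^2 * (b * c)) / D t)"
    define d1 where "d1 = (\<lambda>t. (2 * t * (b * c) * D t - (1 + t^2 * (b * c)) * \<alpha>) / (D t * D t))"
    define m where "m = (\<lambda>t. mk (D t) (t * b) (t * c) (d0 t))"
    define m' where "m' = (\<lambda>t::real. mk \<alpha> b c (d1 t))"
    define \<gamma> where "\<gamma> = (\<lambda>t. m t ** A)"
    have D: "1/2 \<le> D t" "D t \<le> 3/2" if "t \<in> {0..1}" for t
    proof -
      have "\<bar>t * \<alpha>\<bar> \<le> 1 * \<delta>" unfolding abs_mult using that ent by (intro mult_mono) auto
      thus "1/2 \<le> D t" "D t \<le> 3/2" using \<delta>(2) unfolding D_def by linarith+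
    qed
    have D0: "D t \<noteq> 0" if "t \<in> {0..1}" for t using D[OF that] by auto
    have dm: "(m has_vector_derivative m' t) (at t within {0..1})" if t: "t \<in> {0..1}" for t
      unfolding m_def m'_def
    proof (rule has_vector_derivative_mk)
      show dD: "(D has_real_derivative \<alpha>) (at t within {0..1})"
        unfolding D_def by (auto intro!: derivative_eq_intros)
      have nn: "((\<lambda>t. 1 + t^2 * (b * c)) has_real_derivative 2 * t * (b * c)) (at t within {0..1})"
        by (auto intro!: derivative_eq_intros)
      show "(d0 has_real_derivative d1 t) (at t within {0..1})"
        unfolding d0_def d1_def by (rule DERIV_divide[OF nn dD D0[OF t]])
    qed (auto intro!: derivative_eq_intros)
    have cD: "continuous_on {0..1} D" unfolding D_def by (intro continuous_intros)
    have cd1: "continuous_on {0..1} d1" unfolding d1_def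
      by (intro continuous_on_divide continuous_on_diff continuous_on_mult continuous_on_add continuous_on_power continuous_on_id continuous_on_const cD) (use D0 in auto)
    have cm': "continuous_on {0..1} m'" unfolding m'_def by (intro continuous_on_mk continuous_on_const cd1)
    have \<gamma>d: "(\<gamma> has_vector_derivative m' t ** A) (at t within {0..1})" if t: "t \<in> {0..1}" for t
      unfolding \<gamma>_def
      using bounded_linear.has_vector_derivative[OF bounded_bilinear.bounded_linear_left[OF bounded_bilinear_matmul] dm[OF t]] .
    have mS: "m t \<in> SL2R" if "t \<in> {0..1}" for t
      using D0[OF that] by (simp add: m_def d0_def power2_eq_square)
    have curve: "sl2_curve \<gamma> A B"
      unfolding sl2_curve_def
    proof (intro conjI exI[of _ "\<lambda>t. m' t ** A"] ballI)
      show "\<gamma> 0 = A" by (simp add: \<gamma>_def m_def D_def d0_def flip: mat_1_mk)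
      have "m 1 = mk p b c d"
      proof -
        have "p \<noteq> 0" using D0[of 1] by (simp add: D_def \<alpha>_def)
        hence "(1 + b * c) / p = d" using det by (simp add: field_simps)
        thus ?thesis by (simp add: m_def D_def d0_def \<alpha>_def)
      qed
      hence "\<gamma> 1 = B ** inv2 A ** A" by (simp add: \<gamma>_def M)
      thus "\<gamma> 1 = B" using AB(1) by (simp add: inv2_left flip: matrix_mul_assoc)
      show "\<And>t. t \<in> {0..1} \<Longrightarrow> \<gamma> t \<in> SL2R" unfolding \<gamma>_def by (intro SL2R_mult mS AB)
      show "continuous_on {0..1} (\<lambda>t. m' t ** A)" by (intro continuous_on_matmul cm' continuous_on_const)
    qed (rule \<gamma>d)
    obtain \<gamma>' where g: "\<forall>t\<in>{0..1}. (\<gamma> has_vector_derivative \<gamma>' t) (at t within {0..1})" "continuous_on {0..1} \<gamma>'"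
      "continuous_on {0..1} \<gamma>" "\<forall>t\<in>{0..1}. \<gamma>' t ** inv2 (\<gamma> t) \<in> sl2"
      "continuous_on {0..1} (\<lambda>t. \<gamma>' t ** inv2 (\<gamma> t))"
      "continuous_on {0..1} (\<lambda>t. N (\<gamma>' t ** inv2 (\<gamma> t)))"
      "curve_length N \<gamma> = integral {0..1} (\<lambda>t. N (\<gamma>' t ** inv2 (\<gamma> t)))"
      using sl2_curve_length[OF N curve] by (elim exE conjE) (rule that; assumption)
    have bc: "\<bar>b * c\<bar> \<le> \<delta> / 2"
    proof -
      have "\<bar>b * c\<bar> \<le> \<delta> * (1/2)" unfolding abs_mult using ent \<delta> by (intro mult_mono) auto
      thus ?thesis by simp
    qed
    have bound: "N (\<gamma>' t ** inv2 (\<gamma> t)) \<le> 900 * C * \<delta>" if t: "t \<in> {0..1}" for t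
    proof -
      have "\<gamma>' t = m' t ** A"
        using g(1) t \<gamma>d[OF t] by (intro vector_derivative_unique_within_closed_interval[of 0 1 t, simplified]) auto
      hence "\<gamma>' t ** inv2 (\<gamma> t) = m' t ** (A ** inv2 A) ** inv2 (m t)"
        by (simp add: \<gamma>_def inv2_mult matrix_mul_assoc)
      hence eq: "\<gamma>' t ** inv2 (\<gamma> t) = m' t ** inv2 (m t)" using AB(1) by (simp add: inv2_right)
      have t01: "0 \<le> t" "t \<le> 1" using t by auto
      have tt: "\<bar>t^2 * (b * c)\<bar> \<le> \<delta> / 2"
      proof -
        have "\<bar>t^2 * (b * c)\<bar> \<le> 1 * (\<delta> / 2)" unfolding abs_mult[of "t^2"] using bc t01 by (intro mult_mono) (auto simp: power_le_one)
        thus ?thesis by simp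
      qed
      have n1: "\<bar>1 + t^2 * (b * c)\<bar> \<le> 5/4" using tt \<delta>(2) by linarith
      have d0b: "\<bar>d0 t\<bar> \<le> 5/2"
      proof -
        have "\<bar>d0 t\<bar> = \<bar>1 + t^2 * (b * c)\<bar> / D t" using D[OF t] by (simp add: d0_def abs_divide)
        also have "\<dots> \<le> (5/4) / (1/2)" using n1 D[OF t] by (intro frac_le) auto
        finally show ?thesis by simp
      qed
      have d1b: "\<bar>d1 t\<bar> \<le> 11 * \<delta>"
      proof -
        have "\<bar>2 * t * (b * c) * D t\<bar> = 2 * t * \<bar>b * c\<bar> * D t" using t01 D[OF t] by (simp add: abs_mult)
        also have "\<dots> \<le> 2 * 1 * (\<delta> / 2) * (3/2)" using t01 D[OF t] bc \<delta> by (intro mult_mono) auto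
        finally have 1: "\<bar>2 * t * (b * c) * D t\<bar> \<le> 3/2 * \<delta>" by simp
        have "\<bar>(1 + t^2 * (b * c)) * \<alpha>\<bar> \<le> 5/4 * \<delta>" unfolding abs_mult[of "1 + t^2 * (b * c)"] using n1 ent by (intro mult_mono) auto
        hence num: "\<bar>2 * t * (b * c) * D t - (1 + t^2 * (b * c)) * \<alpha>\<bar> \<le> 11/4 * \<delta>" using 1 by linarith
        have "(1/2) * (1/2) \<le> D t * D t" using D[OF t] by (intro mult_mono) auto
        hence den: "1/4 \<le> D t * D t" by simp
        have "\<bar>d1 t\<bar> = \<bar>2 * t * (b * c) * D t - (1 + t^2 * (b * c)) * \<alpha>\<bar> / (D t * D t)" using D[OF t] by (simp add: d1_def abs_divide)
        also have "\<dots> \<le> (11/4 * \<delta>) / (1/4)" using num den \<delta> by (intro frac_le) auto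
        finally show ?thesis by simp
      qed
      have a: "norm (m' t) \<le> 14 * \<delta>" using norm_mat2_le[of "m' t"] ent d1b by (simp add: m'_def)
      have tb: "\<bar>t * b\<bar> \<le> 1 * \<delta>" "\<bar>t * c\<bar> \<le> 1 * \<delta>" unfolding abs_mult using t01 ent by (intro mult_mono; simp)+
      have b: "norm (inv2 (m t)) \<le> 5" using norm_mat2_le[of "inv2 (m t)"] d0b D[OF t] tb \<delta>(2) by (simp add: m_def)
      have "N (\<gamma>' t ** inv2 (\<gamma> t)) \<le> C * norm (m' t ** inv2 (m t))" using n(4)[OF g(4)[rule_format, OF t]] unfolding eq .
      also have "\<dots> \<le> C * (8 * norm (m' t) * norm (inv2 (m t)))" using n(2) norm_mult_le by (intro mult_left_mono) auto
      also have "\<dots> \<le> C * (8 * (14 * \<delta>) * 5)" using n(2) a b \<delta> by (intro mult_left_mono mult_mono) auto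
      also have "\<dots> \<le> 900 * C * \<delta>" using n(2) \<delta>(1) by simp
      finally show ?thesis .
    qed
    have "distG N A B \<le> curve_length N \<gamma>" by (rule distG_le[OF N curve])
    also have "\<dots> \<le> integral {0..1::real} (\<lambda>t. 900 * C * \<delta>)"
      unfolding g(7)
    proof (rule integral_le)
      show "(\<lambda>t. N (\<gamma>' t ** inv2 (\<gamma> t))) integrable_on {0..1}" by (intro integrable_continuous_real g(6))
    qed (use bound in auto)
    also have "\<dots> = 900 * C * \<delta>" by simp
    also have "\<dots> \<le> 900 * C * (\<epsilon> / (1000 * C))" using \<delta>(3) n(2) by (intro mult_left_mono) auto
    also have "\<dots> < \<epsilon>" using n(2) e by simp
    finally show ?thesis .
  qed
  thus ?thesis using \<delta>(1) by blast
qed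

section \<open>One-parameter unipotent subgroups\<close>

text \<open>Cauchy's functional equation: additivity settles rational arguments, and continuity
  extends the identity to their closure.\<close>

lemma additive_continuous_real_linear:
  fixes f :: "real \<Rightarrow> 'a::real_normed_vector"
  assumes "continuous_on UNIV f" "\<And>s t. f (s + t) = f s + f t"
  shows "f t = t *\<^sub>R f 1"
proof -
  have f0: "f 0 = 0"
  proof -
    have "f 0 + f 0 = f (0 + 0)" by (rule assms(2)[symmetric])
    also have "\<dots> = f 0 + 0" by (simp only: add_0_right)
    finally show ?thesis by (simp only: add_left_cancel)
  qed
  have fm: "f (- t) = - f t" for t 
  proof -
    have "f t + f (- t) = f (t + - t)" by (rule assms(2)[symmetric])
    also have "\<dots> = 0" by (simp only: add.right_inverse f0)
    finally have "f t + f (- t) = 0" .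
    thus ?thesis by (rule minus_unique[symmetric])
  qed
  have fn: "f (real n * t) = real n *\<^sub>R f t" for n t
  proof (induction n)
    case (Suc n)
    have "f (real (Suc n) * t) = f (real n * t + t)" by (simp add: algebra_simps)
    also have "\<dots> = real n *\<^sub>R f t + f t" by (simp only: assms(2) Suc)
    finally show ?case by (simp add: scaleR_left_distrib add.commute)
  qed (simp add: f0)
  have fi: "f (of_int k * t) = of_int k *\<^sub>R f t" for k t
  proof (cases "k \<ge> 0")
    case True
    thus ?thesis using fn[of "nat k" t] by simp
  next
    case False
    hence "f (- (real (nat (-k)) * t)) = - (real (nat (-k)) *\<^sub>R f t)" by (simp only: fm fn)
    thus ?thesis using False by simp
  qed
  have fq: "f q = q *\<^sub>R f 1" if q: "q \<in> \<rat>" for q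
  proof -
    obtain a b where "b > 0" "coprime a b" "q = of_int a / of_int b" by (rule Rats_cases'[OF q])
    hence ab: "b \<noteq> 0" "q = of_int a / of_int b" by auto
    have "of_int b *\<^sub>R f q = f (of_int a * 1)" using fi[of b q] ab by simp
    also have "\<dots> = of_int a *\<^sub>R f 1" by (rule fi)
    finally have "(1 / of_int b) *\<^sub>R (of_int b *\<^sub>R f q) = (1 / of_int b) *\<^sub>R (real_of_int a *\<^sub>R f 1)" by simp
    thus ?thesis using ab by simp
  qed
  have "continuous_on (closure \<rat>) (\<lambda>t. f t - t *\<^sub>R f 1)"
    unfolding Rats_closure_real by (intro continuous_on_diff assms(1) continuous_on_scaleR continuous_on_id continuous_on_const)
  moreover have "q \<in> \<rat> \<Longrightarrow> f q - q *\<^sub>R f 1 = 0" for q using fq[of q] by simp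
  moreover have "t \<in> closure \<rat>" unfolding Rats_closure_real by simp
  ultimately have "f t - t *\<^sub>R f 1 = 0"
    by (rule continuous_constant_on_closure)
  thus ?thesis by simp
qed

text \<open>The Jordan form, with the conjugating matrix kept in \<open>SL2R\<close>; the
  normalisation lost in this way is the factor \<open>c\<close>.\<close>

lemma nilpotent_conjugate:
  fixes X :: mat2
  assumes "X ** X = 0" "X \<noteq> 0"
  shows "\<exists>k\<in>SL2R. \<exists>c. c \<noteq> 0 \<and> X = k ** mk 0 c 0 0 ** inv2 k"
proof -
  obtain a b c d where X: "X = mk a b c d" using mk_eta by blast
  have eqs: "a*a + b*c = 0" "a*b + b*d = 0" "c*a + d*c = 0" "c*b + d*d = 0"
    using assms(1) unfolding X by (simp_all add: mat2_eq_iff)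
  show ?thesis
  proof (cases "c = 0")
    case True
    hence "a = 0" "d = 0" using eqs by auto
    hence "X = mk 1 0 0 1 ** mk 0 b 0 0 ** inv2 (mk 1 0 0 1)" using True X by simp
    moreover have "b \<noteq> 0" using assms(2) True \<open>a = 0\<close> \<open>d = 0\<close> X by (auto simp: mat2_eq_iff)
    ultimately show ?thesis by (intro bexI[of _ "mk 1 0 0 1"] exI[of _ b]) auto
  next
    case False
    have "c * (a + d) = 0" using eqs(3) by (simp add: algebra_simps)
    hence d: "d = - a" using False by simp
    have b: "b = - (a * a) / c" using eqs(1) False by (simp add: divide_simps)
    \<comment> \<open>The column \<open>a/c, 1\<close> spans the image of \<open>X\<close>, which is
      also its kernel, and the column \<open>-1, 0\<close> is mapped to \<open>-c\<close> times it
      and makes the determinant 1.\<close>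
    have "X = mk (a/c) (-1) 1 0 ** mk 0 (-c) 0 0 ** inv2 (mk (a/c) (-1) 1 0)"
      using False by (simp add: X d b)
    thus ?thesis using False by (intro bexI[of _ "mk (a/c) (-1) 1 0"] exI[of _ "-c"]) auto
  qed
qed

text \<open>Writing \<open>u t = mat 1 + n t\<close>, the group law makes \<open>n\<close> additive
  up to the product \<open>n s ** n t\<close>. That product vanishes because the elements commute
  and have square zero, so \<open>n\<close> is additive, continuous and therefore linear.\<close>

lemma unipotent_conjugate:
  assumes "unipotent_one_param u"
  shows "\<exists>k\<in>SL2R. \<exists>c. c \<noteq> 0 \<and> (\<forall>t. u t = k ** hh (c * t) ** inv2 k)"
proof -
  have cu: "continuous_on UNIV u" and add: "\<And>s t. u (s + t) = u s ** u t"
    and nil: "\<And>t. (u t - mat 1) ** (u t - mat 1) = 0" and nt: "\<exists>t. u t \<noteq> mat 1"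
    using assms by (auto simp: unipotent_one_param_def)
  define n where "n = (\<lambda>t. u t - mat 1)"
  have u: "u t = mat 1 + n t" for t by (simp add: n_def)
  have nn: "n t ** n t = 0" for t using nil by (simp add: n_def)
  have matrix_add_rdistrib: "(A + B) ** C = A ** C + B ** C" for A B C :: mat2
    by (simp add: mat2_eq_iff mult_nth_2 algebra_simps)
  have nadd: "n (s + t) = n s + n t + n s ** n t" for s t
    using add[of s t] unfolding u by (simp add: matrix_add_ldistrib matrix_add_rdistrib algebra_simps)
  have comm: "n s ** n t = n t ** n s" for s t
    using nadd[of s t] nadd[of t s] by (simp add: add.commute)
  have prod0: "n s ** n t = 0" for s t
  proof -
    have a: "n s ** (n s ** C) = 0" for C using nn[of s] by (simp add: matrix_mul_assoc)
    have b: "n t ** (n s ** n t) = 0" unfolding comm[of s t] using nn[of t] by (simp add: matrix_mul_assoc)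
    have c: "n s ** n t ** n s = 0" unfolding comm[of s t] using nn[of s] by (simp flip: matrix_mul_assoc)
    have d: "n s ** n t ** n t = 0" using nn[of t] by (simp flip: matrix_mul_assoc)
    have e: "n s ** n t ** (n s ** n t) = 0" using c by (simp add: matrix_mul_assoc)
    \<comment> \<open>Of the nine products only the two mixed ones survive, and they are equal;
      hence twice \<open>n s ** n t\<close> is zero.\<close>
    have "0 = (n s + n t + n s ** n t) ** (n s + n t + n s ** n t)" using nn[of "s + t"] unfolding nadd by simp
    also have "\<dots> = n s ** n t + n t ** n s"
      unfolding matrix_add_ldistrib matrix_add_rdistrib by (simp add: nn a b c d e)
    finally have "2 *\<^sub>R (n s ** n t) = 0" unfolding comm[of t s] by (simp add: scaleR_2)
    thus ?thesis by simp
  qed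
  have "continuous_on UNIV n" unfolding n_def by (intro continuous_on_diff cu continuous_on_const)
  hence lin: "n t = t *\<^sub>R n 1" for t
    using additive_continuous_real_linear[of n t] nadd prod0 by simp
  have "n 1 \<noteq> 0"
  proof
    assume "n 1 = 0"
    hence "n t = 0" for t using lin[of t] by simp
    thus False using nt by (simp add: n_def)
  qed
  then obtain k c where k: "k \<in> SL2R" "c \<noteq> 0" "n 1 = k ** mk 0 c 0 0 ** inv2 k"
    using nilpotent_conjugate[OF nn[of 1]] by blast
  have "u t = k ** hh (c * t) ** inv2 k" for t
  proof -
    have "hh (c * t) = mat 1 + t *\<^sub>R mk 0 c 0 0" by (simp add: mat2_eq_iff hh_def mat_1_mk mult.commute)
    hence "k ** hh (c * t) ** inv2 k = k ** inv2 k + k ** (t *\<^sub>R mk 0 c 0 0) ** inv2 k"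
      by (simp add: matrix_add_ldistrib matrix_add_rdistrib)
    also have "k ** (t *\<^sub>R mk 0 c 0 0) ** inv2 k = t *\<^sub>R n 1"
      unfolding k(3) by (simp add: mat2_eq_iff mult_nth_2 algebra_simps)
    finally show ?thesis using k(1) by (simp add: inv2_right u flip: lin)
  qed
  thus ?thesis using k by blast
qed

section \<open>Density of orbits along squares\<close>

definition coset :: "mat2 \<Rightarrow> mat2 set" where
  "coset A = (\<lambda>g. A ** g) ` SL2Z"

lemma coset_in_Xsp: "A \<in> SL2R \<Longrightarrow> coset A \<in> Xsp"
  unfolding Xsp_def coset_def by blast

lemma mem_coset_self: "A \<in> coset A"
  unfolding coset_def using mat_1_SL2Z by (intro image_eqI[of _ _ "mat 1"]) simp_all

lemma Xsp_cosetE: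
  assumes "x \<in> Xsp"
  obtains A where "A \<in> SL2R" "x = coset A"
  using assms unfolding Xsp_def coset_def by blast

lemma act_coset: "act g (coset A) = coset (g ** A)"
  unfolding act_def coset_def image_image by (simp add: matrix_mul_assoc)

lemma act_act: "act g (act h x) = act (g ** h) x"
  unfolding act_def image_image by (simp add: matrix_mul_assoc)

lemma act_Xsp:
  assumes "g \<in> SL2R" "x \<in> Xsp"
  shows "act g x \<in> Xsp"
proof -
  obtain A where "A \<in> SL2R" "x = coset A" using assms(2) by (rule Xsp_cosetE)
  thus ?thesis using assms(1) by (simp add: act_coset coset_in_Xsp SL2R_mult)
qed

text \<open>Density tested on open sets of matrices, hence independent of \<open>N\<close>; the
  metric enters only through \<open>denseX_if_dense_squares\<close>.\<close>

definition dense_squares :: "(real \<Rightarrow> mat2) \<Rightarrow> mat2 set \<Rightarrow> bool" where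
  "dense_squares u x \<longleftrightarrow> (\<forall>W. open W \<and> W \<inter> SL2R \<noteq> {} \<longrightarrow> (\<exists>n::nat. act (u (real n ^ 2)) x \<inter> W \<noteq> {}))"

lemma denseX_if_dense_squares:
  assumes N: "is_norm_on_sl2 N" and u: "\<And>t. u t \<in> SL2R" and x: "x \<in> Xsp" "dense_squares u x"
  shows "denseX N {act (u (real n ^ 2)) x | n. True}"
  unfolding denseX_def
proof (intro conjI ballI allI impI)
  show "{act (u (real n ^ 2)) x | n. True} \<subseteq> Xsp" using act_Xsp[OF u x(1)] by blast
  fix y and \<epsilon> :: real assume y: "y \<in> Xsp" and e: "\<epsilon> > 0"
  obtain B where B: "B \<in> SL2R" "y = coset B" using y by (rule Xsp_cosetE)
  obtain \<delta> where \<delta>: "\<delta> > 0" "\<forall>A\<in>SL2R. \<forall>B\<in>SL2R. norm (B ** inv2 A - mat 1) < \<delta> \<longrightarrow> distG N A B < \<epsilon>"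
    using distG_small[OF N e] by (elim exE conjE) (rule that; assumption)
  define W where "W = (\<lambda>A. B ** inv2 A) -` ball (mat 1) \<delta>"
  have "open W" unfolding W_def inv2_def
  proof (rule open_vimage)
    have "continuous_on UNIV (\<lambda>M::mat2. M $ i $ j)" for i j
      by (rule linear_continuous_on[OF bounded_linear_entry])
    thus "continuous_on UNIV (\<lambda>A::mat2. B ** mk (A $ 2 $ 2) (- A $ 1 $ 2) (- A $ 2 $ 1) (A $ 1 $ 1))"
      by (intro continuous_on_matmul continuous_on_const continuous_on_mk continuous_on_minus)
  qed simp
  moreover have "B \<in> W" using \<delta>(1) B(1) by (simp add: W_def inv2_right)
  ultimately obtain n :: nat where "act (u (real n ^ 2)) x \<inter> W \<noteq> {}"
    using x(2) B(1) unfolding dense_squares_def by blast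
  then obtain A where A: "A \<in> act (u (real n ^ 2)) x" "A \<in> W" by blast
  have X: "act (u (real n ^ 2)) x \<in> Xsp" by (rule act_Xsp[OF u x(1)])
  have "norm (B ** inv2 A - mat 1) < \<delta>" using A(2) by (simp add: W_def dist_norm norm_minus_commute)
  hence "distG N A B < \<epsilon>" using \<delta>(2) Xsp_memD[OF X A(1)] B(1) by simp
  moreover have "distX N (act (u (real n ^ 2)) x) y \<le> distG N A B"
    using distX_le[OF N X y A(1)] mem_coset_self B(2) by simp
  ultimately show "\<exists>z\<in>{act (u (real n ^ 2)) x | n. True}. distX N z y < \<epsilon>"
    by (intro bexI[of _ "act (u (real n ^ 2)) x"]) auto
qed

text \<open>Left multiplication by \<open>u b\<close> is a homeomorphism commuting with the whole
  flow. It places the orbit of each good point inside the set of good points, which makes that set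
  dense.\<close>

lemma dense_squares_translate:
  assumes add: "\<And>s t. u (s + t) = u s ** u t" and u: "\<And>t. u t \<in> SL2R" and x: "dense_squares u x"
  shows "dense_squares u (act (u b) x)"
  unfolding dense_squares_def
proof (intro allI impI, elim conjE)
  fix W :: "mat2 set" assume W: "open W" "W \<inter> SL2R \<noteq> {}"
  define W' where "W' = (\<lambda>A. u b ** A) -` W"
  have o: "open W'" unfolding W'_def using W(1) by (intro open_vimage continuous_on_matmul continuous_on_const continuous_on_id)
  obtain g where g: "g \<in> W" "g \<in> SL2R" using W(2) by blast
  have "inv2 (u b) ** g \<in> W' \<inter> SL2R" using g u[of b] by (simp add: W'_def inv2_right' SL2R_mult inv2_SL2R)
  hence "W' \<inter> SL2R \<noteq> {}" by blast
  then obtain n :: nat where "act (u (real n ^ 2)) x \<inter> W' \<noteq> {}" using x o unfolding dense_squares_def by blast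
  then obtain A where A: "A \<in> act (u (real n ^ 2)) x" "u b ** A \<in> W" unfolding W'_def by blast
  have "u b ** A \<in> act (u b) (act (u (real n ^ 2)) x)" unfolding act_def[of "u b"] using A(1) by (rule imageI)
  also have "act (u b) (act (u (real n ^ 2)) x) = act (u (real n ^ 2)) (act (u b) x)"
    unfolding act_act add[symmetric] by (simp only: add.commute)
  finally show "\<exists>n::nat. act (u (real n ^ 2)) (act (u b) x) \<inter> W \<noteq> {}" using A(2) by blast
qed

text \<open>The diagonal coordinate is recorded as the time scale \<xi> it induces: with
  \<open>\<mu> = sqrt (\<xi> / c)\<close>, moving \<open>hh (c * t)\<close> past
  \<open>dg (1 / \<mu>)\<close> turns it into \<open>hh (\<xi> * t)\<close>. The point
  \<open>(0, c, 0)\<close> corresponds to the identity.\<close>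

definition chart :: "real \<Rightarrow> real \<times> real \<times> real \<Rightarrow> mat2" where
  "chart c = (\<lambda>(r, \<xi>, s). hh s ** dg (1 / sqrt (\<xi> / c)) ** vv r)"

lemma chart_mk:
  "chart c (r, \<xi>, s) = mk (1 / sqrt (\<xi> / c) + s * sqrt (\<xi> / c) * r) (s * sqrt (\<xi> / c)) (sqrt (\<xi> / c) * r) (sqrt (\<xi> / c))"
  by (simp add: chart_def hh_def dg_def vv_def)

lemma chart_SL2R:
  assumes "\<xi> / c > 0"
  shows "chart c (r, \<xi>, s) \<in> SL2R"
proof -
  have "sqrt (\<xi> / c) > 0" using assms by (simp only: real_sqrt_gt_0_iff)
  thus ?thesis unfolding chart_def by (auto intro!: SL2R_mult hh_SL2R vv_SL2R dg_SL2R)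
qed

lemma horocycle_chart:
  assumes "\<xi> / c > 0"
  shows "hh (c * t) ** chart c (r, \<xi>, s) = hh s ** dg (1 / sqrt (\<xi> / c)) ** (hh (\<xi> * t) ** vv r)"
proof -
  define \<mu> where "\<mu> = sqrt (\<xi> / c)"
  have "\<mu> > 0" unfolding \<mu>_def using assms by (simp only: real_sqrt_gt_0_iff)
  moreover have "\<mu> * \<mu> = \<xi> / c" unfolding \<mu>_def using assms by (simp only: real_sqrt_mult_self abs_of_pos)
  ultimately have \<mu>: "\<mu> \<noteq> 0" "\<mu> * \<mu> = \<xi> / c" by auto
  have c: "c \<noteq> 0" using assms by auto
  have e: "c * t * \<mu> = \<xi> * t / \<mu>" using \<mu> c by (simp add: field_simps)
  have "hh (c * t) ** (hh s ** dg (1 / \<mu>)) = hh s ** dg (1 / \<mu>) ** hh (\<xi> * t)"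
    using e by (simp add: hh_def dg_def)
  moreover have "chart c (r, \<xi>, s) = hh s ** dg (1 / \<mu>) ** vv r" by (simp add: chart_def \<mu>_def)
  ultimately show ?thesis unfolding \<mu>_def[symmetric] by (simp add: matrix_mul_assoc)
qed

lemma dense_squares_chart:
  assumes u: "\<And>t. u t = k ** hh (c * t) ** inv2 k" and k: "k \<in> SL2R" and \<xi>: "\<xi> / c > 0" and g: "generic r \<xi>"
  shows "dense_squares u (coset (k ** chart c (r, \<xi>, s)))"
  unfolding dense_squares_def
proof (intro allI impI, elim conjE)
  fix W :: "mat2 set" assume W: "open W" "W \<inter> SL2R \<noteq> {}"
  define P where "P = k ** (hh s ** dg (1 / sqrt (\<xi> / c)))"
  have "sqrt (\<xi> / c) > 0" using \<xi> by (simp only: real_sqrt_gt_0_iff)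
  hence P: "P \<in> SL2R" unfolding P_def by (auto intro!: SL2R_mult hh_SL2R dg_SL2R k)
  define W' where "W' = (\<lambda>A. P ** A) -` W"
  have o: "open W'" unfolding W'_def using W(1) by (intro open_vimage continuous_on_matmul continuous_on_const continuous_on_id)
  obtain h where h: "h \<in> W" "h \<in> SL2R" using W(2) by blast
  have "inv2 P ** h \<in> W' \<inter> SL2R" using h P by (simp add: W'_def inv2_right' SL2R_mult inv2_SL2R)
  then obtain n :: nat where "visits r (\<xi> * (real n)\<^sup>2) W'" using g o unfolding generic_def by blast
  then obtain \<gamma> where \<gamma>: "\<gamma> \<in> SL2Z" "P ** (hh (\<xi> * (real n)\<^sup>2) ** vv r ** \<gamma>) \<in> W"
    unfolding visits_def W'_def by blast
  have "u ((real n)\<^sup>2) ** (k ** chart c (r, \<xi>, s)) = k ** (hh (c * (real n)\<^sup>2) ** (inv2 k ** (k ** chart c (r, \<xi>, s))))"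
    unfolding u by (simp add: matrix_mul_assoc)
  also have "\<dots> = k ** (hh s ** dg (1 / sqrt (\<xi> / c)) ** (hh (\<xi> * (real n)\<^sup>2) ** vv r))"
    unfolding inv2_left'[OF k] horocycle_chart[OF \<xi>] ..
  also have "\<dots> = P ** (hh (\<xi> * (real n)\<^sup>2) ** vv r)" by (simp add: P_def matrix_mul_assoc)
  finally have eq: "u ((real n)\<^sup>2) ** (k ** chart c (r, \<xi>, s)) = P ** (hh (\<xi> * (real n)\<^sup>2) ** vv r)" .
  have "P ** (hh (\<xi> * (real n)\<^sup>2) ** vv r ** \<gamma>) \<in> coset (u ((real n)\<^sup>2) ** (k ** chart c (r, \<xi>, s)))"
    unfolding eq coset_def using \<gamma>(1) by (intro image_eqI[of _ _ \<gamma>]) (simp_all add: matrix_mul_assoc)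
  hence "P ** (hh (\<xi> * (real n)\<^sup>2) ** vv r ** \<gamma>) \<in> act (u ((real n)\<^sup>2)) (coset (k ** chart c (r, \<xi>, s)))"
    unfolding act_coset .
  thus "\<exists>n::nat. act (u ((real n)\<^sup>2)) (coset (k ** chart c (r, \<xi>, s))) \<inter> W \<noteq> {}"
    using \<gamma>(2) by blast
qed

text \<open>One Tonelli step for a weighted sum of boxes: integrating over one coordinate replaces
  the indicator of each side by a bound for its length. It is applied once for each of the three
  coordinates.\<close>

lemma integrate_out:
  fixes a m :: "nat \<Rightarrow> ennreal" and C :: ennreal
  assumes S: "\<And>i. S i \<in> sets lborel" "\<And>i. emeasure lborel (S i) \<le> m i" and \<rho>: "\<rho> \<ge> 0"
    and ae: "AE x in lborel. x \<in> {b..b + \<rho>} \<longrightarrow> C \<le> (\<Sum>i. a i * indicator (S i) x)"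
  shows "C * ennreal \<rho> \<le> (\<Sum>i. a i * m i)"
proof -
  have "C * ennreal \<rho> = (\<integral>\<^sup>+x. C * indicator {b..b + \<rho>} x \<partial>lborel)"
    using \<rho> by (subst nn_integral_cmult_indicator) auto
  also have "\<dots> \<le> (\<integral>\<^sup>+x. (\<Sum>i. a i * indicator (S i) x) \<partial>lborel)"
    by (rule nn_integral_mono_AE, rule AE_mp[OF ae], rule AE_I2) (auto simp: indicator_def)
  also have "\<dots> = (\<Sum>i. \<integral>\<^sup>+x. a i * indicator (S i) x \<partial>lborel)"
    using S(1) by (intro nn_integral_suminf) auto
  also have "\<dots> = (\<Sum>i. a i * emeasure lborel (S i))"
    using S(1) by (simp add: nn_integral_cmult_indicator)
  also have "\<dots> \<le> (\<Sum>i. a i * m i)"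
    by (intro suminf_le mult_left_mono S) auto
  finally show ?thesis .
qed

section \<open>Local coordinates\<close>

lemma chart_tendsto_1:
  assumes "c \<noteq> 0"
  shows "(chart c \<longlongrightarrow> mat 1) (nhds (0, c, 0))"
proof -
  have "((\<lambda>z. z) \<longlongrightarrow> (0, c, 0)) (nhds (0::real, c, 0::real))" by (rule filterlim_ident)
  from tendsto_fst[OF this] tendsto_fst[OF tendsto_snd[OF this]] tendsto_snd[OF tendsto_snd[OF this]]
  have t: "((\<lambda>z. fst z) \<longlongrightarrow> 0) (nhds (0::real, c, 0::real))" "((\<lambda>z. fst (snd z)) \<longlongrightarrow> c) (nhds (0::real, c, 0::real))"
    "((\<lambda>z. snd (snd z)) \<longlongrightarrow> 0) (nhds (0::real, c, 0::real))" by simp_all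
  have "((\<lambda>z. hh (snd (snd z)) ** dg (1 / sqrt (fst (snd z) / c)) ** vv (fst z)) \<longlongrightarrow> hh 0 ** dg (1 / sqrt (c / c)) ** vv 0) (nhds (0, c, 0))"
    unfolding hh_def dg_def vv_def using t assms by (intro tendsto_intros) auto
  moreover have "hh 0 ** dg (1 / sqrt (c / c)) ** vv 0 = mat 1" using assms by (simp add: hh_def dg_def vv_def mat_1_mk)
  moreover have "chart c = (\<lambda>z. hh (snd (snd z)) ** dg (1 / sqrt (fst (snd z) / c)) ** vv (fst z))"
    by (auto simp: chart_def)
  ultimately show ?thesis by (simp only:)
qed

text \<open>The coordinates are read off the entries: the lower right one is
  \<open>\<mu> = sqrt (\<xi> / c)\<close>, and the off-diagonal ones are \<open>s * \<mu>\<close>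
  and \<open>\<mu> * r\<close>. Near the identity \<mu> lies between 1/2 and 3/2.\<close>

lemma chart_coordinates_lipschitz:
  fixes G G' :: mat2
  assumes G: "G = chart c (r, \<xi>, s)" "G' = chart c (r', \<xi>', s')" and c: "\<xi> / c > 0" "\<xi>' / c > 0"
    and near: "norm (G - mat 1) \<le> 1/2" "norm (G' - mat 1) \<le> 1/2"
    and bd: "\<bar>r'\<bar> \<le> 1" "\<bar>s'\<bar> \<le> 1" and d: "norm (G' - G) \<le> d"
  shows "\<bar>r - r'\<bar> \<le> 4 * d" "\<bar>\<xi> - \<xi>'\<bar> \<le> 3 * \<bar>c\<bar> * d" "\<bar>s - s'\<bar> \<le> 4 * d"
proof -
  define \<mu> \<mu>' where "\<mu> = sqrt (\<xi> / c)" and "\<mu>' = sqrt (\<xi>' / c)"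
  have c0: "c \<noteq> 0" using c by auto
  have e: "G$1$2 = s * \<mu>" "G$2$1 = \<mu> * r" "G$2$2 = \<mu>" "G'$1$2 = s' * \<mu>'" "G'$2$1 = \<mu>' * r'" "G'$2$2 = \<mu>'"
    unfolding G chart_mk \<mu>_def \<mu>'_def by simp_all
  have "\<bar>\<mu> - 1\<bar> \<le> 1/2" "\<bar>\<mu>' - 1\<bar> \<le> 1/2"
    using nth_le_norm[of "G - mat 1" 2 2] nth_le_norm[of "G' - mat 1" 2 2] near by (simp_all add: e mat_1_mk)
  hence \<mu>: "1/2 \<le> \<mu>" "\<mu> \<le> 3/2" "1/2 \<le> \<mu>'" "\<mu>' \<le> 3/2" by linarith+
  have D: "\<bar>G'$i$j - G$i$j\<bar> \<le> d" for i j using nth_le_norm[of "G' - G" i j] d by simp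
  have m: "\<bar>\<mu>' - \<mu>\<bar> \<le> d" using D[of 2 2] by (simp add: e)
  have d0: "d \<ge> 0" using d norm_ge_zero order_trans by blast
  \<comment> \<open>Recovers a coordinate from its product with \<mu>: the numerator is at most
    \<open>2 * d\<close> and the division by \<open>\<mu> \<ge> 1/2\<close> doubles it.\<close>
  have core: "\<bar>x - x'\<bar> \<le> 4 * d" if x: "\<bar>x' * \<mu>' - x * \<mu>\<bar> \<le> d" "\<bar>x'\<bar> \<le> 1" for x x'
  proof -
    have "(x - x') * \<mu> = - (x' * \<mu>' - x * \<mu>) + x' * (\<mu>' - \<mu>)" by (simp add: algebra_simps)
    hence "\<bar>(x - x') * \<mu>\<bar> \<le> \<bar>x' * \<mu>' - x * \<mu>\<bar> + \<bar>x' * (\<mu>' - \<mu>)\<bar>" by linarith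
    also have "\<bar>x' * (\<mu>' - \<mu>)\<bar> \<le> 1 * d" unfolding abs_mult using x(2) m by (intro mult_mono) auto
    finally have "\<bar>x - x'\<bar> * \<mu> \<le> 2 * d" using x(1) \<mu> by (simp add: abs_mult)
    moreover have "\<bar>x - x'\<bar> * (1/2) \<le> \<bar>x - x'\<bar> * \<mu>" using \<mu> by (intro mult_left_mono) auto
    ultimately have "\<bar>x - x'\<bar> * (1/2) \<le> 2 * d" by (rule order_trans[rotated])
    thus ?thesis by simp
  qed
  show "\<bar>s - s'\<bar> \<le> 4 * d" using D[of 1 2] bd by (intro core) (simp_all add: e)
  show "\<bar>r - r'\<bar> \<le> 4 * d" using D[of 2 1] bd by (intro core) (simp_all add: e mult.commute)
  have "\<mu> * \<mu> = \<xi> / c" "\<mu>' * \<mu>' = \<xi>' / c" unfolding \<mu>_def \<mu>'_def using c by (simp_all only: real_sqrt_mult_self abs_of_pos)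
  hence "\<xi> = c * (\<mu> * \<mu>)" "\<xi>' = c * (\<mu>' * \<mu>')" using c0 by (simp_all add: field_simps)
  hence "\<xi> - \<xi>' = - (c * ((\<mu>' - \<mu>) * (\<mu> + \<mu>')))" by (simp add: algebra_simps)
  hence "\<bar>\<xi> - \<xi>'\<bar> = \<bar>c\<bar> * (\<bar>\<mu>' - \<mu>\<bar> * \<bar>\<mu> + \<mu>'\<bar>)" by (simp add: abs_mult)
  also have "\<dots> \<le> \<bar>c\<bar> * (d * 3)" using m \<mu> by (intro mult_left_mono mult_mono) auto
  finally show "\<bar>\<xi> - \<xi>'\<bar> \<le> 3 * \<bar>c\<bar> * d" by simp
qed

definition patch :: "real \<Rightarrow> real \<Rightarrow> (real \<times> real \<times> real) set" where
  "patch c \<rho> = {0..\<rho>} \<times> {c..c + \<rho>} \<times> {0..\<rho>}"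

text \<open>This is the direction that bounds coordinates by distance. The issue is that
  \<open>distX\<close> minimises over representatives: a short displacement between
  \<open>k ** G ** \<gamma>1\<close> and \<open>k ** G' ** \<gamma>2\<close> has to force
  \<open>\<gamma>1 = \<gamma>2\<close>, after which it relates \<open>G\<close> to \<open>G'\<close>
  directly.\<close>

lemma chart_bilipschitz:
  assumes N: "is_norm_on_sl2 N" and k: "k \<in> SL2R" and c: "c \<noteq> 0"
  shows "\<exists>\<rho>>0. \<exists>K>0. \<exists>d0>0. (\<forall>(r, \<xi>, s)\<in>patch c \<rho>. \<xi> / c > 0) \<and>
    (\<forall>(r, \<xi>, s)\<in>patch c \<rho>. \<forall>(r', \<xi>', s')\<in>patch c \<rho>. \<forall>d\<le>d0.
       distX N (coset (k ** chart c (r, \<xi>, s))) (coset (k ** chart c (r', \<xi>', s'))) < d \<longrightarrow>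
         \<bar>r - r'\<bar> \<le> K * d \<and> \<bar>\<xi> - \<xi>'\<bar> \<le> K * d \<and> \<bar>s - s'\<bar> \<le> K * d)"
proof -
  obtain K1 L0 where KL: "K1 > 0" "L0 > 0" "\<forall>A\<in>SL2R. \<forall>B\<in>SL2R. \<forall>L\<le>L0. distG N A B < L \<longrightarrow> norm (B ** inv2 A - mat 1) \<le> K1 * L"
    using distG_displacement[OF N] by (elim exE conjE) (rule that; assumption)
  \<comment> \<open>Expresses \<open>\<gamma>2 ** inv2 \<gamma>1\<close> through the two chart
    points and the displacement \<open>e\<close>; continuity puts it within 1 of
    \<open>mat 1\<close>, and discreteness does the rest.\<close>
  define h where "h = (\<lambda>(p, e, p'). inv2 (chart c p') ** inv2 k ** e ** k ** chart c p)"
  have "(h \<longlongrightarrow> inv2 (mat 1) ** inv2 k ** mat 1 ** k ** mat 1) (nhds ((0,c,0), mat 1, (0,c,0)))"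
  proof -
    have "((\<lambda>z. z) \<longlongrightarrow> ((0,c,0), mat 1, (0,c,0))) (nhds ((0::real,c,0::real), mat 1::mat2, (0::real,c,0::real)))" by (rule filterlim_ident)
    from tendsto_fst[OF this] tendsto_fst[OF tendsto_snd[OF this]] tendsto_snd[OF tendsto_snd[OF this]]
    have t: "((\<lambda>z. fst z) \<longlongrightarrow> (0,c,0)) (nhds ((0::real,c,0::real), mat 1::mat2, (0::real,c,0::real)))"
      "((\<lambda>z. fst (snd z)) \<longlongrightarrow> mat 1) (nhds ((0::real,c,0::real), mat 1::mat2, (0::real,c,0::real)))"
      "((\<lambda>z. snd (snd z)) \<longlongrightarrow> (0,c,0)) (nhds ((0::real,c,0::real), mat 1::mat2, (0::real,c,0::real)))" by simp_all
    show ?thesis unfolding h_def case_prod_beta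
      by (intro tendsto_matmul tendsto_inv2 tendsto_const t(2) filterlim_compose[OF chart_tendsto_1[OF c] t(1)] filterlim_compose[OF chart_tendsto_1[OF c] t(3)])
  qed
  moreover have "inv2 (mat 1) ** inv2 k ** mat 1 ** k ** mat 1 = mat 1"
  proof -
    have "inv2 (mat 1) = mat 1" by (simp add: mat_1_mk)
    thus ?thesis using k by (simp add: inv2_left)
  qed
  ultimately have "eventually (\<lambda>z. dist (h z) (mat 1) < 1) (nhds ((0,c,0), mat 1, (0,c,0)))"
    by (intro tendstoD) simp_all
  then obtain e1 where e1: "e1 > 0" "\<And>p e p'. dist p (0,c,0) < e1 \<Longrightarrow> dist e (mat 1) < e1 \<Longrightarrow> dist p' (0,c,0) < e1 \<Longrightarrow> dist (h (p, e, p')) (mat 1) < 1"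
    by (rule eventually_nhds_tripleE) blast
  have "eventually (\<lambda>z. dist (chart c z) (mat 1) < 1/2) (nhds (0,c,0))"
    by (rule tendstoD[OF chart_tendsto_1[OF c]]) simp
  then obtain e2 where e2: "e2 > 0" "\<And>r \<xi> s. dist r 0 < e2 \<Longrightarrow> dist \<xi> c < e2 \<Longrightarrow> dist s 0 < e2 \<Longrightarrow> dist (chart c (r, \<xi>, s)) (mat 1) < 1/2"
    by (rule eventually_nhds_tripleE) blast
  \<comment> \<open>The bound \<open>|c| / 2\<close> keeps \<xi> of the sign of \<open>c\<close>;
    \<open>e1 / 4\<close> lets three coordinate deviations add up to less than
    \<open>e1\<close>.\<close>
  define \<rho> where "\<rho> = min (min 1 (\<bar>c\<bar> / 2)) (min (e1 / 4) (e2 / 2))"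
  have \<rho>: "\<rho> > 0" "\<rho> \<le> 1" "\<rho> \<le> \<bar>c\<bar> / 2" "\<rho> \<le> e1 / 4" "\<rho> \<le> e2 / 2" using c e1(1) e2(1) by (auto simp: \<rho>_def)
  have pos: "\<xi> / c > 0" if "(r, \<xi>, s) \<in> patch c \<rho>" for r \<xi> s
  proof -
    have "c \<le> \<xi>" "\<xi> \<le> c + \<bar>c\<bar> / 2" using that \<rho>(3) by (auto simp: patch_def)
    thus ?thesis using c by (cases "c > 0") (auto simp: zero_less_divide_iff)
  qed
  have p1: "dist (r, \<xi>, s) (0,c,0) < e1" "dist (chart c (r, \<xi>, s)) (mat 1) < 1/2" if "(r, \<xi>, s) \<in> patch c \<rho>" for r \<xi> s
  proof -
    have b: "\<bar>r\<bar> \<le> \<rho>" "\<bar>\<xi> - c\<bar> \<le> \<rho>" "\<bar>s\<bar> \<le> \<rho>" using that by (auto simp: patch_def)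
    have "dist (r, \<xi>, s) (0,c,0) \<le> dist r 0 + dist (\<xi>, s) (c, 0)"
      unfolding dist_Pair_Pair[of r] by (rule sqrt_sum_squares_le_sum) auto
    moreover have "dist (\<xi>, s) (c, 0) \<le> dist \<xi> c + dist s 0"
      unfolding dist_Pair_Pair[of \<xi>] by (rule sqrt_sum_squares_le_sum) auto
    moreover have dd: "dist r 0 \<le> \<rho>" "dist \<xi> c \<le> \<rho>" "dist s 0 \<le> \<rho>" using b by (auto simp: dist_real_def)
    ultimately show "dist (r, \<xi>, s) (0,c,0) < e1" using \<rho>(1,4) by linarith
    show "dist (chart c (r, \<xi>, s)) (mat 1) < 1/2" using dd \<rho>(1,5) by (intro e2(2)) linarith+
  qed
  \<comment> \<open>Three uses of \<open>norm_mult_le\<close> on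
    \<open>inv2 k ** (e - mat 1) ** k ** G\<close>, with \<open>norm G\<close> at most 3.\<close>
  define K2 where "K2 = 8 * (8 * (8 * norm (inv2 k) * K1) * norm k) * 3"
  have K2: "K2 \<ge> 0" using KL by (simp add: K2_def)
  define K where "K = (4 + 3 * \<bar>c\<bar>) * K2 + 1"
  have K: "K > 0" using K2 by (auto simp: K_def intro!: add_nonneg_pos mult_nonneg_nonneg)
  define d0 where "d0 = min L0 (e1 / (2 * K1))"
  have d0: "d0 > 0" "d0 \<le> L0" "d0 \<le> e1 / (2 * K1)" using KL e1(1) by (auto simp: d0_def)
  have main: "\<bar>r - r'\<bar> \<le> K * d \<and> \<bar>\<xi> - \<xi>'\<bar> \<le> K * d \<and> \<bar>s - s'\<bar> \<le> K * d"
    if p: "(r, \<xi>, s) \<in> patch c \<rho>" "(r', \<xi>', s') \<in> patch c \<rho>" and d: "d \<le> d0"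
      and dX: "distX N (coset (k ** chart c (r, \<xi>, s))) (coset (k ** chart c (r', \<xi>', s'))) < d" for r \<xi> s r' \<xi>' s' d
  proof -
    define G G' where "G = chart c (r, \<xi>, s)" and "G' = chart c (r', \<xi>', s')"
    have GS: "G \<in> SL2R" "G' \<in> SL2R" unfolding G_def G'_def using chart_SL2R pos p by blast+
    have kG: "k ** G \<in> SL2R" "k ** G' \<in> SL2R" using SL2R_mult k GS by blast+
    have X: "coset (k ** G) \<in> Xsp" "coset (k ** G') \<in> Xsp" using kG coset_in_Xsp by blast+
    obtain A B where AB: "A \<in> coset (k ** G)" "B \<in> coset (k ** G')" "distG N A B < d"
      using distX_lessD[OF X dX[folded G_def G'_def]] by (elim bexE) (rule that; assumption)
    obtain \<gamma>1 where \<gamma>1: "\<gamma>1 \<in> SL2Z" "A = k ** G ** \<gamma>1" using AB(1) unfolding coset_def by (elim imageE) (rule that; assumption)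
    obtain \<gamma>2 where \<gamma>2: "\<gamma>2 \<in> SL2Z" "B = k ** G' ** \<gamma>2" using AB(2) unfolding coset_def by (elim imageE) (rule that; assumption)
    have ABS: "A \<in> SL2R" "B \<in> SL2R" using Xsp_memD X AB by blast+
    define e where "e = B ** inv2 A"
    have e: "norm (e - mat 1) \<le> K1 * d" unfolding e_def
      using KL(3) ABS AB(3) d d0(2) by simp
    have "K1 * d \<le> K1 * (e1 / (2 * K1))" using KL(1) d d0(3) by (intro mult_left_mono) auto
    also have "\<dots> < e1" using KL(1) e1(1) by simp
    finally have ee: "dist e (mat 1) < e1" using e by (simp add: dist_norm)
    have inv: "inv2 k ** (k ** C) = C" "inv2 G ** (G ** C) = C" "inv2 G' ** (G' ** C) = C" for C
      using inv2_left' k GS by blast+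
    have "h ((r, \<xi>, s), e, (r', \<xi>', s')) = inv2 G' ** (inv2 k ** (k ** (G' ** (\<gamma>2 ** inv2 \<gamma>1 ** (inv2 G ** (inv2 k ** (k ** G)))))))"
      unfolding h_def e_def \<gamma>1(2) \<gamma>2(2) by (simp add: inv2_mult matrix_mul_assoc flip: G_def G'_def)
    also have "\<dots> = \<gamma>2 ** inv2 \<gamma>1" using GS(1) by (simp only: inv inv2_left matrix_mul_rid)
    finally have hg: "h ((r, \<xi>, s), e, (r', \<xi>', s')) = \<gamma>2 ** inv2 \<gamma>1" .
    have "dist (\<gamma>2 ** inv2 \<gamma>1) (mat 1) < 1" using e1(2)[OF p1(1)[OF p(1)] ee p1(1)[OF p(2)]] unfolding hg .
    hence g1: "\<gamma>2 ** inv2 \<gamma>1 = mat 1"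
      using SL2Z_near_1[OF SL2Z_mult[OF \<gamma>2(1) inv2_SL2Z[OF \<gamma>1(1)]]] by (simp add: dist_norm)
    have "e ** (k ** G) = k ** (G' ** (\<gamma>2 ** inv2 \<gamma>1 ** (inv2 G ** (inv2 k ** (k ** G)))))"
      unfolding e_def \<gamma>1(2) \<gamma>2(2) by (simp add: inv2_mult matrix_mul_assoc)
    also have "\<dots> = k ** G'" using GS(1) by (simp only: inv g1 inv2_left matrix_mul_rid)
    finally have eG: "e ** (k ** G) = k ** G'" .
    have sub: "A0 ** (B0 - C0) = A0 ** B0 - A0 ** C0" "(B0 - C0) ** A0 = B0 ** A0 - C0 ** A0" for A0 B0 C0 :: mat2
      by (simp_all add: mat2_eq_iff mult_nth_2 algebra_simps)
    have "inv2 k ** (e - mat 1) ** k ** G = inv2 k ** (e ** (k ** G)) - inv2 k ** (k ** G)"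
      by (simp add: sub matrix_mul_assoc)
    hence diff: "G' - G = inv2 k ** (e - mat 1) ** k ** G" unfolding eG inv by simp
    have n1: "norm (mat 1 :: mat2) \<le> 2" using norm_mat2_le[of "mat 1"] by (simp add: mat_1_mk)
    have Gn: "norm (G - mat 1) \<le> 1/2" "norm (G' - mat 1) \<le> 1/2"
      using p1(2)[OF p(1)] p1(2)[OF p(2)] by (simp_all add: G_def G'_def dist_norm)
    have "norm G \<le> norm (G - mat 1) + norm (mat 1 :: mat2)" using norm_triangle_ineq[of "G - mat 1" "mat 1"] by simp
    hence G3: "norm G \<le> 3" using Gn n1 by linarith
    have d00: "0 \<le> K1 * d" using e norm_ge_zero order_trans by blast
    have "norm (inv2 k ** (e - mat 1)) \<le> 8 * norm (inv2 k) * (K1 * d)"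
      by (rule order_trans[OF norm_mult_le]) (use e in \<open>intro mult_left_mono; simp\<close>)
    hence "8 * norm (inv2 k ** (e - mat 1)) * norm k \<le> 8 * (8 * norm (inv2 k) * (K1 * d)) * norm k"
      by (intro mult_right_mono mult_left_mono[of _ _ 8]) (assumption | simp)+
    hence nk: "norm (inv2 k ** (e - mat 1) ** k) \<le> 8 * (8 * norm (inv2 k) * (K1 * d)) * norm k"
      by (rule order_trans[OF norm_mult_le])
    define Z where "Z = 8 * (8 * norm (inv2 k) * (K1 * d)) * norm k"
    have Z: "norm (inv2 k ** (e - mat 1) ** k) \<le> Z" using nk by (simp only: Z_def)
    hence "0 \<le> Z" using norm_ge_zero order_trans by blast
    hence "8 * norm (inv2 k ** (e - mat 1) ** k) * norm G \<le> 8 * Z * 3"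
      using Z G3 by (intro mult_mono) auto
    hence "norm (G' - G) \<le> 8 * Z * 3"
      unfolding diff by (rule order_trans[OF norm_mult_le])
    hence dG: "norm (G' - G) \<le> K2 * d" by (simp add: K2_def Z_def mult_ac)
    have bd: "\<bar>r'\<bar> \<le> 1" "\<bar>s'\<bar> \<le> 1" using p(2) \<rho>(2) by (auto simp: patch_def)
    note lip = chart_coordinates_lipschitz[OF G_def G'_def pos[OF p(1)] pos[OF p(2)] Gn bd dG]
    have dpos: "0 \<le> d" using d00 KL(1) by (simp add: zero_le_mult_iff)
    have "K2 * d \<ge> 0" using K2 dpos by simp
    moreover have "3 * \<bar>c\<bar> * (K2 * d) \<ge> 0" using K2 dpos by simp
    moreover have "K * d = 4 * (K2 * d) + 3 * \<bar>c\<bar> * (K2 * d) + d" by (simp add: K_def algebra_simps)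
    ultimately have "4 * (K2 * d) \<le> K * d" "3 * \<bar>c\<bar> * (K2 * d) \<le> K * d" using dpos by linarith+
    thus ?thesis using lip by linarith
  qed
  show ?thesis
    by (intro exI[of _ \<rho>] exI[of _ K] exI[of _ d0] conjI \<rho>(1) K d0(1); clarify; (rule pos main; assumption))
qed

section \<open>Hausdorff dimension\<close>

text \<open>Stated as an iterated property to match the one-coordinate integrations in
  \<open>cube_covering\<close>.\<close>

lemma generic_null:
  "AE r in lborel. AE \<xi> in lborel. generic r \<xi>"
proof -
  have *: "AE x in lborel. P x" if n: "negligible {x::real. \<not> P x}" for P
  proof -
    have "{x. \<not> P x} \<in> null_sets lebesgue" using n by (simp add: negligible_iff_null_sets)
    then obtain S where "S \<in> null_sets lborel" "{x. \<not> P x} \<subseteq> S"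
      using null_sets_completion_iff2 by metis
    thus ?thesis by (intro AE_I'[of S]) auto
  qed
  have "AE r in lborel. well_approximable r" by (rule * negligible_not_well_approximable)+
  moreover have "AE \<xi> in lborel. generic r \<xi>" if "well_approximable r" for r
    by (rule *) (rule negligible_not_generic[OF that])
  ultimately show ?thesis by (auto elim: AE_mp)
qed

text \<open>Since \<open>enn2real\<close> sends infinity to 0, the finite bound \<delta> is what
  makes the conversion faithful.\<close>

lemma hdiam_enn2real:
  assumes "hdiam d U \<le> ennreal \<delta>" "x \<in> U" "y \<in> U"
  shows "d x y \<le> enn2real (hdiam d U)"
proof -
  have "ennreal (d x y) \<le> hdiam d U"
    unfolding hdiam_def using assms(2,3) by (intro SUP_upper2[of "(x, y)"]) auto
  moreover have "hdiam d U = ennreal (enn2real (hdiam d U))"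
    using assms(1) by (simp add: ennreal_enn2real_if) (metis ennreal_less_top infinity_ennreal_def leD)
  ultimately have "ennreal (d x y) \<le> ennreal (enn2real (hdiam d U))" by simp
  thus ?thesis by (simp add: ennreal_le_iff)
qed

text \<open>Only the covering boxes are integrated, so no measurability of \<open>P\<close> is needed.\<close>
lemma cube_covering:
  fixes D :: "nat \<Rightarrow> real"
  assumes \<rho>: "\<rho> > 0" and K: "K > 0" and D: "\<And>i. D i \<ge> 0"
    and good: "AE r in lborel. AE \<xi> in lborel. P r \<xi>"
    and cov: "\<And>r \<xi> s. P r \<xi> \<Longrightarrow> (r, \<xi>, s) \<in> patch c \<rho> \<Longrightarrow> \<exists>i. (r, \<xi>, s) \<in> B i"
    and B: "\<And>i r \<xi> s r' \<xi>' s'. (r, \<xi>, s) \<in> B i \<Longrightarrow> (r', \<xi>', s') \<in> B i \<Longrightarrow>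
        \<bar>r - r'\<bar> \<le> K * D i \<and> \<bar>\<xi> - \<xi>'\<bar> \<le> K * D i \<and> \<bar>s - s'\<bar> \<le> K * D i"
  shows "ennreal (\<rho> ^ 3 / (8 * K ^ 3)) \<le> (\<Sum>i. ennreal (D i ^ 3))"
proof -
  \<comment> \<open>A nonempty \<open>B i\<close> lies in the box of side \<open>2 * K * D i\<close>
    around any of its points. For empty \<open>B i\<close> the choice is arbitrary, and
    \<open>I\<close> is made empty.\<close>
  define z where "z = (\<lambda>i. SOME p. p \<in> B i)"
  define I where "I = (\<lambda>i t. if B i = {} then {} else {t - K * D i .. t + K * D i})"
  define m where "m = (\<lambda>i. ennreal (2 * K * D i))"
  have I: "I i t \<in> sets lborel" "emeasure lborel (I i t) \<le> m i" for i t
    using K D[of i] by (auto simp: I_def m_def intro!: ennreal_leI)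
  define R X S where "R = (\<lambda>i. I i (fst (z i)))" and "X = (\<lambda>i. I i (fst (snd (z i))))" and "S = (\<lambda>i. I i (snd (snd (z i))))"
  have ind: "1 \<le> (\<Sum>i. indicator (R i) r * indicator (X i) \<xi> * (indicator (S i) s :: ennreal))"
    if p: "P r \<xi>" "(r, \<xi>, s) \<in> patch c \<rho>" for r \<xi> s
  proof -
    obtain i where i: "(r, \<xi>, s) \<in> B i" using cov[OF p] by blast
    hence zi: "z i \<in> B i" unfolding z_def by (rule someI)
    obtain r' \<xi>' s' where z': "z i = (r', \<xi>', s')" by (cases "z i") auto
    have "\<bar>r - r'\<bar> \<le> K * D i \<and> \<bar>\<xi> - \<xi>'\<bar> \<le> K * D i \<and> \<bar>s - s'\<bar> \<le> K * D i"
      by (rule B[OF i zi[unfolded z']])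
    hence "r \<in> R i" "\<xi> \<in> X i" "s \<in> S i" using i by (auto simp: R_def X_def S_def I_def z' abs_le_iff)
    hence "1 = (\<Sum>j\<in>{i}. indicator (R j) r * indicator (X j) \<xi> * (indicator (S j) s :: ennreal))" by simp
    also have "\<dots> \<le> (\<Sum>j. indicator (R j) r * indicator (X j) \<xi> * indicator (S j) s)"
      by (rule sum_le_suminf) auto
    finally show ?thesis .
  qed
  \<comment> \<open>The order of integration follows the quantifiers of the hypothesis:
    \<open>P\<close> leaves \<open>s\<close> free, holds for almost every \<xi>, and this for almost
    every \<open>r\<close>.\<close>
  have s1: "1 * ennreal \<rho> \<le> (\<Sum>i. (indicator (R i) r * indicator (X i) \<xi>) * m i)"
    if p: "P r \<xi>" "r \<in> {0..0 + \<rho>}" "\<xi> \<in> {c..c + \<rho>}" for r \<xi>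
  proof (rule integrate_out[where b = 0 and S = S])
    show "AE s in lborel. s \<in> {0..0 + \<rho>} \<longrightarrow> 1 \<le> (\<Sum>i. indicator (R i) r * indicator (X i) \<xi> * (indicator (S i) s :: ennreal))"
      by (rule AE_I2, rule impI, rule ind) (use p in \<open>auto simp: patch_def\<close>)
  qed (use I \<rho> in \<open>auto simp: S_def\<close>)
  have s2: "1 * ennreal \<rho> * ennreal \<rho> \<le> (\<Sum>i. (indicator (R i) r * m i) * m i)"
    if p: "AE \<xi> in lborel. P r \<xi>" "r \<in> {0..0 + \<rho>}" for r
  proof (rule integrate_out[where b = c and S = X])
    show "AE \<xi> in lborel. \<xi> \<in> {c..c + \<rho>} \<longrightarrow> 1 * ennreal \<rho> \<le> (\<Sum>i. (indicator (R i) r * m i) * indicator (X i) \<xi>)"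
    proof (rule AE_mp[OF p(1)], rule AE_I2, intro impI)
      fix \<xi> assume "P r \<xi>" "\<xi> \<in> {c..c + \<rho>}"
      from s1[OF this(1) p(2) this(2)]
      show "1 * ennreal \<rho> \<le> (\<Sum>i. (indicator (R i) r * m i) * indicator (X i) \<xi>)" by (simp add: mult_ac)
    qed
  qed (use I \<rho> in \<open>auto simp: X_def\<close>)
  have s3: "1 * ennreal \<rho> * ennreal \<rho> * ennreal \<rho> \<le> (\<Sum>i. (m i * m i) * m i)"
  proof (rule integrate_out[where b = 0 and S = R])
    show "AE r in lborel. r \<in> {0..0 + \<rho>} \<longrightarrow> 1 * ennreal \<rho> * ennreal \<rho> \<le> (\<Sum>i. (m i * m i) * indicator (R i) r)"
    proof (rule AE_mp[OF good], rule AE_I2, intro impI)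
      fix r assume "AE \<xi> in lborel. P r \<xi>" "r \<in> {0..0 + \<rho>}"
      from s2[OF this]
      show "1 * ennreal \<rho> * ennreal \<rho> \<le> (\<Sum>i. (m i * m i) * indicator (R i) r)" by (simp add: mult_ac)
    qed
  qed (use I \<rho> in \<open>auto simp: R_def\<close>)
  have "ennreal (\<rho> ^ 3) \<le> (\<Sum>i. ennreal (8 * K ^ 3) * ennreal (D i ^ 3))"
  proof -
    have "(m i * m i) * m i = ennreal (8 * K ^ 3) * ennreal (D i ^ 3)" for i
      using K D[of i] by (simp add: m_def power3_eq_cube mult_ac flip: ennreal_mult)
    moreover have "1 * ennreal \<rho> * ennreal \<rho> * ennreal \<rho> = ennreal (\<rho> ^ 3)"
      using \<rho> by (simp add: power3_eq_cube flip: ennreal_mult)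
    ultimately show ?thesis using s3 by simp
  qed
  hence "ennreal (\<rho> ^ 3) \<le> ennreal (8 * K ^ 3) * (\<Sum>i. ennreal (D i ^ 3))" by simp
  hence "ennreal (1 / (8 * K ^ 3)) * ennreal (\<rho> ^ 3) \<le> ennreal (1 / (8 * K ^ 3)) * (ennreal (8 * K ^ 3) * (\<Sum>i. ennreal (D i ^ 3)))"
    by (rule mult_left_mono) simp
  also have "\<dots> = ennreal (1 / (8 * K ^ 3) * (8 * K ^ 3)) * (\<Sum>i. ennreal (D i ^ 3))"
    using K by (subst ennreal_mult) (auto simp: mult.assoc)
  also have "1 / (8 * K ^ 3) * (8 * K ^ 3) = 1" using K by simp
  also have "ennreal (1 / (8 * K ^ 3)) * ennreal (\<rho> ^ 3) = ennreal (\<rho> ^ 3 / (8 * K ^ 3))"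
    using K \<rho> by (simp flip: ennreal_mult)
  finally show ?thesis by simp
qed

text \<open>The cubes of the diameters of any fine cover dominate the volume of a coordinate box.
  This single bound yields both uncountability and the dimension; \<open>\<delta> \<le> 1\<close>
  serves the comparison of exponents there.\<close>

lemma covering_bound:
  assumes N: "is_norm_on_sl2 N" and k: "k \<in> SL2R" and c: "c \<noteq> 0" and u: "\<And>t. u t = k ** hh (c * t) ** inv2 k"
  shows "\<exists>\<kappa>>0. \<exists>\<delta>>0. \<delta> \<le> 1 \<and> (\<forall>U :: nat \<Rightarrow> mat2 set set. (\<forall>i. hdiam (distX N) (U i) \<le> ennreal \<delta>) \<longrightarrow>
      {x\<in>Xsp. dense_squares u x} \<subseteq> (\<Union>i. U i) \<longrightarrow> ennreal \<kappa> \<le> (\<Sum>i. ennreal (enn2real (hdiam (distX N) (U i)) ^ 3)))"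
proof -
  obtain \<rho> K d0 where \<rho>: "\<rho> > 0" "K > 0" "d0 > 0" and pos: "\<forall>(r, \<xi>, s)\<in>patch c \<rho>. \<xi> / c > 0" and
    lip: "\<forall>(r, \<xi>, s)\<in>patch c \<rho>. \<forall>(r', \<xi>', s')\<in>patch c \<rho>. \<forall>d\<le>d0.
       distX N (coset (k ** chart c (r, \<xi>, s))) (coset (k ** chart c (r', \<xi>', s'))) < d \<longrightarrow>
         \<bar>r - r'\<bar> \<le> K * d \<and> \<bar>\<xi> - \<xi>'\<bar> \<le> K * d \<and> \<bar>s - s'\<bar> \<le> K * d"
    using chart_bilipschitz[OF N k c] by (elim exE conjE) (rule that; assumption)
  define \<delta> where "\<delta> = min (d0 / 2) 1"
  have \<delta>: "\<delta> > 0" "\<delta> \<le> 1" "\<delta> < d0" using \<rho>(3) by (auto simp: \<delta>_def)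
  have main: "ennreal (\<rho> ^ 3 / (8 * K ^ 3)) \<le> (\<Sum>i. ennreal (enn2real (hdiam (distX N) (U i)) ^ 3))"
    if U: "\<forall>i. hdiam (distX N) (U i) \<le> ennreal \<delta>" "{x\<in>Xsp. dense_squares u x} \<subseteq> (\<Union>i. U i)" for U :: "nat \<Rightarrow> mat2 set set"
  proof -
    define D where "D = (\<lambda>i. enn2real (hdiam (distX N) (U i)))"
    define B where "B = (\<lambda>i. {p\<in>patch c \<rho>. coset (k ** chart c p) \<in> U i})"
    have D: "D i \<ge> 0" "D i < d0" for i
    proof -
      show "D i \<ge> 0" by (simp add: D_def)
      have "D i \<le> enn2real (ennreal \<delta>)" unfolding D_def using U(1) by (intro enn2real_mono) auto
      thus "D i < d0" using \<delta> by simp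
    qed
    have "ennreal (\<rho> ^ 3 / (8 * K ^ 3)) \<le> (\<Sum>i. ennreal (D i ^ 3))"
    proof (rule cube_covering[OF \<rho>(1,2) D(1) generic_null])
      fix r \<xi> s assume g: "generic r \<xi>" and p: "(r, \<xi>, s) \<in> patch c \<rho>"
      have xi: "\<xi> / c > 0" using pos p by blast
      have "coset (k ** chart c (r, \<xi>, s)) \<in> Xsp" by (intro coset_in_Xsp SL2R_mult k chart_SL2R xi)
      moreover have "dense_squares u (coset (k ** chart c (r, \<xi>, s)))" by (rule dense_squares_chart[OF u k xi g])
      ultimately obtain i where "coset (k ** chart c (r, \<xi>, s)) \<in> U i" using U(2) by blast
      thus "\<exists>i. (r, \<xi>, s) \<in> B i" using p unfolding B_def by blast
    next
      fix i r \<xi> s r' \<xi>' s' assume b: "(r, \<xi>, s) \<in> B i" "(r', \<xi>', s') \<in> B i"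
      let ?x = "coset (k ** chart c (r, \<xi>, s))" and ?y = "coset (k ** chart c (r', \<xi>', s'))"
      have "distX N ?x ?y \<le> D i" unfolding D_def
        by (rule hdiam_enn2real[OF U(1)[rule_format]]) (use b in \<open>simp_all add: B_def\<close>)
      hence all: "\<bar>r - r'\<bar> \<le> K * d \<and> \<bar>\<xi> - \<xi>'\<bar> \<le> K * d \<and> \<bar>s - s'\<bar> \<le> K * d" if "D i < d" "d < d0" for d
        using lip b that unfolding B_def by fastforce
      \<comment> \<open>\<open>chart_bilipschitz\<close> requires a strict bound on the distance, so
        it is applied with every \<open>d\<close> between \<open>D i\<close> and \<open>d0\<close>,
        and \<open>d\<close> is lowered to \<open>D i\<close>. The choice
        \<open>\<delta> < d0\<close> leaves this room.\<close>
      have lim: "a \<le> K * D i" if "\<And>d. D i < d \<Longrightarrow> d < d0 \<Longrightarrow> a \<le> K * d" for a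
      proof -
        have "a / K \<le> D i"
          by (rule dense_ge_bounded[OF D(2)]) (use that \<rho>(2) in \<open>simp add: field_simps\<close>)
        thus ?thesis using \<rho>(2) by (simp add: field_simps)
      qed
      show "\<bar>r - r'\<bar> \<le> K * D i \<and> \<bar>\<xi> - \<xi>'\<bar> \<le> K * D i \<and> \<bar>s - s'\<bar> \<le> K * D i"
        by (intro conjI lim) (use all in blast)+
    qed
    thus ?thesis by (simp add: D_def)
  qed
  have "\<rho> ^ 3 / (8 * K ^ 3) > 0" using \<rho> by simp
  thus ?thesis using \<delta> main
    by (intro exI[of _ "\<rho> ^ 3 / (8 * K ^ 3)"] exI[of _ \<delta>] conjI allI impI)
qed

text \<open>One inequality is enough for the diameter of a singleton, because \<open>ennreal\<close>
  truncates at 0.\<close>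

lemma distX_self:
  assumes N: "is_norm_on_sl2 N" and x: "x \<in> Xsp"
  shows "distX N x x \<le> 0"
proof (rule field_le_epsilon)
  fix e :: real assume e: "e > 0"
  obtain A where A: "A \<in> SL2R" "x = coset A" using x by (rule Xsp_cosetE)
  obtain \<delta> where \<delta>: "\<delta> > 0" "\<forall>A\<in>SL2R. \<forall>B\<in>SL2R. norm (B ** inv2 A - mat 1) < \<delta> \<longrightarrow> distG N A B < e"
    using distG_small[OF N e] by (elim exE conjE) (rule that; assumption)
  have "distX N x x \<le> distG N A A" by (rule distX_le[OF N x x]) (simp_all add: A(2) mem_coset_self)
  moreover have "norm (A ** inv2 A - mat 1) < \<delta>" using A(1) \<delta>(1) by (simp add: inv2_right)
  ultimately show "distX N x x \<le> 0 + e" using \<delta>(2) A(1) by fastforce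
qed

text \<open>A countable set is covered by singletons of diameter 0, which contradicts
  \<open>covering_bound\<close>.\<close>

lemma uncountable_dense_squares:
  assumes N: "is_norm_on_sl2 N" and k: "k \<in> SL2R" and c: "c \<noteq> 0" and u: "\<And>t. u t = k ** hh (c * t) ** inv2 k"
  shows "uncountable {x\<in>Xsp. dense_squares u x}"
proof
  let ?E = "{x\<in>Xsp. dense_squares u x}"
  assume count: "countable ?E"
  obtain \<kappa> \<delta> where b: "\<kappa> > 0" "\<delta> > 0" "\<delta> \<le> 1" "\<forall>U :: nat \<Rightarrow> mat2 set set. (\<forall>i. hdiam (distX N) (U i) \<le> ennreal \<delta>) \<longrightarrow>
      ?E \<subseteq> (\<Union>i. U i) \<longrightarrow> ennreal \<kappa> \<le> (\<Sum>i. ennreal (enn2real (hdiam (distX N) (U i)) ^ 3))"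
    using covering_bound[OF N k c u] by (elim exE conjE) (rule that; assumption)
  \<comment> \<open>The empty case is separated because \<open>from_nat_into\<close> gives no
    information about an empty set.\<close>
  define U where "U = (\<lambda>i. if ?E = {} then {} else {from_nat_into ?E i})"
  have z: "hdiam (distX N) (U i) = 0" for i
  proof (cases "?E = {}")
    case True thus ?thesis by (simp add: U_def hdiam_def bot_ennreal)
  next
    case False
    have "from_nat_into ?E i \<in> Xsp" using from_nat_into[OF False, of i] by simp
    hence "ennreal (distX N (from_nat_into ?E i) (from_nat_into ?E i)) = 0"
      using distX_self[OF N] by (simp add: ennreal_neg)
    moreover have "U i = {from_nat_into ?E i}" using False unfolding U_def by (simp only: if_False)
    ultimately show ?thesis by (simp add: hdiam_def)
  qed
  have cov: "?E \<subseteq> (\<Union>i. U i)"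
  proof
    fix x assume x: "x \<in> ?E"
    then obtain i where "from_nat_into ?E i = x" using from_nat_into_surj[OF count x] by blast
    thus "x \<in> (\<Union>i. U i)" using x unfolding U_def by auto
  qed
  have small: "\<forall>i. hdiam (distX N) (U i) \<le> ennreal \<delta>" by (simp add: z)
  have "ennreal \<kappa> \<le> (\<Sum>i. ennreal (enn2real (hdiam (distX N) (U i)) ^ 3))"
    by (rule b(4)[THEN spec, THEN mp, THEN mp, OF small cov])
  thus False using b(1) by (simp add: z)
qed

text \<open>For diameters at most 1 and \<open>s \<le> 3\<close> a cube is at most the power
  \<open>s\<close>. So the content at scale \<delta> is at least \<kappa>, and the supremum over
  scales is positive for each such \<open>s\<close>.\<close>

lemma hausdorff_dim_dense_squares:
  assumes N: "is_norm_on_sl2 N" and k: "k \<in> SL2R" and c: "c \<noteq> 0" and u: "\<And>t. u t = k ** hh (c * t) ** inv2 k"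
  shows "hausdorff_dim (distX N) Xsp {x\<in>Xsp. dense_squares u x} \<ge> 3"
proof -
  let ?E = "{x\<in>Xsp. dense_squares u x}"
  obtain \<kappa> \<delta> where b: "\<kappa> > 0" "\<delta> > 0" "\<delta> \<le> 1" "\<forall>U :: nat \<Rightarrow> mat2 set set. (\<forall>i. hdiam (distX N) (U i) \<le> ennreal \<delta>) \<longrightarrow>
      ?E \<subseteq> (\<Union>i. U i) \<longrightarrow> ennreal \<kappa> \<le> (\<Sum>i. ennreal (enn2real (hdiam (distX N) (U i)) ^ 3))"
    using covering_bound[OF N k c u] by (elim exE conjE) (rule that; assumption)
  have pos: "hausdorff_measure (distX N) Xsp s ?E \<noteq> 0" if s: "s \<le> 3" for s
  proof -
    have "ennreal \<kappa> \<le> hausdorff_content (distX N) Xsp s \<delta> ?E"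
      unfolding hausdorff_content_def
    proof (rule INF_greatest)
      fix U assume "U \<in> {U :: nat \<Rightarrow> mat2 set set. (\<forall>i. U i \<subseteq> Xsp \<and> hdiam (distX N) (U i) \<le> ennreal \<delta>) \<and> ?E \<subseteq> (\<Union>i. U i)}"
      hence U: "\<forall>i. hdiam (distX N) (U i) \<le> ennreal \<delta>" "?E \<subseteq> (\<Union>i. U i)" by auto
      have "ennreal \<kappa> \<le> (\<Sum>i. ennreal (enn2real (hdiam (distX N) (U i)) ^ 3))" using b(4)[THEN spec, THEN mp, THEN mp, OF U] .
      also have "\<dots> \<le> (\<Sum>i. ennreal (enn2real (hdiam (distX N) (U i)) powr s))"
      proof (intro suminf_le ennreal_leI)
        fix i
        have "enn2real (hdiam (distX N) (U i)) \<le> enn2real (ennreal \<delta>)" using U(1) by (intro enn2real_mono) auto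
        hence "enn2real (hdiam (distX N) (U i)) \<le> 1" using b(2,3) by simp
        thus "enn2real (hdiam (distX N) (U i)) ^ 3 \<le> enn2real (hdiam (distX N) (U i)) powr s"
          using powr_mono'[OF s, of "enn2real (hdiam (distX N) (U i))"] by (simp add: powr_numeral)
      qed auto
      finally show "ennreal \<kappa> \<le> (\<Sum>i. ennreal (enn2real (hdiam (distX N) (U i)) powr s))" .
    qed
    also have "\<dots> \<le> hausdorff_measure (distX N) Xsp s ?E"
      unfolding hausdorff_measure_def by (rule SUP_upper) (use b(2) in simp)
    finally show ?thesis using b(1) by auto
  qed
  show ?thesis unfolding hausdorff_dim_def
  proof (rule Inf_greatest)
    fix x assume "x \<in> {ereal s |s. 0 < s \<and> hausdorff_measure (distX N) Xsp s ?E = 0}"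
    then obtain s where "x = ereal s" "hausdorff_measure (distX N) Xsp s ?E = 0" by blast
    thus "3 \<le> x" using pos[of s] by (cases "s \<le> 3") auto
  qed
qed

theorem theorem1p3:
  fixes u :: "real \<Rightarrow> real^2^2" and N :: "real^2^2 \<Rightarrow> real"
  assumes "unipotent_one_param u"
    and "is_norm_on_sl2 N"
  shows "\<exists>E. E \<subseteq> Xsp \<and> uncountable E \<and> denseX N E \<and>
           (\<forall>x\<in>E. denseX N {act (u (real n ^ 2)) x | n. True}) \<and>
           hausdorff_dim (distX N) Xsp E > 2"
proof -
  obtain k c where k: "k \<in> SL2R" and c: "c \<noteq> 0" and u: "\<And>t. u t = k ** hh (c * t) ** inv2 k"
    using unipotent_conjugate[OF assms(1)] by blast
  have uS: "u t \<in> SL2R" and add: "u (s + t) = u s ** u t" for s t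
    using assms(1) by (auto simp: unipotent_one_param_def)
  define E where "E = {x\<in>Xsp. dense_squares u x}"
  have orbit: "denseX N {act (u (real n ^ 2)) x | n. True}" if "x \<in> E" for x
    using that by (intro denseX_if_dense_squares[OF assms(2) uS]) (auto simp: E_def)
  have unc: "uncountable E" unfolding E_def by (rule uncountable_dense_squares[OF assms(2) k c u])
  have "hausdorff_dim (distX N) Xsp E \<ge> 3" unfolding E_def by (rule hausdorff_dim_dense_squares[OF assms(2) k c u])
  moreover have "(2::ereal) < 3" by simp
  ultimately have dim: "hausdorff_dim (distX N) Xsp E > 2" by (rule less_le_trans[rotated])
  have "E \<noteq> {}" using unc by auto
  then obtain x where x: "x \<in> E" by blast
  \<comment> \<open>\<open>E\<close> contains the square-time orbit of each of its points, so one
    dense orbit already makes \<open>E\<close> dense.\<close>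
  have sub: "{act (u (real n ^ 2)) x | n. True} \<subseteq> E"
    using x dense_squares_translate[OF add uS] act_Xsp[OF uS] by (auto simp: E_def)
  have "denseX N E"
    unfolding denseX_def
  proof (intro conjI ballI allI impI)
    show "E \<subseteq> Xsp" by (auto simp: E_def)
    fix y and \<epsilon> :: real assume "y \<in> Xsp" "\<epsilon> > 0"
    then obtain z where "z \<in> {act (u (real n ^ 2)) x | n. True}" "distX N z y < \<epsilon>"
      using orbit[OF x] unfolding denseX_def by blast
    thus "\<exists>z\<in>E. distX N z y < \<epsilon>" using sub by blast
  qed
  thus ?thesis using unc orbit dim by (intro exI[of _ E]) (auto simp: E_def)
qed

end
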